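(* Suppose that for the family $f_c(z)=z^2+c$ all non-constant polynomials $\Delta_{n,m}\in\mathbb{Z}[c]$ (positive integers $m\mid n$) are irreducible over $\mathbb{Q}$. Then there is no parabolic parameter for $f_c(z)=z^2+c$ of degree $5$ over $\mathbb{Q}$ and none of degree $7$ over $\mathbb{Q}$.
   Context: $\gamma\in\mathbb{C}$ is a parabolic parameter if $f_\gamma(z)=z^2+\gamma$ has a parabolic periodic point in $\mathbb{C}$, i.e. a point $\alpha$ of some period $m$ whose multiplier $(f_\gamma^{\circ m})'(\alpha)$ is a root of unity. Definition of $\Delta_{n,m}$: with $c$ an indeterminate and $f(z)=z^2+c$, let $\Phi_n^*(z)=\prod_{k\mid n}(f^{\circ k}(z)-z)^{\mu(n/k)}$ ($\mu$ the Möbius function), and let $\delta_n(x)\in\mathbb{Z}[c][x]$ be the monic polynomial in $x$ with $\delta_n(x)^n=\prod_{\Phi_n^*(\alpha)=0}(x-(f^{\circ n})'(\alpha))$ (roots in $\overline{\mathbb{Q}(c)}$ with multiplicity). For $m\mid n$, $m<n$, put $\Delta_{n,m}=\mathrm{Res}_x(\Phi^{\mathrm{cyc}}_{n/m}(x),\delta_m(x))$, where $\Phi^{\mathrm{cyc}}_i$ is the $i$-th cyclotomic polynomial, and define $\Delta_{n,n}$ by $\delta_n(1)=\Delta_{n,n}\prod_{m\mid n,\,m\ne n}\Delta_{n,m}$. All $\Delta_{n,m}$ are polynomials in $\mathbb{Z}[c]$. *)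

theory Defs
  imports
    "HOL-Algebra.Algebraic_Closure_Type"
    "Subresultants.Resultant_Prelim"
begin

hide_const (open) Polynomials.degree Divisibility.irreducible

definition moebius :: "nat \<Rightarrow> int" where
  "moebius n = (if squarefree n then (- 1) ^ card (prime_factors n) else 0)"

definition cyclotomic_poly :: "nat \<Rightarrow> int poly" where
  "cyclotomic_poly i = (THE p. map_poly of_int p =
     (\<Prod>\<zeta>\<in>{\<zeta>::complex. \<zeta> ^ i = 1 \<and> (\<forall>k. 0 < k \<and> k < i \<longrightarrow> \<zeta> ^ k \<noteq> 1)}. [:- \<zeta>, 1:]))"

definition quad_iter :: "'a::comm_ring_1 \<Rightarrow> nat \<Rightarrow> 'a poly" where
  "quad_iter c k = (pcompose [:c, 0, 1:] ^^ k) [:0, 1:]"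

definition parabolic_parameter :: "complex \<Rightarrow> bool" where
  "parabolic_parameter \<gamma> \<longleftrightarrow> (\<exists>m>0. \<exists>\<alpha>.
     poly (quad_iter \<gamma> m) \<alpha> = \<alpha> \<and>
     (\<forall>k. 0 < k \<and> k < m \<longrightarrow> poly (quad_iter \<gamma> k) \<alpha> \<noteq> \<alpha>) \<and>
     (\<exists>r>0. poly (pderiv (quad_iter \<gamma> m)) \<alpha> ^ r = 1))"

text \<open>Degree of an algebraic number over the rationals: the degree of its minimal polynomial.\<close>

definition has_degree_over_rat :: "complex \<Rightarrow> nat \<Rightarrow> bool" where
  "has_degree_over_rat x d \<longleftrightarrow> (\<exists>p :: rat poly. lead_coeff p = 1 \<and> irreducible p \<and>
     poly (map_poly of_rat p) x = 0 \<and> degree p = d)"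

text \<open>In the type \<open>int poly poly\<close> the inner variable is the parameter $c$; the outer variable is
  $z$ for the iterates and dynatomic polynomials, and $x$ for the multiplier polynomials.\<close>

definition generic_iter :: "nat \<Rightarrow> int poly poly" where
  "generic_iter k = quad_iter [:0, 1:] k"

text \<open>The exponents may be negative, so the product is formed in the fraction field of
  $\mathbb{Z}[c][z]$; its value lies in $\mathbb{Z}[c][z]$.\<close>

definition dynatomic :: "nat \<Rightarrow> int poly poly" where
  "dynatomic n = (THE p. to_fract p =
     (\<Prod>k | k dvd n. to_fract (generic_iter k - [:0, 1:]) powi moebius (n div k)))"

text \<open>The embedding of $\mathbb{Z}[c]$ into the algebraic closure of its fraction field
  $\mathbb{Q}(c)$.\<close>

definition to_closure :: "int poly \<Rightarrow> int poly fract alg_closure" where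
  "to_closure a = to_ac (to_fract a)"

definition multiplier_poly :: "nat \<Rightarrow> int poly poly" where
  "multiplier_poly n = (THE d. lead_coeff d = 1 \<and>
     map_poly to_closure d ^ n =
       (\<Prod>\<alpha>\<in>#proots (map_poly to_closure (dynatomic n)).
          [:- poly (map_poly to_closure (pderiv (generic_iter n))) \<alpha>, 1:]))"

definition Delta_proper :: "nat \<Rightarrow> nat \<Rightarrow> int poly" where
  "Delta_proper n m =
     resultant (map_poly (\<lambda>a. [:a:]) (cyclotomic_poly (n div m))) (multiplier_poly m)"

definition Delta :: "nat \<Rightarrow> nat \<Rightarrow> int poly" where
  "Delta n m = (if m = n
     then THE D. poly (multiplier_poly n) 1 = D * (\<Prod>k | k dvd n \<and> k \<noteq> n. Delta_proper n k)
     else Delta_proper n m)"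

end

theory Submission
  imports Defs "Subresultants.Subresultant" "HOL-Number_Theory.Residues"
begin

text \<open>Let \<open>f\<close> be the generic quadratic polynomial \<open>z\<^sup>2 + c\<close>, let \<open>\<nu> n\<close> be the degree of its \<open>n\<close>-th
dynatomic polynomial, so that \<open>\<Sum>d dvd n. \<nu> d = 2 ^ n\<close>, and let \<open>\<delta> n\<close> be the \<open>n\<close>-th multiplier
polynomial.  A complex parameter \<open>\<gamma>\<close> with a point of period \<open>m\<close> whose multiplier has order \<open>r\<close> is a
root of \<open>Delta (r * m) m\<close> if \<open>r > 1\<close>, and of \<open>\<delta> m 1\<close>, which is the product of the
\<open>Delta m k\<close> over the divisors \<open>k\<close> of \<open>m\<close>, if \<open>r = 1\<close>.  So \<open>\<gamma>\<close> is a root of some \<open>Delta n m\<close>.  If that polynomial is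
irreducible, then its degree is the degree of \<open>\<gamma>\<close>, and the degrees are
\<open>2 * degree (Delta n m) = \<phi> (n / m) * \<nu> m\<close> for \<open>m < n\<close> and
\<open>2 * degree (Delta n n) = \<nu> n - (\<Sum>d dvd n, d < n. \<phi> (n / d) * \<nu> d)\<close>.  For small indices these
numbers are computed, for large ones they are large, and 10 and 14 never occur.

The polynomials are introduced by definite descriptions, so most of the work lies in showing that they
exist.

\<^item> The dynatomic polynomial exists because \<open>f\<^sup>n z - z\<close> is separable over the field of rational
  functions in \<open>c\<close>: it is already separable at \<open>c = 0\<close>.  Its roots are therefore partitioned by their
  exact period, a monic factor of a monic polynomial has its coefficients in the smaller ring
  (\<open>primitive_factor_exists\<close>), and Moebius inversion turns \<open>f\<^sup>n z - z = \<Prod>d dvd n. \<Phi> d\<close> into the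
  defining formula.

\<^item> Multipliers are constant along cycles, so the product over the roots of the dynatomic polynomial
  that defines \<open>\<delta> n\<close> is an \<open>n\<close>-th power over the algebraic closure.  It is also a resultant, hence has
  coefficients in the polynomial ring over the integers, and a monic \<open>n\<close>-th root of such a polynomial
  again has coefficients there (\<open>monic_root_descends_field\<close>, \<open>monic_root_descends_fract\<close>).

\<^item> \<open>Delta n n\<close> exists if the product of the \<open>Delta n d\<close> over the proper divisors \<open>d\<close> of \<open>n\<close> divides
  \<open>\<delta> n 1\<close>.  Every single factor has a root in common with \<open>\<delta> n 1\<close>: where the multiplier of a
  \<open>d\<close>-cycle is a primitive root of unity of order \<open>n / d\<close>, an \<open>n\<close>-cycle collapses onto it
  (\<open>satellite_collision\<close>).  As the factors are irreducible, each of them divides \<open>\<delta> n 1\<close>, and it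
  remains to show that no two of them are proportional (\<open>Delta_proper_not_associated\<close>).

The last point is arithmetic.  At \<open>c = 0\<close> every cycle of length \<open>d > 1\<close> has multiplier \<open>2 ^ d\<close>, so the
constant coefficient of \<open>Delta n d\<close> is up to sign the value at \<open>2 ^ d\<close> of the cyclotomic polynomial of
index \<open>n / d\<close>, raised to the number \<open>\<nu> d / d\<close> of cycles; for \<open>d = 1\<close> only the fixed point 1 counts.  By Bang's
theorem, if \<open>n > 1\<close> is not 6, some prime divides \<open>2 ^ n - 1\<close> but no \<open>2 ^ k - 1\<close> with \<open>0 < k < n\<close>, and it
divides that cyclotomic value exactly as often as \<open>2 ^ n - 1\<close>.  Proportional factors would thus belong to
equally many cycles, but \<open>\<nu> d / d\<close> increases strictly from \<open>d = 2\<close> on.  The pair of divisors 1 and 2 and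
the case \<open>n = 6\<close> are treated directly.

Degrees and leading coefficients are read off from the behaviour for \<open>c \<rightarrow> \<infinity>\<close>, where every periodic point
has absolute value about \<open>sqrt \<bar>c\<bar>\<close>, so that the multiplier of an \<open>n\<close>-cycle has absolute value about
\<open>\<bar>4 * c\<bar> powr (n / 2)\<close>.\<close>

section \<open>Resultants as products over roots\<close>

text \<open>One step of the Euclidean algorithm for resultants.  It is the coefficient of index 0 of the
corresponding statement about subresultants, which distinguishes whether \<open>H\<close> is constant.\<close>
lemma resultant_euclid_step:
  fixes F G H B :: "'a::idom poly"
  assumes "F + B * G = H" "degree G \<le> degree F" "degree H < degree G" "H \<noteq> 0"
  shows "resultant F G
       = (- 1) ^ (degree F * degree G) * lead_coeff G ^ (degree F - degree H) * resultant G H"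
proof (cases "degree H = 0")
  case False
  then have "[:resultant F G:] = smult ((- 1) ^ (degree F * degree G)
       * lead_coeff G ^ (degree F - degree H)) [:resultant G H:]"
    using BT_lemma_1_12[OF assms(1,2), of 0] assms by (simp add: subresultant_resultant)
  then show ?thesis by simp
next
  case True
  then obtain c where c: "H = [:c:]" by (metis degree_eq_zeroE)
  have dg: "degree G > 0" using assms by auto
  have "[:resultant F G:] = smult ((- 1) ^ (degree F * degree G)
       * lead_coeff G ^ degree F * c ^ (degree G - 1)) [:c:]"
    using BT_lemma_1_13[OF assms(1,2)] assms True c by (simp add: subresultant_resultant)
  moreover have "c ^ (degree G - 1) * c = c ^ degree G"
    using dg by (metis Suc_diff_1 mult.commute power_Suc)
  ultimately show ?thesis using True c by (simp add: mult.assoc)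
qed

lemma resultant_dvd_eq_0:
  fixes F G :: "'a::idom poly"
  assumes "F = B * G" "degree G \<le> degree F" "degree G > 0" "F \<noteq> 0"
  shows "resultant F G = 0"
proof -
  have "subresultant 0 F G = 0"
    using subresultant_product[OF assms(1,2), of 0] assms(3) by simp
  then show ?thesis by (simp add: subresultant_resultant)
qed

lemma proots_linear_product: "proots (\<Prod>x\<in>#A. [:- x, 1 :: 'a::idom:]) = A"
  proof (induction A)
  case (add x A)
  have "(\<Prod>x\<in>#A. [:- x, 1 :: 'a:]) \<noteq> 0" by (auto simp: prod_mset_zero_iff)
  then have "proots ([:- x, 1:] * (\<Prod>x\<in>#A. [:- x, 1:])) = {#x#} + A"
    by (subst proots_mult) (auto simp only: add proots_linear_factor minus_minus pCons_eq_0_iff zero_neq_one[symmetric])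
  then show ?case by simp
qed simp

lemma alg_closed_factorization:
  fixes p :: "'a::alg_closed_field poly"
  assumes "p \<noteq> 0"
  shows "p = smult (lead_coeff p) (\<Prod>\<alpha>\<in>#proots p. [:- \<alpha>, 1:])" and "size (proots p) = degree p"
proof -
  obtain A where A: "size A = degree p" "p = smult (lead_coeff p) (\<Prod>x\<in>#A. [:-x, 1:])"
    using alg_closed_imp_factorization[OF assms] by blast
  have "proots p = A"
    using assms by (subst A(2), subst proots_smult) (simp, rule proots_linear_product)
  then show "p = smult (lead_coeff p) (\<Prod>\<alpha>\<in>#proots p. [:- \<alpha>, 1:])" "size (proots p) = degree p"
    using A by simp_all
qed

lemma poly_prod_mset: "poly (\<Prod>x\<in>#A. f x) z = (\<Prod>x\<in>#A. poly (f x) (z :: 'a::comm_semiring_1))"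
  by (induction A) auto

text \<open>The product formula for the resultant.  It satisfies the same swap and reduction rules as the
resultant itself, and this is how the two are identified below.\<close>
definition root_norm :: "'a::alg_closed_field poly \<Rightarrow> 'a poly \<Rightarrow> 'a" where
  "root_norm p q = lead_coeff p ^ degree q * (\<Prod>\<alpha>\<in>#proots p. poly q \<alpha>)"

lemma prod_mset_minus_swap:
  "(\<Prod>a\<in>#A. \<Prod>b\<in>#B. a - b :: 'a::comm_ring_1) = (- 1) ^ (size A * size B) * (\<Prod>b\<in>#B. \<Prod>a\<in>#A. b - a)"
proof -
  have "(\<Prod>a\<in>#A. \<Prod>b\<in>#B. a - b) = (\<Prod>b\<in>#B. \<Prod>a\<in>#A. (- 1) * (b - a))"
    by (subst prod_mset.swap) simp
  also have "\<dots> = (\<Prod>b\<in>#B. (- 1) ^ size A * (\<Prod>a\<in>#A. b - a))"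
    by (simp only: prod_mset.distrib prod_mset_constant)
  also have "\<dots> = (- 1) ^ (size A * size B) * (\<Prod>b\<in>#B. \<Prod>a\<in>#A. b - a)"
    by (simp only: prod_mset.distrib prod_mset_constant power_mult)
  finally show ?thesis .
qed

lemma root_norm_double_prod:
  fixes p q :: "'a::alg_closed_field poly"
  assumes "q \<noteq> 0" "p \<noteq> 0"
  shows "root_norm p q = lead_coeff p ^ degree q * lead_coeff q ^ degree p
           * (\<Prod>a\<in>#proots p. \<Prod>b\<in>#proots q. a - b)"
proof -
  have "poly q a = lead_coeff q * (\<Prod>b\<in>#proots q. a - b)" for a
  proof -
    have "poly q a = poly (smult (lead_coeff q) (\<Prod>b\<in>#proots q. [:- b, 1:])) a"
      using alg_closed_factorization(1)[OF assms(1)] by simp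
    then show ?thesis by (simp add: poly_prod_mset)
  qed
  then have "(\<Prod>a\<in>#proots p. poly q a) = (\<Prod>a\<in>#proots p. lead_coeff q * (\<Prod>b\<in>#proots q. a - b))"
    by presburger
  also have "\<dots> = lead_coeff q ^ degree p * (\<Prod>a\<in>#proots p. \<Prod>b\<in>#proots q. a - b)"
    by (simp only: prod_mset.distrib prod_mset_constant alg_closed_factorization(2)[OF assms(2)])
  finally show ?thesis
    unfolding root_norm_def by (simp only: mult.assoc)
qed

lemma root_norm_swap:
  fixes p q :: "'a::alg_closed_field poly"
  assumes "q \<noteq> 0" "p \<noteq> 0"
  shows "root_norm p q = (- 1) ^ (degree p * degree q) * root_norm q p"
  unfolding root_norm_double_prod[OF assms] root_norm_double_prod[OF assms(2,1)]
  by (subst prod_mset_minus_swap)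
     (simp add: alg_closed_factorization(2)[OF assms(1)] alg_closed_factorization(2)[OF assms(2)] mult_ac)

lemma resultant_eq_root_norm_aux:
  fixes p q :: "'a::alg_closed_field poly"
  assumes "q \<noteq> 0" "degree q \<le> degree p"
  shows "p \<noteq> 0 \<Longrightarrow> resultant p q = root_norm p q"
  using assms
proof (induction "degree q" arbitrary: p q rule: less_induct)
  case less
  show ?case
  proof (cases "degree q = 0")
    case True
    then obtain c where "q = [:c:]" by (metis degree_eq_zeroE)
    then show ?thesis
      using alg_closed_factorization(2)[OF less.prems(1)] by (simp add: root_norm_def)
  next
    case False
    define H where "H = p mod q"
    have eq: "p + (- (p div q)) * q = H"
      unfolding H_def by (simp add: minus_div_mult_eq_mod)
    show ?thesis
    proof (cases "H = 0")
      case True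
      then have p: "p = (p div q) * q" using eq by simp
      have "resultant p q = 0"
        using resultant_dvd_eq_0[OF p] less.prems False by simp
      moreover obtain b where b: "poly q b = 0"
        using alg_closed_imp_poly_has_root[of q] False by auto
      then have "poly p b = 0" by (subst p) simp
      then have "b \<in># proots p" using less.prems(1) by simp
      then have "(\<Prod>a\<in>#proots p. poly q a) = 0"
        using b by (auto simp: prod_mset_zero_iff)
      ultimately show ?thesis by (simp add: root_norm_def)
    next
      case H0: False
      have dH: "degree H < degree q"
        using H0 False unfolding H_def by (metis degree_mod_less' less.prems(2))
      have "resultant q H = root_norm q H"
        using less.hyps[of H q] dH H0 less.prems by simp
      moreover have "(\<Prod>b\<in>#proots q. poly H b) = (\<Prod>b\<in>#proots q. poly p b)"
      proof -
        have "poly H b = poly p b" if "b \<in># proots q" for b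
          using that less.prems(2) by (simp add: eq[symmetric])
        then show ?thesis by (metis (no_types, lifting) image_mset_cong)
      qed
      ultimately have "resultant p q = (- 1) ^ (degree p * degree q) *
          (lead_coeff q ^ (degree p - degree H) * lead_coeff q ^ degree H) * (\<Prod>b\<in>#proots q. poly p b)"
        using resultant_euclid_step[OF eq less.prems(3) dH H0] by (simp add: root_norm_def mult_ac)
      also have "lead_coeff q ^ (degree p - degree H) * lead_coeff q ^ degree H = lead_coeff q ^ degree p"
        using dH less.prems(3) by (simp flip: power_add)
      finally show ?thesis
        using root_norm_swap[OF less.prems(2,1)] by (simp add: root_norm_def mult_ac)
    qed
  qed
qed

theorem resultant_eq_root_norm:
  fixes p q :: "'a::alg_closed_field poly"
  assumes "q \<noteq> 0" "p \<noteq> 0"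
  shows "resultant p q = root_norm p q"
proof (cases "degree q \<le> degree p")
  case True
  then show ?thesis using resultant_eq_root_norm_aux assms by blast
next
  case False
  then have "resultant q p = root_norm q p"
    using resultant_eq_root_norm_aux[OF assms(2) _ assms(1)] by simp
  then show ?thesis
    using resultant_swap[of p q] root_norm_swap[OF assms] by simp
qed

text \<open>The form in which resultants are used: the resultant with a monic polynomial is an element of the base
ring that every homomorphism into an algebraically closed field turns into a product over roots, provided
that the degree of \<open>q\<close> does not drop.  The
same element thus describes the generic situation and all its specialisations.\<close>
lemma hom_resultant_monic:
  fixes h :: "'a::comm_ring_1 \<Rightarrow> 'b::alg_closed_field"
  assumes h: "comm_ring_hom h" and p: "lead_coeff p = 1"
    and q: "degree (map_poly h q) = degree q" "map_poly h q \<noteq> 0"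
  shows "h (resultant p q) = (\<Prod>\<alpha>\<in>#proots (map_poly h p). poly (map_poly h q) \<alpha>)"
proof -
  interpret comm_ring_hom h by fact
  have d: "degree (map_poly h p) = degree p"
    using p by (intro degree_map_poly) auto
  have l: "lead_coeff (map_poly h p) = 1"
    unfolding d using p by (simp add: coeff_map_poly)
  then have "map_poly h p \<noteq> 0" by (metis leading_coeff_0_iff zero_neq_one)
  then show ?thesis
    using resultant_map_poly[OF d q(1)] resultant_eq_root_norm[OF q(2), of "map_poly h p"] l
    by (simp add: root_norm_def)
qed

lemma lead_coeff_map_poly_monic:
  fixes h :: "'a::comm_ring_1 \<Rightarrow> 'b::comm_ring_1"
  assumes h: "comm_ring_hom h" and p: "lead_coeff p = 1"
  shows "degree (map_poly h p) = degree p" "lead_coeff (map_poly h p) = 1"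
proof -
  interpret comm_ring_hom h by fact
  show d: "degree (map_poly h p) = degree p"
    using p by (intro degree_map_poly) auto
  show "lead_coeff (map_poly h p) = 1"
    unfolding d using p by (simp add: coeff_map_poly)
qed

section \<open>Descent of monic factors and monic roots\<close>

text \<open>Division with remainder by a monic polynomial can be carried out in the smaller ring, and quotient and
remainder are unique in the larger one.\<close>
lemma monic_quotient_descends:
  fixes h :: "'a::idom \<Rightarrow> 'b::idom"
  assumes h: "inj_comm_ring_hom h" and Q: "lead_coeff Q = 1"
    and F: "map_poly h F = map_poly h Q * T"
  shows "\<exists>q. F = Q * q \<and> map_poly h q = T"
proof -
  interpret h: inj_comm_ring_hom h by fact
  interpret m: map_poly_inj_comm_ring_hom h ..
  obtain q r where qr: "pseudo_divmod F Q = (q, r)" by force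
  have Q0: "Q \<noteq> 0" using Q by auto
  have eq: "F = Q * q + r" using pseudo_divmod(1)[OF Q0 qr] Q by simp
  have r: "r = 0 \<or> degree r < degree Q" using pseudo_divmod(2)[OF Q0 qr] .
  have e: "map_poly h Q * (T - map_poly h q) = map_poly h r"
    using F unfolding eq by (simp add: m.hom_add m.hom_mult algebra_simps)
  have "T - map_poly h q = 0"
  proof (rule ccontr)
    assume ne: "T - map_poly h q \<noteq> 0"
    have "map_poly h Q \<noteq> 0" using Q0 by simp
    then have "degree (map_poly h r) \<ge> degree Q" "map_poly h r \<noteq> 0"
      using ne by (simp_all flip: e add: degree_mult_eq)
    then show False using r by auto
  qed
  with e have "r = 0" by simp
  then show ?thesis using eq \<open>T - map_poly h q = 0\<close> by (intro exI[of _ q]) simp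
qed

lemma lead_coeff_linear_prod: "lead_coeff (\<Prod>a\<in>A. [:- a, 1 :: 'a::idom:]) = 1"
  by (simp add: lead_coeff_prod)

text \<open>By induction, \<open>P\<close> is the quotient of \<open>F n\<close> by the factors that belong to the proper divisors of \<open>n\<close>.  With \<open>S k\<close> the
primitive \<open>k\<close>-th roots of unity this gives the cyclotomic polynomials, with \<open>S k\<close> the points of exact
period \<open>k\<close> the dynatomic ones.\<close>
theorem primitive_factor_exists:
  fixes h :: "'a::idom \<Rightarrow> 'b::idom"
  assumes h: "inj_comm_ring_hom h"
    and F: "\<And>n. n > 0 \<Longrightarrow> map_poly h (F n) = (\<Prod>k | k dvd n. \<Prod>a\<in>S k. [:- a, 1:])"
  shows "n > (0::nat) \<Longrightarrow> \<exists>P. lead_coeff P = 1 \<and> map_poly h P = (\<Prod>a\<in>S n. [:- a, 1:])"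
proof (induction n rule: less_induct)
  case (less n)
  interpret h: inj_comm_ring_hom h by fact
  interpret m: map_poly_inj_comm_ring_hom h ..
  define D where "D = {k. k dvd n \<and> k \<noteq> n}"
  have D: "finite D" "{k. k dvd n} = insert n D" "n \<notin> D"
    using less.prems unfolding D_def by auto
  have kD: "k < n" "k > 0" if "k \<in> D" for k
    using that less.prems dvd_imp_le[of k n] unfolding D_def by (auto intro!: Nat.gr0I)
  have "\<forall>k\<in>D. \<exists>P. lead_coeff P = 1 \<and> map_poly h P = (\<Prod>a\<in>S k. [:- a, 1:])"
    using less.IH kD by blast
  then obtain P where P: "\<And>k. k \<in> D \<Longrightarrow> lead_coeff (P k) = 1"
    "\<And>k. k \<in> D \<Longrightarrow> map_poly h (P k) = (\<Prod>a\<in>S k. [:- a, 1:])"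
    by metis
  have "lead_coeff (\<Prod>k\<in>D. P k) = 1"
    using P(1) by (simp add: lead_coeff_prod)
  moreover have "map_poly h (F n) = map_poly h (\<Prod>k\<in>D. P k) * (\<Prod>a\<in>S n. [:- a, 1:])"
    using F[OF less.prems] P(2) by (simp add: D m.hom_prod mult.commute)
  ultimately obtain q where q: "map_poly h q = (\<Prod>a\<in>S n. [:- a, 1:])"
    using monic_quotient_descends[OF h] by blast
  have "h (lead_coeff q) = lead_coeff (map_poly h q)" by (simp add: coeff_map_poly)
  then have "h (lead_coeff q) = h 1" unfolding q lead_coeff_linear_prod by simp
  then have "lead_coeff q = 1" by (simp only: h.eq_iff)
  then show ?case using q by blast
qed

lemma coeff_mult_bound:
  fixes p q :: "'a::comm_semiring_0 poly"
  assumes "degree p \<le> a" "degree q \<le> b"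
  shows "coeff (p * q) (a + b) = coeff p a * coeff q b"
proof -
  have "coeff (p * q) (a + b) = (\<Sum>i\<le>a + b. if i = a then coeff p a * coeff q b else 0)"
    unfolding coeff_mult
  proof (rule sum.cong[OF refl])
    fix i assume "i \<in> {..a + b}"
    show "coeff p i * coeff q (a + b - i) = (if i = a then coeff p a * coeff q b else 0)"
    proof (cases i a rule: linorder_cases)
      case less
      then have "degree q < a + b - i" using assms by simp
      then show ?thesis using less by (simp add: coeff_eq_0)
    next
      case greater
      then have "degree p < i" using assms by simp
      then show ?thesis using greater by (simp add: coeff_eq_0)
    qed simp
  qed
  then show ?thesis by simp
qed

text \<open>\<open>D ^ n - T ^ n\<close> is \<open>D - T\<close> times a sum of \<open>n\<close> monic polynomials of the same degree; this isolates the
leading coefficient of \<open>D - T\<close>.\<close>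
lemma monic_power_diff:
  fixes D T :: "'a::idom poly"
  assumes "lead_coeff D = 1" "lead_coeff T = 1" "degree D = d" "degree T = d" "n > 0"
    "degree (D - T) \<le> e"
  shows "coeff (D ^ n - T ^ n) (e + (n - 1) * d) = of_nat n * coeff (D - T) e"
proof -
  define W where "W = (\<Sum>i<n. D ^ i * T ^ (n - Suc i))"
  have deg: "degree (D ^ i * T ^ (n - Suc i)) = (n - 1) * d"
    and lc: "lead_coeff (D ^ i * T ^ (n - Suc i)) = 1" if "i < n" for i
  proof -
    have [simp]: "D \<noteq> 0" "T \<noteq> 0" using assms(1,2) by auto
    have "degree (D ^ i * T ^ (n - Suc i)) = i * d + (n - Suc i) * d"
      by (simp add: degree_mult_eq degree_power_eq assms)
    also have "\<dots> = (n - 1) * d" using that by (simp flip: add_mult_distrib)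
    finally show "degree (D ^ i * T ^ (n - Suc i)) = (n - 1) * d" .
    show "lead_coeff (D ^ i * T ^ (n - Suc i)) = 1"
      using assms by (simp add: lead_coeff_mult lead_coeff_power)
  qed
  have "D ^ n - T ^ n = (D - T) * W"
    unfolding W_def by (subst power_diff_sumr2) (simp add: mult.commute)
  moreover have "degree W \<le> (n - 1) * d"
    unfolding W_def by (rule degree_sum_le) (simp_all add: deg)
  moreover have "coeff W ((n - 1) * d) = of_nat n"
  proof -
    have "coeff W ((n - 1) * d) = (\<Sum>i<n. 1)"
      unfolding W_def coeff_sum by (intro sum.cong refl) (metis deg lc lessThan_iff)
    then show ?thesis by simp
  qed
  ultimately show ?thesis
    using coeff_mult_bound[OF assms(6), of W "(n - 1) * d"] by (simp add: mult.commute)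
qed

lemma monic_power_inj:
  fixes D T :: "'a::{idom,ring_char_0} poly"
  assumes "lead_coeff D = 1" "lead_coeff T = 1" "n > 0" "D ^ n = T ^ n"
  shows "D = T"
proof (rule ccontr)
  assume "D \<noteq> T"
  have "D \<noteq> 0" "T \<noteq> 0" using assms by auto
  then have d: "degree D = degree T"
    using arg_cong[OF assms(4), of degree] assms(3) by (simp add: degree_power_eq)
  have "of_nat n * lead_coeff (D - T) = coeff (D ^ n - T ^ n) (degree (D - T) + (n - 1) * degree T)"
    by (rule monic_power_diff[symmetric]) (use assms d in auto)
  also have "\<dots> = 0" using assms(4) by simp
  finally have "lead_coeff (D - T) = 0" using assms(3) by simp
  then show False using \<open>D \<noteq> T\<close> by (metis eq_iff_diff_eq_0 leading_coeff_0_iff)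
qed

text \<open>The coefficients of a monic \<open>n\<close>-th root are found one after the other from the top: if \<open>T\<close> agrees with
\<open>D\<close> above degree \<open>e\<close>, then the coefficient of \<open>D - T\<close> at \<open>e\<close> is, up to the factor \<open>n\<close>, a coefficient of
\<open>D ^ n - T ^ n\<close>, so it lies in the smaller field.\<close>
lemma monic_root_descends_field:
  fixes h :: "'a::field_char_0 \<Rightarrow> 'b::field_char_0"
  assumes h: "inj_comm_ring_hom h" and D: "lead_coeff D = 1" "n > 0"
    and R: "map_poly h R = D ^ n"
  shows "\<exists>D'. D = map_poly h D'"
proof -
  interpret h: inj_comm_ring_hom h by fact
  interpret m: map_poly_inj_comm_ring_hom h ..
  define d where "d = degree D"
  have "\<exists>T. degree (map_poly h T) = d \<and> lead_coeff (map_poly h T) = 1 \<and>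
           (\<forall>j\<le>i. j \<le> d \<longrightarrow> coeff (map_poly h T) (d - j) = coeff D (d - j))" for i
  proof (induction i)
    case 0
    show ?case
      by (rule exI[of _ "monom 1 d"]) (use D in \<open>simp add: map_poly_monom degree_monom_eq d_def\<close>)
  next
    case (Suc i)
    then obtain T where T: "degree (map_poly h T) = d" "lead_coeff (map_poly h T) = 1"
      "\<And>j. j \<le> i \<Longrightarrow> j \<le> d \<Longrightarrow> coeff (map_poly h T) (d - j) = coeff D (d - j)"
      by blast
    show ?case
    proof (cases "Suc i \<le> d")
      case False
      then show ?thesis using T by (intro exI[of _ T]) (auto simp: le_Suc_eq)
    next
      case True
      define e where "e = d - Suc i"
      \<comment> \<open>\<open>T\<close> agrees with \<open>D\<close> in the degrees above \<open>e\<close>; the next coefficient is corrected below.\<close>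
      have le: "degree (D - map_poly h T) \<le> e"
      proof (rule degree_le, intro allI impI)
        fix k assume k: "e < k"
        show "coeff (D - map_poly h T) k = 0"
        proof (cases "k \<le> d")
          case True
          then have "k = d - (d - k)" "d - k \<le> i" using k unfolding e_def by auto
          then show ?thesis using T(3)[of "d - k"] by simp
        next
          case False
          then show ?thesis using T(1) d_def by (simp add: coeff_eq_0)
        qed
      qed
      have "of_nat n * coeff (D - map_poly h T) e = coeff (D ^ n - map_poly h T ^ n) (e + (n - 1) * d)"
        by (rule monic_power_diff[symmetric]) (use D T le in \<open>auto simp: d_def\<close>)
      also have "\<dots> = h (coeff (R - T ^ n) (e + (n - 1) * d))"
        by (simp add: R[symmetric] coeff_map_poly h.hom_minus flip: m.hom_power)
      finally have c: "of_nat n * coeff (D - map_poly h T) e = h (coeff (R - T ^ n) (e + (n - 1) * d))" .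
      define c where "c = coeff (R - T ^ n) (e + (n - 1) * d) / of_nat n"
      have "h (of_nat k) = of_nat k" for k by (induction k) (auto simp: h.hom_add)
      then have "of_nat n * h c = h (of_nat n * c)" by (simp add: h.hom_mult)
      also have "of_nat n * c = coeff (R - T ^ n) (e + (n - 1) * d)"
        using D(2) by (simp add: c_def)
      finally have "of_nat n * h c = of_nat n * coeff (D - map_poly h T) e" using c by simp
      then have hc: "h c = coeff D e - coeff (map_poly h T) e"
        using D(2) by simp
      define T' where "T' = T + monom c e"
      have T': "map_poly h T' = map_poly h T + monom (h c) e"
        unfolding T'_def by (simp add: m.hom_add map_poly_monom)
      have cT': "coeff (map_poly h T') k = (if k = e then coeff D e else coeff (map_poly h T) k)" for k
        unfolding T' using hc by simp
      have "e < d" using True unfolding e_def by simp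
      have dT: "degree (map_poly h T') = d"
        unfolding T' using T(1) \<open>e < d\<close> degree_monom_le[of "h c" e]
        by (subst degree_add_eq_left) auto
      show ?thesis
      proof (intro exI[of _ T'] conjI allI impI)
        show "degree (map_poly h T') = d" by fact
        show "lead_coeff (map_poly h T') = 1"
          unfolding dT cT' using \<open>e < d\<close> T by auto
        fix j assume "j \<le> Suc i" "j \<le> d"
        then show "coeff (map_poly h T') (d - j) = coeff D (d - j)"
          unfolding cT' using T(3)[of j] by (auto simp: e_def le_Suc_eq)
      qed
    qed
  qed
  from this[of d] obtain T where T: "degree (map_poly h T) = d"
     "\<And>j. j \<le> d \<Longrightarrow> coeff (map_poly h T) (d - j) = coeff D (d - j)" by blast
  have "D = map_poly h T"
  proof (rule poly_eqI)
    fix k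
    show "coeff D k = coeff (map_poly h T) k"
    proof (cases "k \<le> d")
      case True
      then show ?thesis using T(2)[of "d - k"] by simp
    next
      case False
      then show ?thesis using T(1) d_def by (simp add: coeff_eq_0)
    qed
  qed
  then show ?thesis ..
qed

lemma content_power_eq_1:
  fixes p :: "'a::{factorial_semiring, semiring_gcd, normalization_semidom_multiplicative, idom} poly"
  assumes "content p = 1"
  shows "content (p ^ n) = 1"
  using assms by (induction n) (auto simp: content_mult)

text \<open>Write the root as \<open>c\<close> times a primitive polynomial \<open>p\<close>.  Powers of primitive polynomials are primitive,
so comparing contents shows that the leading coefficient of \<open>p\<close>, which is the inverse of \<open>c\<close>, is a unit.\<close>
lemma monic_root_descends_fract:
  fixes R :: "'a::{factorial_ring_gcd, semiring_gcd_mult_normalize} poly"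
  assumes D: "lead_coeff D = 1" "n > 0" and R: "map_poly to_fract R = D ^ n"
  shows "\<exists>d. D = map_poly to_fract d"
proof -
  obtain c p where p: "D = smult c (map_poly to_fract p)" "content p = 1"
    by (rule content_decompose_fract)
  have "c \<noteq> 0" using D(1) p(1) by auto
  then have c: "c * to_fract (lead_coeff p) = 1"
    using D(1) unfolding p(1) by (simp add: degree_map_poly coeff_map_poly)
  have "map_poly to_fract (smult (lead_coeff p ^ n) R)
      = smult ((c * to_fract (lead_coeff p)) ^ n) (map_poly to_fract (p ^ n))"
  proof -
    interpret m: map_poly_inj_comm_ring_hom "to_fract :: 'a \<Rightarrow> _" ..
    have "map_poly to_fract (smult (lead_coeff p ^ n) R) = smult (to_fract (lead_coeff p) ^ n) (D ^ n)"
      by (simp add: R to_fract_hom.hom_power)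
    then show ?thesis
      unfolding p(1) by (simp add: smult_power m.hom_power power_mult_distrib mult.commute)
  qed
  then have "map_poly to_fract (smult (lead_coeff p ^ n) R) = map_poly to_fract (p ^ n)"
    unfolding c by (simp only: power_one smult_1_left)
  then have "smult (lead_coeff p ^ n) R = p ^ n"
    by (simp only: fract_poly_eq_iff)
  then have "content (smult (lead_coeff p ^ n) R) = 1"
    using p(2) by (simp add: content_power_eq_1)
  then have "is_unit (lead_coeff p ^ n)"
    by (metis content_smult dvd_mult_left dvd_refl is_unit_normalize normalize_1 normalize_dvd_iff)
  then have "is_unit (lead_coeff p)" using D(2) by (simp add: is_unit_power_iff)
  then obtain u where u: "lead_coeff p * u = 1" by (metis dvdE)
  then have "to_fract (lead_coeff p) * to_fract u = 1" by (simp flip: to_fract_mult)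
  with c have "c = to_fract u" by (metis mult.assoc mult.commute mult.right_neutral)
  then have "D = map_poly to_fract (smult u p)" unfolding p(1) by simp
  then show ?thesis ..
qed

section \<open>Moebius inversion\<close>

text \<open>For a prime \<open>p\<close> dividing \<open>n\<close>, the divisors \<open>d\<close> and \<open>p * d\<close> with \<open>d\<close> prime to \<open>p\<close> cancel, and those divisible
by the square of \<open>p\<close> contribute nothing.\<close>
lemma sum_moebius_divisors:
  fixes n :: nat
  assumes "n > 0"
  shows "(\<Sum>d | d dvd n. moebius d) = (if n = 1 then 1 else 0)"
proof (cases "n = 1")
  case True
  then show ?thesis by (simp add: moebius_def)
next
  case False
  then obtain p where p: "prime p" "p dvd n" using prime_factor_nat by blast
  have fin: "finite {d. d dvd n}" using assms by simp
  define A where "A = {d. d dvd n \<and> \<not> p dvd d}"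
  define B where "B = {d. d dvd n \<and> p dvd d \<and> \<not> p * p dvd d}"
  have fAB: "finite A" "finite B" unfolding A_def B_def using fin by auto
  have "(\<Sum>d | d dvd n. moebius d) = (\<Sum>d\<in>A \<union> B. moebius d)"
  proof (rule sum.mono_neutral_right[OF fin])
    show "A \<union> B \<subseteq> {d. d dvd n}" unfolding A_def B_def by auto
    show "\<forall>d\<in>{d. d dvd n} - (A \<union> B). moebius d = 0"
    proof
      fix d assume "d \<in> {d. d dvd n} - (A \<union> B)"
      then have "p\<^sup>2 dvd d" unfolding A_def B_def by (auto simp: power2_eq_square)
      then have "\<not> squarefree d"
        using p(1) by (metis not_prime_unit squarefreeD)
      then show "moebius d = 0" by (simp add: moebius_def)
    qed
  qed
  also have "\<dots> = (\<Sum>d\<in>A. moebius d) + (\<Sum>d\<in>B. moebius d)"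
    by (rule sum.union_disjoint[OF fAB]) (auto simp: A_def B_def)
  also have "(\<Sum>d\<in>B. moebius d) = (\<Sum>d\<in>A. moebius (p * d))"
  proof (rule sum.reindex_bij_witness[of _ "\<lambda>d. p * d" "\<lambda>d. d div p"])
    fix d assume d: "d \<in> A"
    have "coprime p d" using d p(1) by (auto simp: A_def prime_imp_coprime)
    then have "p * d dvd n" using d p(2) by (auto simp: A_def divides_mult)
    then show "p * d \<in> B"
      using d p(1) by (auto simp: A_def B_def prime_gt_0_nat)
  next
    fix d assume "d \<in> B"
    then have d: "d dvd n" "p dvd d" "\<not> p * p dvd d" by (auto simp: B_def)
    then obtain e where e: "d = p * e" by (elim dvdE)
    then show "p * (d div p) = d" "moebius (p * (d div p)) = moebius d" using d by simp_all
    have "e dvd n" using d(1) unfolding e by (rule dvd_mult_right)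
    then show "d div p \<in> A"
      using d(3) p(1) unfolding e by (auto simp: A_def prime_gt_0_nat)
  qed (use p(1) in \<open>simp add: prime_gt_0_nat\<close>)
  also have "\<dots> = (\<Sum>d\<in>A. - moebius d)"
  proof (rule sum.cong[OF refl])
    fix d assume d: "d \<in> A"
    have cop: "coprime p d" using d p(1) by (auto simp: A_def prime_imp_coprime)
    have "d > 0" using d assms by (auto simp: A_def intro!: Nat.gr0I)
    have sf: "squarefree (p * d) = squarefree d"
      using cop p(1) by (auto simp: squarefree_mult_coprime squarefree_prime dest: squarefree_multD)
    have "prime_factors (p * d) = insert p (prime_factors d)"
      using p(1) \<open>d > 0\<close> by (simp add: prime_factors_product prime_gt_0_nat prime_prime_factors)
    moreover have "p \<notin> prime_factors d" using d by (auto simp: A_def)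
    ultimately have "card (prime_factors (p * d)) = Suc (card (prime_factors d))" by simp
    then show "moebius (p * d) = - moebius d" by (simp add: moebius_def sf)
  qed
  finally show ?thesis using False by (simp add: sum_negf)
qed

lemma power_int_sum_exponent:
  fixes x :: "'a::field"
  assumes "x \<noteq> 0" "finite A"
  shows "x powi (\<Sum>a\<in>A. f a) = (\<Prod>a\<in>A. x powi f a)"
  using assms(2) by (induction rule: finite_induct) (auto simp: power_int_add assms(1))

lemma power_int_prod: "(\<Prod>a\<in>A. f a :: 'a::field) powi k = (\<Prod>a\<in>A. f a powi k)"
  by (induction A rule: infinite_finite_induct) (auto simp: power_int_mult_distrib)

theorem multiplicative_moebius_inversion:
  fixes G :: "nat \<Rightarrow> 'a::field"
  assumes n: "n > 0" and G: "\<And>k. k dvd n \<Longrightarrow> G k \<noteq> 0"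
    and F: "\<And>k. k dvd n \<Longrightarrow> F k = (\<Prod>d | d dvd k. G d)"
  shows "(\<Prod>k | k dvd n. F k powi moebius (n div k)) = G n"
proof -
  have fin: "finite {k. k dvd n}" using n by simp
  have "(\<Prod>k | k dvd n. F k powi moebius (n div k))
      = (\<Prod>k | k dvd n. \<Prod>d | d dvd n \<and> d dvd k. G d powi moebius (n div k))"
  proof (rule prod.cong[OF refl])
    fix k assume "k \<in> {k. k dvd n}"
    then have "{d. d dvd k} = {d. d dvd n \<and> d dvd k}" "F k = (\<Prod>d | d dvd k. G d)"
      using F by (auto intro: dvd_trans)
    then show "F k powi moebius (n div k) = (\<Prod>d | d dvd n \<and> d dvd k. G d powi moebius (n div k))"
      by (simp add: power_int_prod)
  qed
  also have "\<dots> = (\<Prod>d | d dvd n. \<Prod>k | k dvd n \<and> d dvd k. G d powi moebius (n div k))"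
    using prod.swap_restrict[OF fin fin, of "\<lambda>k d. G d powi moebius (n div k)" "\<lambda>k d. d dvd k"] by simp
  also have "\<dots> = (\<Prod>d | d dvd n. if d = n then G n else 1)"
  proof (rule prod.cong[OF refl])
    fix d assume "d \<in> {d. d dvd n}"
    then have d: "d dvd n" by simp
    then have d0: "d > 0" "n div d > 0" using n by (auto intro: Nat.gr0I simp: dvd_div_eq_0_iff)
    have "(\<Prod>k | k dvd n \<and> d dvd k. G d powi moebius (n div k))
        = G d powi (\<Sum>k | k dvd n \<and> d dvd k. moebius (n div k))"
      by (rule power_int_sum_exponent[symmetric]) (use G d n in auto)
    also have "(\<Sum>k | k dvd n \<and> d dvd k. moebius (n div k)) = (\<Sum>e | e dvd n div d. moebius e)"
    proof (rule sum.reindex_bij_witness[of _ "\<lambda>e. n div e" "\<lambda>k. n div k"])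
      fix e assume "e \<in> {e. e dvd n div d}"
      then obtain f where f: "n = d * (e * f)" using d by (metis dvdE dvd_mult_div_cancel mem_Collect_eq)
      then have "e > 0" using n by (auto intro: Nat.gr0I)
      then show "n div e \<in> {k. k dvd n \<and> d dvd k}" "n div (n div e) = e"
        using f n by (auto simp: mult.left_commute[of d] )
    next
      fix k assume "k \<in> {k. k dvd n \<and> d dvd k}"
      then have "k dvd n" "d dvd k" by auto
      then obtain f g where f: "n = k * f" "k = d * g" by (elim dvdE)
      then show "n div k \<in> {e. e dvd n div d}" "n div (n div k) = k"
        using n by (auto simp: mult.assoc)
    qed simp
    also have "\<dots> = (if n div d = 1 then 1 else 0)"
      by (rule sum_moebius_divisors) fact
    also have "(n div d = 1) = (d = n)"
    proof
      assume "n div d = 1"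
      then show "d = n" using d by (metis dvd_div_mult_self mult_1)
    qed (use n in simp)
    finally show "(\<Prod>k | k dvd n \<and> d dvd k. G d powi moebius (n div k)) = (if d = n then G n else 1)"
      by auto
  qed
  also have "\<dots> = G n" using fin n by simp
  finally show ?thesis .
qed

section \<open>Iterates, multipliers and exact periods\<close>

text \<open>Used for exact periods of points and for orders of roots of unity alike.\<close>
lemma least_period_dvd:
  fixes P :: "nat \<Rightarrow> bool"
  assumes "P n" "n > 0" and mod: "\<And>a b. P a \<Longrightarrow> P b \<Longrightarrow> b > 0 \<Longrightarrow> P (a mod b)"
  obtains e where "e dvd n" "e > 0" "P e" "\<And>k. 0 < k \<Longrightarrow> k < e \<Longrightarrow> \<not> P k"
proof -
  define e where "e = (LEAST k. 0 < k \<and> P k)"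
  have e: "0 < e \<and> P e" unfolding e_def by (rule LeastI) (use assms in auto)
  have min: "\<not> P k" if "0 < k" "k < e" for k
    using not_less_Least[of k "\<lambda>k. 0 < k \<and> P k"] that unfolding e_def by blast
  have "n mod e < e" using e by simp
  then have "n mod e = 0" using min mod[of n e] assms e by blast
  then have "e dvd n" by auto
  then show ?thesis using that e min by blast
qed

lemma quad_iter_0: "quad_iter c 0 = [:0, 1:]"
  by (simp add: quad_iter_def)

lemma quad_iter_Suc: "quad_iter c (Suc k) = quad_iter c k ^ 2 + [:c:]"
  by (simp add: quad_iter_def pcompose_pCons power2_eq_square algebra_simps)

lemma poly_quad_iter_0 [simp]: "poly (quad_iter c 0) z = z"
  by (simp add: quad_iter_0)

lemma poly_quad_iter_Suc [simp]: "poly (quad_iter c (Suc k)) z = poly (quad_iter c k) z ^ 2 + c"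
  by (simp add: quad_iter_Suc)

lemma poly_quad_iter_add:
  "poly (quad_iter c (j + k)) z = poly (quad_iter c j) (poly (quad_iter c k) z)"
  by (induction j) auto

lemma poly_quad_iter_mult_fixed:
  assumes "poly (quad_iter c k) z = z"
  shows "poly (quad_iter c (j * k)) z = z"
  using assms by (induction j) (auto simp: poly_quad_iter_add)

lemma poly_quad_iter_mod:
  assumes "poly (quad_iter c k) z = z"
  shows "poly (quad_iter c (i mod k)) z = poly (quad_iter c i) z"
proof -
  have "poly (quad_iter c i) z = poly (quad_iter c (i mod k + i div k * k)) z" by simp
  also have "\<dots> = poly (quad_iter c (i mod k)) z"
    unfolding poly_quad_iter_add using poly_quad_iter_mult_fixed[OF assms] by simp
  finally show ?thesis by simp
qed

lemma degree_lead_coeff_quad_iter: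
  fixes c :: "'a::idom"
  shows "degree (quad_iter c k) = 2 ^ k \<and> lead_coeff (quad_iter c k) = 1"
proof (induction k)
  case 0
  then show ?case by (simp add: quad_iter_0)
next
  case (Suc k)
  have ne: "quad_iter c k \<noteq> 0" using Suc by auto
  have d: "degree (quad_iter c k ^ 2) = 2 ^ Suc k"
    using Suc ne by (simp add: degree_power_eq)
  then have "degree [:c:] < degree (quad_iter c k ^ 2)" by simp
  then show ?case
    unfolding quad_iter_Suc using d Suc
    by (simp add: degree_add_eq_left lead_coeff_add_le lead_coeff_power coeff_eq_0)
       (metis Suc.IH lead_coeff_power one_power2 power_Suc d)
qed

lemma (in comm_ring_hom) hom_quad_iter: "map_poly hom (quad_iter c k) = quad_iter (hom c) k"
proof -
  interpret m: map_poly_comm_ring_hom hom ..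
  show ?thesis
    by (induction k) (auto simp: quad_iter_0 quad_iter_Suc m.hom_add m.hom_power map_poly_pCons_hom)
qed

lemma pderiv_quad_iter:
  "pderiv (quad_iter c n) = (\<Prod>i<n. 2 * quad_iter (c :: 'a::idom) i)"
proof (induction n)
  case (Suc n)
  have "pderiv (q ^ 2) = 2 * q * pderiv q" for q :: "'a poly"
    by (simp add: power2_eq_square pderiv_mult)
  then show ?case using Suc by (simp add: quad_iter_Suc pderiv_add pderiv_pCons mult.commute)
qed (simp add: quad_iter_0 pderiv_pCons)

text \<open>The derivative of the \<open>n\<close>-th iterate; for a point of period \<open>n\<close> this is the multiplier of its cycle.\<close>
definition multiplier :: "'a::idom \<Rightarrow> nat \<Rightarrow> 'a \<Rightarrow> 'a" where
  "multiplier c n z = poly (pderiv (quad_iter c n)) z"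

lemma multiplier_eq: "multiplier c n z = (\<Prod>i<n. 2 * poly (quad_iter c i) z)"
  by (simp add: multiplier_def pderiv_quad_iter poly_prod)

lemma prod_lessThan_add:
  fixes a b :: nat
  shows "(\<Prod>i<a + b. g i) = (\<Prod>i<a. g i) * (\<Prod>i<b. g (i + a) :: 'a::comm_monoid_mult)"
  by (induction b) (auto simp: mult.assoc add.commute)

lemma multiplier_mult:
  assumes "poly (quad_iter c d) z = z"
  shows "multiplier c (j * d) z = multiplier c d z ^ j"
proof (induction j)
  case 0
  then show ?case by (simp add: multiplier_eq)
next
  case (Suc j)
  have "multiplier c (Suc j * d) z
      = (\<Prod>i<j * d. 2 * poly (quad_iter c i) z) * (\<Prod>i<d. 2 * poly (quad_iter c (i + j * d)) z)"
    unfolding multiplier_eq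
    by (simp add: prod_lessThan_add add.commute[of d])
  also have "(\<Prod>i<d. 2 * poly (quad_iter c (i + j * d)) z) = multiplier c d z"
    unfolding multiplier_eq poly_quad_iter_add poly_quad_iter_mult_fixed[OF assms] ..
  finally show ?case using Suc by (simp add: multiplier_eq mult.commute)
qed

text \<open>By the chain rule the multiplier is a product over the orbit, and passing to the image permutes the factors
cyclically.  The case that the orbit contains the critical point 0 is separate, because then the common
factor cannot be cancelled.\<close>
lemma multiplier_image:
  fixes c :: "'a::idom"
  assumes "poly (quad_iter c n) z = z" "n > 0"
  shows "multiplier c n (poly (quad_iter c 1) z) = multiplier c n z"
proof -
  define g where "g i = 2 * poly (quad_iter c i) z" for i
  have s: "poly (quad_iter c i) (poly (quad_iter c 1) z) = poly (quad_iter c (Suc i)) z" for i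
    using poly_quad_iter_add[of c i 1 z] by simp
  have "g 0 * (\<Prod>i<n. g (Suc i)) = (\<Prod>i<n. g i) * g n"
    using prod.lessThan_Suc_shift[of g n] prod.lessThan_Suc[of g n] by simp
  moreover have "g n = g 0" using assms(1) by (simp add: g_def)
  ultimately have "g 0 * (\<Prod>i<n. g (Suc i)) = g 0 * (\<Prod>i<n. g i)" by simp
  moreover have "(\<Prod>i<n. g (Suc i)) = (\<Prod>i<n. g i)" if "g 0 = 0"
  proof -
    have 1: "(\<Prod>i<n. g i) = 0" using that assms(2) by (intro prod_zero) auto
    have 2: "(\<Prod>i<n. g (Suc i)) = 0"
      using that assms(2) \<open>g n = g 0\<close> by (intro prod_zero) (auto intro!: bexI[of _ "n - 1"])
    show ?thesis unfolding 1 2 ..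
  qed
  ultimately have "(\<Prod>i<n. g (Suc i)) = (\<Prod>i<n. g i)" by auto
  then show ?thesis by (simp only: multiplier_eq s g_def)
qed

definition periodic_points :: "'a::comm_ring_1 \<Rightarrow> nat \<Rightarrow> 'a set" where
  "periodic_points c n = {z. poly (quad_iter c n) z = z \<and> (\<forall>k. 0 < k \<and> k < n \<longrightarrow> poly (quad_iter c k) z \<noteq> z)}"

lemma periodic_point_decompose:
  assumes "poly (quad_iter c n) z = z" "n > 0"
  obtains e where "e dvd n" "e > 0" "z \<in> periodic_points c e"
proof -
  have "\<And>a b. poly (quad_iter c a) z = z \<Longrightarrow> poly (quad_iter c b) z = z \<Longrightarrow> poly (quad_iter c (a mod b)) z = z"
    using poly_quad_iter_mod by metis
  then obtain e where "e dvd n" "e > 0" "poly (quad_iter c e) z = z"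
    "\<And>k. 0 < k \<Longrightarrow> k < e \<Longrightarrow> poly (quad_iter c k) z \<noteq> z"
    using least_period_dvd[of "\<lambda>k. poly (quad_iter c k) z = z" n] assms by metis
  then show ?thesis using that by (auto simp: periodic_points_def)
qed

lemma periodic_points_dvd:
  assumes "z \<in> periodic_points c e" "e > 0" "poly (quad_iter c n) z = z"
  shows "e dvd n"
proof -
  have "poly (quad_iter c (n mod e)) z = z"
    using poly_quad_iter_mod[of c e z n] assms by (simp add: periodic_points_def)
  then have "n mod e = 0"
    using assms by (auto simp: periodic_points_def)
  then show ?thesis by auto
qed

lemma fixed_points_Union:
  assumes "n > 0"
  shows "{z. poly (quad_iter c n) z = z} = (\<Union>k\<in>{k. k dvd n}. periodic_points c k)"
proof (intro equalityI subsetI)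
  fix z assume "z \<in> {z. poly (quad_iter c n) z = z}"
  then show "z \<in> (\<Union>k\<in>{k. k dvd n}. periodic_points c k)"
    using periodic_point_decompose[of c n z] assms by auto
next
  fix z assume "z \<in> (\<Union>k\<in>{k. k dvd n}. periodic_points c k)"
  then obtain k where k: "k dvd n" "poly (quad_iter c k) z = z"
    by (auto simp: periodic_points_def)
  then obtain j where "n = j * k" by (metis dvd_def mult.commute)
  with k have "n = j * k" "poly (quad_iter c k) z = z" by auto
  then show "z \<in> {z. poly (quad_iter c n) z = z}"
    using poly_quad_iter_mult_fixed by blast
qed

lemma periodic_points_disjoint:
  assumes "0 < i" "0 < j" "i \<noteq> j"
  shows "periodic_points c i \<inter> periodic_points c j = {}"
  using assms by (auto simp: periodic_points_def) (metis linorder_neqE_nat)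

definition fix_poly :: "'a::idom \<Rightarrow> nat \<Rightarrow> 'a poly" where
  "fix_poly c n = quad_iter c n - [:0, 1:]"

lemma fix_poly_root_iff: "poly (fix_poly c n) z = 0 \<longleftrightarrow> poly (quad_iter c n) z = z"
  by (simp add: fix_poly_def)

lemma fix_poly_monic:
  assumes "n > 0"
  shows "degree (fix_poly c n) = 2 ^ n" "lead_coeff (fix_poly c n) = 1"
proof -
  have "(2::nat) ^ 1 \<le> 2 ^ n" using assms by (intro power_increasing) auto
  then have l: "degree [:0, 1 :: 'a:] < degree (quad_iter c n)"
    using degree_lead_coeff_quad_iter[of c n] by simp
  then have "degree (fix_poly c n) = degree (quad_iter c n)"
    unfolding fix_poly_def diff_conv_add_uminus by (intro degree_add_eq_left) (simp only: degree_minus)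
  then show "degree (fix_poly c n) = 2 ^ n" "lead_coeff (fix_poly c n) = 1"
    using degree_lead_coeff_quad_iter[of c n] l by (auto simp: fix_poly_def coeff_eq_0)
qed

lemma poly_pderiv_fix_poly: "poly (pderiv (fix_poly c n)) z = multiplier c n z - 1"
  by (simp add: fix_poly_def multiplier_def pderiv_diff pderiv_pCons)

lemma map_poly_fix_poly:
  fixes h :: "'a::idom \<Rightarrow> 'b::idom"
  assumes "comm_ring_hom h"
  shows "map_poly h (fix_poly c n) = fix_poly (h c) n"
proof -
  interpret comm_ring_hom h by fact
  interpret m: map_poly_comm_ring_hom h ..
  show ?thesis by (simp add: fix_poly_def m.hom_minus hom_quad_iter map_poly_pCons_hom)
qed

section \<open>The dynatomic polynomial\<close>

lemma separable_factorization:
  fixes p :: "'a::{alg_closed_field,field_char_0} poly"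
  assumes "p \<noteq> 0" "\<And>a. poly p a = 0 \<Longrightarrow> poly (pderiv p) a \<noteq> 0"
  shows "proots p = mset_set {a. poly p a = 0}"
proof (rule multiset_eqI)
  fix a
  have "rsquarefree p" using assms by (auto simp: rsquarefree_roots)
  then have "poly p a = 0 \<Longrightarrow> order a p = 1"
    using rsquarefree_root_order assms(1) by blast
  moreover have "poly p a \<noteq> 0 \<Longrightarrow> order a p = 0" by (simp add: order_0I)
  ultimately show "count (proots p) a = count (mset_set {a. poly p a = 0}) a"
    using assms(1) poly_roots_finite[OF assms(1)] by (cases "poly p a = 0") auto
qed

lemma separable_factorization_monic:
  fixes p :: "'a::{alg_closed_field,field_char_0} poly"
  assumes "lead_coeff p = 1" "\<And>a. poly p a = 0 \<Longrightarrow> poly (pderiv p) a \<noteq> 0"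
  shows "p = (\<Prod>a | poly p a = 0. [:- a, 1:])"
proof -
  have "p \<noteq> 0" using assms(1) by (metis leading_coeff_0_iff zero_neq_one)
  then have "p = smult (lead_coeff p) (\<Prod>\<alpha>\<in>#proots p. [:- \<alpha>, 1:])"
    by (rule alg_closed_factorization)
  also have "\<dots> = (\<Prod>\<alpha>\<in>#mset_set {a. poly p a = 0}. [:- \<alpha>, 1:])"
    using assms by (simp only: separable_factorization[OF \<open>p \<noteq> 0\<close> assms(2)] smult_1_left)
  finally show ?thesis by (simp only: prod_unfold_prod_mset)
qed

text \<open>Extracting \<open>n\<close>-th roots coefficient by coefficient needs division by \<open>n\<close> in the field of fractions.\<close>
instance fract :: ("{idom, ring_char_0}") field_char_0
proof
  have "of_nat n = to_fract (of_nat n :: 'a)" for n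
    by (induction n) auto
  then show "inj (of_nat :: nat \<Rightarrow> 'a fract)"
    by (auto intro!: injI)
qed

text \<open>Specialisation of the generic parameter to a complex number.\<close>
definition eval_at :: "complex \<Rightarrow> int poly \<Rightarrow> complex" where
  "eval_at \<gamma> p = poly (map_poly of_int p) \<gamma>"

lemma comm_ring_hom_eval_at: "comm_ring_hom (eval_at \<gamma>)"
  by unfold_locales (auto simp: eval_at_def of_int_poly_hom.hom_add of_int_poly_hom.hom_mult)

interpretation ev: comm_ring_hom "eval_at \<gamma>" by (rule comm_ring_hom_eval_at)

interpretation evp: map_poly_comm_ring_hom "eval_at \<gamma>" ..

lemma eval_at_X [simp]: "eval_at \<gamma> [:0, 1:] = \<gamma>"
  by (simp add: eval_at_def)

lemma inj_comm_ring_hom_to_closure: "inj_comm_ring_hom to_closure"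
  by unfold_locales (auto simp: to_closure_def)

interpretation tc: inj_comm_ring_hom to_closure by (rule inj_comm_ring_hom_to_closure)

interpretation tci: idom_hom to_closure by unfold_locales

interpretation tcp: map_poly_inj_comm_ring_hom to_closure ..

text \<open>The generic parameter as an element of the algebraically closed field over which \<open>multiplier_poly\<close> is defined.\<close>
definition param :: "int poly fract alg_closure" where "param = to_closure [:0, 1:]"

lemma generic_iter_eq: "generic_iter n - [:0, 1:] = fix_poly [:0, 1:] n"
  by (simp add: generic_iter_def fix_poly_def)

text \<open>For \<open>c = 0\<close> the \<open>n\<close>-th iterate is the power map with exponent \<open>2 ^ n\<close>.\<close>
lemma fixed_point_at_0:
  assumes "poly (quad_iter (0::'a::idom) n) z = z" "n > 0"
  shows "z = 0 \<and> multiplier 0 n z = 0 \<or> z \<noteq> 0 \<and> multiplier 0 n z = 2 ^ n"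
proof -
  have it: "poly (quad_iter 0 k) z = z ^ (2 ^ k)" for k
    by (induction k) (auto simp: power_mult[symmetric] mult.commute)
  have "(\<Prod>i<n. z ^ 2 ^ i) * z = z ^ 2 ^ n" for n
  proof (induction n)
    case (Suc n)
    have "(\<Prod>i<Suc n. z ^ 2 ^ i) * z = z ^ 2 ^ n * ((\<Prod>i<n. z ^ 2 ^ i) * z)"
      by (simp add: mult_ac)
    also have "\<dots> = z ^ (2 ^ n + 2 ^ n)" by (simp only: Suc power_add)
    finally show ?case by (simp add: mult_2)
  qed simp
  then have m: "multiplier 0 n z * z = 2 ^ n * z"
    using assms(1) by (simp add: multiplier_eq it prod.distrib mult.assoc)
  show ?thesis
  proof (cases "z = 0")
    case True
    have "multiplier 0 n z = 0"
      unfolding multiplier_eq it using assms(2) True by (intro prod_zero) (auto intro!: bexI[of _ 0])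
    then show ?thesis using True by simp
  next
    case False
    then show ?thesis using m by simp
  qed
qed

text \<open>The resultant of \<open>f\<^sup>n z - z\<close> and its derivative is a polynomial in \<open>c\<close>.  It does not vanish at \<open>c = 0\<close>, where
all multipliers are 0 or \<open>2 ^ n\<close> and so different from 1; hence it does not vanish identically.\<close>
lemma generic_separable:
  assumes "n > 0" "poly (fix_poly param n) a = 0"
  shows "poly (pderiv (fix_poly param n)) a \<noteq> 0"
proof
  assume a: "poly (pderiv (fix_poly param n)) a = 0"
  define F :: "int poly poly" where "F = fix_poly [:0, 1:] n"
  have dF: "degree (pderiv F) = 2 ^ n - 1"
    using fix_poly_monic(1)[OF assms(1), of "[:0, 1 :: int:]"] by (simp add: F_def degree_pderiv)
  have n2: "(2::nat) ^ 1 \<le> 2 ^ n" using assms by (intro power_increasing) auto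
  have map1: "map_poly (eval_at 0) F = fix_poly 0 n" "map_poly to_closure F = fix_poly param n"
    unfolding F_def map_poly_fix_poly[OF comm_ring_hom_eval_at] eval_at_X
      map_poly_fix_poly[OF tc.comm_ring_hom_axioms] param_def by (rule refl)+
  interpret e: idom_hom "eval_at 0" by unfold_locales
  have map2: "map_poly (eval_at 0) (pderiv F) = pderiv (fix_poly 0 n)"
    "map_poly to_closure (pderiv F) = pderiv (fix_poly param n)"
    by (simp_all add: e.map_poly_pderiv tci.map_poly_pderiv map1)
  have d1: "degree (pderiv (fix_poly (0::complex) n)) = 2 ^ n - 1"
    "degree (pderiv (fix_poly param n)) = 2 ^ n - 1"
    by (simp_all add: degree_pderiv fix_poly_monic(1)[OF assms(1)])
  have ne: "pderiv (fix_poly (0::complex) n) \<noteq> 0" "pderiv (fix_poly param n) \<noteq> 0"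
    using d1 n2 by auto
  have lF: "lead_coeff F = 1" using fix_poly_monic(2)[OF assms(1)] by (simp add: F_def)
  have "eval_at 0 (resultant F (pderiv F))
      = (\<Prod>\<alpha>\<in>#proots (fix_poly 0 n). poly (pderiv (fix_poly 0 n)) \<alpha>)"
    using hom_resultant_monic[OF comm_ring_hom_eval_at lF, of 0 "pderiv F"] d1 ne dF
    by (simp add: map1 map2)
  moreover have "fix_poly (0::complex) n \<noteq> 0"
    using fix_poly_monic[OF assms(1), of "0::complex"] by auto
  moreover have "poly (pderiv (fix_poly 0 n)) \<alpha> \<noteq> 0" if "poly (fix_poly 0 n) \<alpha> = 0" for \<alpha> :: complex
  proof -
    have "(2::complex) ^ n \<noteq> 1"
    proof
      assume "(2::complex) ^ n = 1"
      then have "norm ((2::complex) ^ n) = 1" by simp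
      then have "(2::real) ^ n = 1" by (simp add: norm_power)
      then show False using one_less_power[of "2::real" n] assms(1) by simp
    qed
    then show ?thesis
      using fixed_point_at_0[of n \<alpha>] that assms(1) by (auto simp: poly_pderiv_fix_poly fix_poly_root_iff)
  qed
  ultimately have "eval_at 0 (resultant F (pderiv F)) \<noteq> 0"
    by (auto simp: prod_mset_zero_iff)
  then have "to_closure (resultant F (pderiv F)) \<noteq> 0" by auto
  moreover have "to_closure (resultant F (pderiv F))
      = (\<Prod>\<alpha>\<in>#proots (fix_poly param n). poly (pderiv (fix_poly param n)) \<alpha>)"
    using hom_resultant_monic[OF tc.comm_ring_hom_axioms lF, of "pderiv F"] d1 ne dF
    by (simp add: map1 map2)
  moreover have "fix_poly param n \<noteq> 0"
    using fix_poly_monic[OF assms(1), of param] by auto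
  ultimately show False using a assms(2) by (auto simp: prod_mset_zero_iff)
qed

lemma finite_periodic_points:
  fixes c :: "'a::idom"
  assumes "n > 0"
  shows "finite (periodic_points c n)"
proof -
  have "fix_poly c n \<noteq> 0" using fix_poly_monic[OF assms, of c] by auto
  then have "finite {z. poly (fix_poly c n) z = 0}" by (rule poly_roots_finite)
  then show ?thesis
    by (rule rev_finite_subset) (auto simp: periodic_points_def fix_poly_root_iff)
qed

lemma generic_fix_poly_factorization:
  assumes "n > 0"
  shows "fix_poly param n = (\<Prod>k | k dvd n. \<Prod>a\<in>periodic_points param k. [:- a, 1:])"
proof -
  have "fix_poly param n = (\<Prod>a | poly (fix_poly param n) a = 0. [:- a, 1:])"
    using separable_factorization_monic[OF fix_poly_monic(2) generic_separable] assms by blast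
  also have "{a. poly (fix_poly param n) a = 0} = (\<Union>k\<in>{k. k dvd n}. periodic_points param k)"
    unfolding fix_poly_root_iff using fixed_points_Union[OF assms] by blast
  also have "(\<Prod>a\<in>\<dots>. [:- a, 1:]) = (\<Prod>k | k dvd n. \<Prod>a\<in>periodic_points param k. [:- a, 1:])"
  proof (rule prod.UNION_disjoint)
    show "finite {k. k dvd n}" using assms by simp
    have pos: "k > 0" if "k dvd n" for k using that assms by (auto intro: Nat.gr0I)
    then show "\<forall>k\<in>{k. k dvd n}. finite (periodic_points param k)"
      by (auto intro: finite_periodic_points)
    show "\<forall>i\<in>{k. k dvd n}. \<forall>j\<in>{k. k dvd n}. i \<noteq> j \<longrightarrow> periodic_points param i \<inter> periodic_points param j = {}"
      using periodic_points_disjoint pos by blast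
  qed
  finally show ?thesis .
qed

text \<open>\<open>primitive_factor_exists\<close>, applied to the points of exact period, gives polynomials \<open>P d\<close>; Moebius inversion shows
that they satisfy the description that defines the dynatomic polynomials.\<close>
theorem dynatomic_characterization:
  assumes "n > 0"
  shows "lead_coeff (dynatomic n) = 1"
    and "map_poly to_closure (dynatomic n) = (\<Prod>a\<in>periodic_points param n. [:- a, 1:])"
proof -
  let ?F = "\<lambda>n. fix_poly [:0, 1 :: int:] n"
  have mF: "map_poly to_closure (?F n) = fix_poly param n" for n
    by (simp add: map_poly_fix_poly[OF tc.comm_ring_hom_axioms] param_def)
  have "\<exists>P. lead_coeff P = 1 \<and> map_poly to_closure P = (\<Prod>a\<in>periodic_points param n. [:- a, 1:])"
    if "n > 0" for n
    by (rule primitive_factor_exists[OF inj_comm_ring_hom_to_closure, of ?F])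
       (use that in \<open>simp_all only: mF generic_fix_poly_factorization\<close>)
  then obtain P where P: "\<And>n. n > 0 \<Longrightarrow> lead_coeff (P n) = 1"
    "\<And>n. n > 0 \<Longrightarrow> map_poly to_closure (P n) = (\<Prod>a\<in>periodic_points param n. [:- a, 1:])"
    by metis
  have FP: "?F k = (\<Prod>d | d dvd k. P d)" if "k > 0" for k
  proof -
    have "map_poly to_closure (?F k) = map_poly to_closure (\<Prod>d | d dvd k. P d)"
      unfolding mF tcp.hom_prod generic_fix_poly_factorization[OF that]
      by (rule prod.cong[OF refl]) (use that P(2) in \<open>auto intro!: P(2)[symmetric] Nat.gr0I\<close>)
    then show ?thesis by (simp only: tcp.eq_iff)
  qed
  have "(\<Prod>k | k dvd n. to_fract (generic_iter k - [:0, 1:]) powi moebius (n div k)) = to_fract (P n)"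
  proof (rule multiplicative_moebius_inversion[OF assms])
    fix k assume "k dvd n"
    then have k: "k > 0" using assms by (auto intro: Nat.gr0I)
    show "to_fract (P k) \<noteq> 0" using P(1)[OF k] by auto
    show "to_fract (generic_iter k - [:0, 1:]) = (\<Prod>d | d dvd k. to_fract (P d))"
      unfolding generic_iter_eq FP[OF k] by (simp add: to_fract_hom.hom_prod)
  qed
  then have "dynatomic n = P n"
    unfolding dynatomic_def by (intro the_equality) auto
  then show "lead_coeff (dynatomic n) = 1"
    "map_poly to_closure (dynatomic n) = (\<Prod>a\<in>periodic_points param n. [:- a, 1:])"
    using P assms by auto
qed

lemma dynatomic_prod:
  assumes "n > 0"
  shows "(\<Prod>d | d dvd n. dynatomic d) = fix_poly [:0, 1:] n"
proof -
  have "map_poly to_closure (fix_poly [:0, 1:] n) = map_poly to_closure (\<Prod>d | d dvd n. dynatomic d)"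
    unfolding tcp.hom_prod map_poly_fix_poly[OF tc.comm_ring_hom_axioms] param_def[symmetric]
      generic_fix_poly_factorization[OF assms]
  proof (rule prod.cong[OF refl])
    fix d assume "d \<in> {d. d dvd n}"
    then have "d > 0" using assms by (auto intro: Nat.gr0I)
    then show "(\<Prod>a\<in>periodic_points param d. [:- a, 1:]) = map_poly to_closure (dynatomic d)"
      by (rule dynatomic_characterization(2)[symmetric])
  qed
  then show ?thesis by (simp only: tcp.eq_iff)
qed

section \<open>The multiplier polynomial\<close>

text \<open>The polynomial \<open>\<Prod>\<alpha>. (x - g \<alpha>)\<close> over the roots \<open>\<alpha>\<close> of \<open>p\<close>, with coefficients in the base ring: a resultant with
respect to the inner variable, computed over polynomials in \<open>x\<close>.\<close>
definition char_resultant :: "'a::comm_ring_1 poly \<Rightarrow> 'a poly \<Rightarrow> 'a poly" where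
  "char_resultant p g = resultant (map_poly coeff_lift p) ([:[:0, 1:]:] - map_poly coeff_lift g)"

theorem map_char_resultant:
  fixes h :: "'a::idom \<Rightarrow> 'b::{alg_closed_field,field_char_0}"
  assumes h: "comm_ring_hom h" and p: "lead_coeff p = 1"
    and g: "degree (map_poly h g) = degree g" "degree g > 0"
  shows "map_poly h (char_resultant p g)
       = (\<Prod>\<alpha>\<in>#proots (map_poly h p). [:- poly (map_poly h g) \<alpha>, 1:])"
proof -
  interpret h: comm_ring_hom h by fact
  interpret m: map_poly_comm_ring_hom h ..
  have "poly (map_poly h (char_resultant p g)) x
      = poly (\<Prod>\<alpha>\<in>#proots (map_poly h p). [:- poly (map_poly h g) \<alpha>, 1:]) x" for x
  proof -
    \<comment> \<open>It suffices to compare values at all points \<open>x\<close>; this reduces the claim to resultants over a field.\<close>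
    define \<phi> where "\<phi> r = poly (map_poly h r) x" for r
    have \<phi>: "comm_ring_hom \<phi>"
      by unfold_locales (auto simp: \<phi>_def m.hom_add m.hom_mult)
    interpret f: comm_ring_hom \<phi> by (rule \<phi>)
    interpret fm: map_poly_comm_ring_hom \<phi> ..
    have \<phi>c: "\<phi> [:a:] = h a" for a by (simp add: \<phi>_def h.map_poly_pCons_hom)
    have comp: "map_poly \<phi> (map_poly coeff_lift q) = map_poly h q" for q
      by (rule poly_eqI) (simp add: coeff_map_poly \<phi>c)
    let ?P = "map_poly coeff_lift p" and ?Q = "[:[:0, 1:]:] - map_poly coeff_lift g"
    have lP: "lead_coeff ?P = 1"
      using lead_coeff_map_poly_monic(2)[OF coeff_lift_hom.comm_ring_hom_axioms p] .
    have "map_poly h [:0, 1:] = [:0, 1:]" by (simp add: h.map_poly_pCons_hom)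
    then have x: "\<phi> [:0, 1:] = x" unfolding \<phi>_def by simp
    have mQ: "map_poly \<phi> ?Q = [:x:] - map_poly h g"
      by (simp only: fm.hom_minus comp) (simp add: f.map_poly_pCons_hom x del: pCons_one)
    have dc: "degree (map_poly coeff_lift g) = degree g"
      by (rule degree_map_poly) simp
    have dQ: "degree ?Q = degree g"
      unfolding diff_conv_add_uminus using dc g(2)
      by (subst degree_add_eq_right) (simp_all only: degree_minus degree_pCons_0)
    have dQ': "degree ([:x:] - map_poly h g) = degree g"
      unfolding diff_conv_add_uminus using g
      by (subst degree_add_eq_right) (simp_all only: degree_minus degree_pCons_0)
    have "\<phi> (char_resultant p g)
        = (\<Prod>\<alpha>\<in>#proots (map_poly h p). poly ([:x:] - map_poly h g) \<alpha>)"
      unfolding char_resultant_def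
      by (subst hom_resultant_monic[OF \<phi> lP]) (use dQ dQ' g in \<open>auto simp only: mQ comp degree_0\<close>)
    also have "\<dots> = poly (\<Prod>\<alpha>\<in>#proots (map_poly h p). [:- poly (map_poly h g) \<alpha>, 1:]) x"
      by (simp add: poly_prod_mset)
    finally show ?thesis by (simp add: \<phi>_def)
  qed
  then show ?thesis by (simp only: poly_eq_poly_eq_iff[symmetric] fun_eq_iff) simp
qed

text \<open>Every cycle of \<open>f\<close> has exactly \<open>n\<close> points and \<open>h\<close> is constant along it, so one point from every cycle suffices.\<close>
theorem prod_over_cycles:
  fixes h :: "'a \<Rightarrow> 'b::comm_monoid_mult"
  assumes "finite S" "n > 0" "\<And>a. a \<in> S \<Longrightarrow> f a \<in> S" "\<And>a. a \<in> S \<Longrightarrow> (f ^^ n) a = a"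
    "\<And>a k. a \<in> S \<Longrightarrow> 0 < k \<Longrightarrow> k < n \<Longrightarrow> (f ^^ k) a \<noteq> a" "\<And>a. a \<in> S \<Longrightarrow> h (f a) = h a"
  shows "\<exists>T. T \<subseteq> S \<and> (\<Prod>a\<in>S. h a) = (\<Prod>a\<in>T. h a) ^ n"
  using assms
proof (induction "card S" arbitrary: S rule: less_induct)
  case (less S)
  show ?case
  proof (cases "S = {}")
    case False
    then obtain a where a: "a \<in> S" by blast
    have fk: "(f ^^ k) b \<in> S" if "b \<in> S" for b k using that less.prems(3) by (induction k) auto
    have hk: "h ((f ^^ k) b) = h b" if "b \<in> S" for b k
      using that less.prems(6) fk by (induction k) auto
    define Orb where "Orb = (\<lambda>k. (f ^^ k) a) ` {..<n}"
    have inj: "inj_on (\<lambda>k. (f ^^ k) a) {..<n}"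
    proof (rule linorder_inj_onI)
      fix i j assume ij: "i < j" "i \<in> {..<n}" "j \<in> {..<n}"
      have "(f ^^ j) a = (f ^^ (j - i)) ((f ^^ i) a)"
        using ij by (simp flip: funpow_add[unfolded o_def, THEN fun_cong])
      then show "(f ^^ i) a \<noteq> (f ^^ j) a"
        using less.prems(5)[OF fk[OF a], of "j - i" i] ij less_imp_diff_less[of j n i] by auto
    qed auto
    have OS: "Orb \<subseteq> S" unfolding Orb_def using fk a by auto
    have aO: "a \<in> Orb" unfolding Orb_def using less.prems(2) by (auto intro!: image_eqI[of _ _ 0])
    have prodO: "(\<Prod>b\<in>Orb. h b) = h a ^ n"
      unfolding Orb_def prod.reindex[OF inj] using hk[OF a] by simp
    have fn1: "f ((f ^^ (n - 1)) b) = (f ^^ n) b" for b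
      using less.prems(2) by (metis Suc_diff_1 comp_apply funpow.simps(2))
    have pre: "b \<in> Orb" if b: "b \<in> S" "f b \<in> Orb" for b
    proof -
      obtain k where k: "k < n" "f b = (f ^^ k) a" using b(2) unfolding Orb_def by auto
      have "b = (f ^^ (n - 1)) (f b)"
        using less.prems(4)[OF b(1)] fn1[of b] by (simp add: funpow_swap1)
      also have "\<dots> = (f ^^ (n - 1 + k)) a" using k(2) by (simp add: funpow_add)
      finally have bk: "b = (f ^^ (n - 1 + k)) a" .
      show ?thesis
      proof (cases "k = 0")
        case True
        then show ?thesis using bk less.prems(2) by (auto simp: Orb_def)
      next
        case False
        then have "n - 1 + k = (k - 1) + n" using less.prems(2) by simp
        then have "b = (f ^^ (k - 1)) a" using bk less.prems(4)[OF a] by (simp add: funpow_add)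
        then show ?thesis using k(1) by (auto simp: Orb_def)
      qed
    qed
    have "card (S - Orb) < card S"
      using aO a less.prems(1) by (intro psubset_card_mono) auto
    then have "\<exists>T. T \<subseteq> S - Orb \<and> (\<Prod>a\<in>S - Orb. h a) = (\<Prod>a\<in>T. h a) ^ n"
    proof (rule less.hyps)
      fix b assume b: "b \<in> S - Orb"
      then show "f b \<in> S - Orb" using less.prems(3) pre by blast
      show "(f ^^ n) b = b" "h (f b) = h b" using b less.prems(4,6) by blast+
      fix k assume "0 < k" "k < n"
      then show "(f ^^ k) b \<noteq> b" using b less.prems(5) by blast
    qed (use less.prems(1,2) in auto)
    then obtain T where T: "T \<subseteq> S - Orb" "(\<Prod>a\<in>S - Orb. h a) = (\<Prod>a\<in>T. h a) ^ n" by blast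
    have "a \<notin> T" "finite T" using T(1) aO less.prems(1) by (auto intro: finite_subset)
    then have "(\<Prod>b\<in>insert a T. h b) ^ n = h a ^ n * (\<Prod>a\<in>S - Orb. h a)"
      by (simp add: T(2) power_mult_distrib)
    also have "\<dots> = (\<Prod>b\<in>S. h b)"
      unfolding prodO[symmetric] using prod.subset_diff[OF OS less.prems(1), of h] by (simp add: mult.commute)
    finally show ?thesis using T(1) a by (intro exI[of _ "insert a T"]) auto
  qed auto
qed

lemma funpow_quad: "(poly (quad_iter c 1) ^^ k) z = poly (quad_iter c k) z"
  by (induction k) auto

lemma periodic_points_image:
  assumes "z \<in> periodic_points c n" "n > 0"
  shows "poly (quad_iter c 1) z \<in> periodic_points c n"
proof -
  let ?f = "\<lambda>k. poly (quad_iter c k)"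
  have per: "?f n z = z" and min: "\<And>k. 0 < k \<Longrightarrow> k < n \<Longrightarrow> ?f k z \<noteq> z"
    using assms(1) by (auto simp: periodic_points_def)
  have add: "?f i (?f j w) = ?f (i + j) w" for i j w by (simp add: poly_quad_iter_add)
  have "?f n (?f 1 z) = ?f 1 (?f n z)" by (simp only: add add.commute)
  moreover have "?f k (?f 1 z) \<noteq> ?f 1 z" if k: "0 < k" "k < n" for k
  proof
    assume "?f k (?f 1 z) = ?f 1 z"
    then have "?f (n - 1) (?f k (?f 1 z)) = ?f (n - 1) (?f 1 z)" by simp
    then have "?f (n - 1 + (k + 1)) z = ?f (n - 1 + 1) z" by (simp only: add)
    moreover have "n - 1 + (k + 1) = k + n" "n - 1 + 1 = n" using assms(2) by simp_all
    ultimately have "?f (k + n) z = ?f n z" by (simp only:)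
    then have "?f k z = z" using per by (simp add: poly_quad_iter_add)
    then show False using min k by blast
  qed
  ultimately show ?thesis using per by (auto simp: periodic_points_def)
qed

lemma map_pderiv_generic_iter:
  fixes h :: "int poly \<Rightarrow> 'b::{idom,ring_char_0}"
  assumes "comm_ring_hom h"
  shows "map_poly h (pderiv (generic_iter n)) = pderiv (quad_iter (h [:0, 1:]) n)"
    and "degree (map_poly h (pderiv (generic_iter n))) = degree (pderiv (generic_iter n))"
proof -
  interpret h: comm_ring_hom h by fact
  interpret i: idom_hom h by unfold_locales
  show 1: "map_poly h (pderiv (generic_iter n)) = pderiv (quad_iter (h [:0, 1:]) n)"
    by (simp only: i.map_poly_pderiv generic_iter_def h.hom_quad_iter)
  show "degree (map_poly h (pderiv (generic_iter n))) = degree (pderiv (generic_iter n))"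
    by (subst 1) (simp add: generic_iter_def degree_pderiv degree_lead_coeff_quad_iter)
qed

lemma degree_pderiv_generic_iter: "n > 0 \<Longrightarrow> degree (pderiv (generic_iter n)) > 0"
proof -
  assume "n > 0"
  then have "(2::nat) ^ 1 \<le> 2 ^ n" by (intro power_increasing) auto
  then show ?thesis by (simp add: generic_iter_def degree_pderiv degree_lead_coeff_quad_iter)
qed

definition multiplier_resultant :: "nat \<Rightarrow> int poly poly" where
  "multiplier_resultant n = char_resultant (dynatomic n) (pderiv (generic_iter n))"

lemma map_multiplier_resultant:
  fixes h :: "int poly \<Rightarrow> 'b::{alg_closed_field,field_char_0}"
  assumes "comm_ring_hom h" "n > 0"
  shows "map_poly h (multiplier_resultant n)
    = (\<Prod>\<alpha>\<in>#proots (map_poly h (dynatomic n)). [:- multiplier (h [:0, 1:]) n \<alpha>, 1:])"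
  unfolding multiplier_resultant_def multiplier_def map_pderiv_generic_iter(1)[OF assms(1), symmetric]
  by (rule map_char_resultant[OF assms(1) dynatomic_characterization(1)[OF assms(2)]
        map_pderiv_generic_iter(2)[OF assms(1)] degree_pderiv_generic_iter[OF assms(2)]])

text \<open>The product over all points of exact period \<open>n\<close> is an \<open>n\<close>-th power \<open>D ^ n\<close> over the algebraic closure, and as
a resultant it has coefficients in the polynomial ring over the integers.  The coefficients of \<open>D\<close>
descend first to the field of fractions and then to that ring.\<close>
theorem multiplier_poly_characterization:
  assumes "n > 0"
  shows "lead_coeff (multiplier_poly n) = 1" "multiplier_poly n ^ n = multiplier_resultant n"
proof -
  let ?R = "multiplier_resultant n"
  let ?S = "periodic_points param n"
  let ?h = "\<lambda>a. [:- multiplier param n a, 1:]"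
  have "proots (map_poly to_closure (dynatomic n)) = mset_set ?S"
    unfolding dynatomic_characterization(2)[OF assms] prod_unfold_prod_mset
    by (rule proots_linear_product)
  then have mR: "map_poly to_closure ?R = (\<Prod>a\<in>?S. ?h a)"
    using map_multiplier_resultant[OF tc.comm_ring_hom_axioms assms]
    by (simp only: param_def[symmetric] prod_unfold_prod_mset)
  have "\<exists>T. T \<subseteq> ?S \<and> (\<Prod>a\<in>?S. ?h a) = (\<Prod>a\<in>T. ?h a) ^ n"
  proof (rule prod_over_cycles[where f = "poly (quad_iter param 1)"])
    fix a assume a: "a \<in> ?S"
    then show "(poly (quad_iter param 1) ^^ n) a = a"
      by (simp only: funpow_quad) (simp add: periodic_points_def)
    show "poly (quad_iter param 1) a \<in> ?S" using periodic_points_image[OF a assms] .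
    show "?h (poly (quad_iter param 1) a) = ?h a"
      using a assms by (subst multiplier_image) (auto simp: periodic_points_def)
    fix k assume "0 < k" "k < n"
    then show "(poly (quad_iter param 1) ^^ k) a \<noteq> a"
      using a by (simp only: funpow_quad) (simp add: periodic_points_def)
  qed (use assms finite_periodic_points in auto)
  then obtain T where T: "map_poly to_closure ?R = (\<Prod>a\<in>T. ?h a) ^ n" unfolding mR by blast
  define D where "D = (\<Prod>a\<in>T. ?h a)"
  have lD: "lead_coeff D = 1" unfolding D_def by (simp add: lead_coeff_prod)
  have tc: "map_poly to_closure q = map_poly to_ac (map_poly to_fract q)" for q
    by (rule poly_eqI) (simp add: coeff_map_poly to_closure_def)
  have ac: "inj_comm_ring_hom (to_ac :: int poly fract \<Rightarrow> _)" by unfold_locales auto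
  interpret ac: inj_comm_ring_hom "to_ac :: int poly fract \<Rightarrow> _" by (rule ac)
  interpret acp: map_poly_inj_comm_ring_hom "to_ac :: int poly fract \<Rightarrow> _" ..
  have e1: "map_poly to_ac (map_poly to_fract ?R) = D ^ n" using T unfolding tc D_def .
  obtain D' where D': "D = map_poly to_ac D'"
    using monic_root_descends_field[OF ac lD assms e1] by blast
  have "map_poly to_ac (map_poly to_fract ?R) = map_poly to_ac (D' ^ n)"
    using e1 unfolding D' acp.hom_power .
  then have e2: "map_poly to_fract ?R = D' ^ n" by (simp only: acp.eq_iff)
  have lD': "lead_coeff D' = 1" using lD unfolding D' by simp
  obtain d where d: "D' = map_poly to_fract d"
    using monic_root_descends_fract[OF lD' assms e2] by blast
  have ld: "lead_coeff d = 1" using lD' unfolding d by (simp add: degree_map_poly coeff_map_poly)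
  have "map_poly to_closure (d ^ n) = map_poly to_closure ?R"
    unfolding tcp.hom_power unfolding T using D' d by (simp only: tc D_def)
  then have dR: "d ^ n = ?R" by (simp only: tcp.eq_iff)
  have "(\<Prod>\<alpha>\<in>#proots (map_poly to_closure (dynatomic n)).
          [:- poly (map_poly to_closure (pderiv (generic_iter n))) \<alpha>, 1:]) = map_poly to_closure ?R"
    using map_multiplier_resultant[OF tc.comm_ring_hom_axioms assms]
    unfolding multiplier_def map_pderiv_generic_iter(1)[OF tc.comm_ring_hom_axioms] by simp
  then have "multiplier_poly n = (THE d. lead_coeff d = 1 \<and> map_poly to_closure d ^ n = map_poly to_closure ?R)"
    unfolding multiplier_poly_def by (simp only:)
  also have "\<dots> = d"
  proof (rule the_equality)
    show "lead_coeff d = 1 \<and> map_poly to_closure d ^ n = map_poly to_closure ?R"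
      using ld dR by (simp flip: tcp.hom_power)
    fix e assume e: "lead_coeff e = 1 \<and> map_poly to_closure e ^ n = map_poly to_closure ?R"
    then have "e ^ n = d ^ n" unfolding dR by (simp only: tcp.hom_power[symmetric] tcp.eq_iff)
    then show "e = d" using monic_power_inj[of e d n] e ld assms by blast
  qed
  finally show "lead_coeff (multiplier_poly n) = 1" "multiplier_poly n ^ n = ?R"
    using ld dR by simp_all
qed

section \<open>Cyclotomic polynomials\<close>

definition prim_roots :: "nat \<Rightarrow> complex set" where
  "prim_roots r = {\<zeta>. \<zeta> ^ r = 1 \<and> (\<forall>k. 0 < k \<and> k < r \<longrightarrow> \<zeta> ^ k \<noteq> 1)}"

lemma finite_unity_roots: "n > 0 \<Longrightarrow> finite {\<zeta>::complex. \<zeta> ^ n = 1}"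
  by (rule finite_roots_unity) simp

lemma finite_prim_roots: "n > 0 \<Longrightarrow> finite (prim_roots n)"
  by (rule rev_finite_subset[OF finite_unity_roots]) (auto simp: prim_roots_def)

lemma unity_root_decompose:
  assumes "\<zeta> ^ n = (1::complex)" "n > 0"
  obtains e where "e dvd n" "e > 0" "\<zeta> \<in> prim_roots e"
proof -
  have "\<And>a b. \<zeta> ^ a = 1 \<Longrightarrow> \<zeta> ^ b = 1 \<Longrightarrow> \<zeta> ^ (a mod b) = 1"
  proof -
    fix a b assume ab: "\<zeta> ^ a = 1" "\<zeta> ^ b = 1"
    have "\<zeta> ^ a = \<zeta> ^ (b * (a div b) + a mod b)" by simp
    also have "\<dots> = \<zeta> ^ (a mod b)" unfolding power_add power_mult ab(2) by simp
    finally show "\<zeta> ^ (a mod b) = 1" using ab(1) by simp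
  qed
  then obtain e where "e dvd n" "e > 0" "\<zeta> ^ e = 1" "\<And>k. 0 < k \<Longrightarrow> k < e \<Longrightarrow> \<zeta> ^ k \<noteq> 1"
    using least_period_dvd[of "\<lambda>k. \<zeta> ^ k = 1" n] assms by metis
  then show ?thesis using that by (auto simp: prim_roots_def)
qed

lemma unity_roots_Union:
  assumes "n > 0"
  shows "{\<zeta>::complex. \<zeta> ^ n = 1} = (\<Union>k\<in>{k. k dvd n}. prim_roots k)"
proof (intro equalityI subsetI)
  fix z :: complex assume "z \<in> {\<zeta>. \<zeta> ^ n = 1}"
  then show "z \<in> (\<Union>k\<in>{k. k dvd n}. prim_roots k)"
    using unity_root_decompose[of z n] assms by auto
next
  fix z assume "z \<in> (\<Union>k\<in>{k. k dvd n}. prim_roots k)"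
  then obtain k where k: "k dvd n" "z ^ k = 1" by (auto simp: prim_roots_def)
  then show "z \<in> {\<zeta>. \<zeta> ^ n = 1}" by (auto simp: power_mult elim: dvdE)
qed

lemma prim_roots_disjoint:
  assumes "0 < i" "0 < j" "i \<noteq> j"
  shows "prim_roots i \<inter> prim_roots j = {}"
  using assms by (auto simp: prim_roots_def) (metis linorder_neqE_nat)

lemma prod_unity_roots:
  fixes h :: "complex \<Rightarrow> 'b::comm_monoid_mult"
  assumes "n > 0"
  shows "(\<Prod>\<zeta> | \<zeta> ^ n = 1. h \<zeta>) = (\<Prod>k | k dvd n. \<Prod>\<zeta>\<in>prim_roots k. h \<zeta>)"
  unfolding unity_roots_Union[OF assms]
proof (rule prod.UNION_disjoint)
  show "finite {k. k dvd n}" using assms by simp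
  have pos: "k > 0" if "k dvd n" for k using that assms by (auto intro: Nat.gr0I)
  then show "\<forall>k\<in>{k. k dvd n}. finite (prim_roots k)" by (auto intro: finite_prim_roots)
  show "\<forall>i\<in>{k. k dvd n}. \<forall>j\<in>{k. k dvd n}. i \<noteq> j \<longrightarrow> prim_roots i \<inter> prim_roots j = {}"
    using prim_roots_disjoint pos by blast
qed

lemma unity_poly_monic:
  assumes "n > 0"
  shows "lead_coeff (monom 1 n - 1 :: 'a::idom poly) = 1"
proof -
  have "degree (monom 1 n - 1 :: 'a poly) = n"
    unfolding diff_conv_add_uminus using assms
    by (subst degree_add_eq_left) (simp_all add: degree_monom_eq)
  then show ?thesis using assms by simp
qed

lemma unity_poly_factorization:
  assumes "n > 0"
  shows "monom 1 n - 1 = (\<Prod>k | k dvd n. \<Prod>\<zeta>\<in>prim_roots k. [:- \<zeta>, 1:])"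
proof -
  let ?p = "monom 1 n - 1 :: complex poly"
  have r: "{a. poly ?p a = 0} = {a. a ^ n = 1}" by (simp add: poly_monom)
  have "poly (pderiv ?p) a \<noteq> 0" if "poly ?p a = 0" for a
  proof -
    have "a \<noteq> 0" using that assms by (auto simp: poly_monom power_0_left)
    then show ?thesis using assms by (simp add: pderiv_diff pderiv_monom poly_monom)
  qed
  then have "?p = (\<Prod>a | poly ?p a = 0. [:- a, 1:])"
    by (rule separable_factorization_monic[OF unity_poly_monic[OF assms]])
  then show ?thesis unfolding r prod_unity_roots[OF assms] .
qed

lemma map_poly_of_int_unity: "map_poly of_int (monom 1 n - 1 :: int poly) = (monom 1 n - 1 :: complex poly)"
  by (simp add: of_int_poly_hom.hom_minus map_poly_monom)

theorem cyclotomic_poly_characterization: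
  assumes "n > 0"
  shows "lead_coeff (cyclotomic_poly n) = 1"
    and "map_poly of_int (cyclotomic_poly n) = (\<Prod>\<zeta>\<in>prim_roots n. [:- \<zeta>, 1:])"
proof -
  have inj: "inj_comm_ring_hom (of_int :: int \<Rightarrow> complex)" by unfold_locales auto
  have "\<exists>P. lead_coeff P = 1 \<and> map_poly of_int P = (\<Prod>a\<in>prim_roots n. [:- a, 1:])"
    by (rule primitive_factor_exists[OF inj, of "\<lambda>n. monom 1 n - 1", OF _ assms])
      (simp only: map_poly_of_int_unity unity_poly_factorization)
  then obtain P :: "int poly" where P: "lead_coeff P = 1" "map_poly of_int P = (\<Prod>a\<in>prim_roots n. [:- a, 1:])"
    by blast
  have "cyclotomic_poly n = P"
    unfolding cyclotomic_poly_def
  proof (rule the_equality)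
    show *: "map_poly of_int P = (\<Prod>\<zeta>\<in>{\<zeta>::complex. \<zeta> ^ n = 1 \<and> (\<forall>k. 0 < k \<and> k < n \<longrightarrow> \<zeta> ^ k \<noteq> 1)}. [:- \<zeta>, 1:])"
      using P(2) by (simp add: prim_roots_def)
    fix Q :: "int poly"
    assume "map_poly of_int Q = (\<Prod>\<zeta>\<in>{\<zeta>::complex. \<zeta> ^ n = 1 \<and> (\<forall>k. 0 < k \<and> k < n \<longrightarrow> \<zeta> ^ k \<noteq> 1)}. [:- \<zeta>, 1:])"
    then have "map_poly (of_int :: int \<Rightarrow> complex) Q = map_poly of_int P" using * by simp
    then show "Q = P" by simp
  qed
  then show "lead_coeff (cyclotomic_poly n) = 1"
     "map_poly of_int (cyclotomic_poly n) = (\<Prod>\<zeta>\<in>prim_roots n. [:- \<zeta>, 1:])"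
    using P by auto
qed

lemma poly_cyclotomic:
  assumes "n > 0"
  shows "of_int (poly (cyclotomic_poly n) x) = (\<Prod>\<zeta>\<in>prim_roots n. of_int x - \<zeta>)"
proof -
  have "of_int (poly (cyclotomic_poly n) x) = poly (map_poly of_int (cyclotomic_poly n)) (of_int x :: complex)"
    by simp
  then show ?thesis
    unfolding cyclotomic_poly_characterization(2)[OF assms] by (simp add: poly_prod)
qed

lemma prod_cyclotomic_value:
  assumes "n > 0"
  shows "(\<Prod>d | d dvd n. poly (cyclotomic_poly d) x) = x ^ n - 1"
proof -
  have "(of_int (\<Prod>d | d dvd n. poly (cyclotomic_poly d) x) :: complex)
      = (\<Prod>d | d dvd n. \<Prod>\<zeta>\<in>prim_roots d. of_int x - \<zeta>)"
    unfolding of_int_prod by (rule prod.cong[OF refl]) (use assms in \<open>auto intro!: poly_cyclotomic Nat.gr0I\<close>)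
  also have "\<dots> = poly (monom 1 n - 1) (of_int x)"
    unfolding unity_poly_factorization[OF assms] by (simp add: poly_prod)
  also have "\<dots> = of_int (x ^ n - 1)" by (simp add: poly_monom)
  finally show ?thesis by (simp only: of_int_eq_iff)
qed

lemma degree_linear_prod: "degree (\<Prod>a\<in>A. [:- a, 1 :: 'a::idom:]) = card A"
  by (subst degree_prod_sum_eq) (auto simp del: pCons_one)

text \<open>Both sides have the same sums over the divisors of \<open>n\<close>.\<close>
theorem card_prim_roots: "n > 0 \<Longrightarrow> card (prim_roots n) = totient n"
proof (induction n rule: less_induct)
  case (less n)
  define D where "D = {k. k dvd n \<and> k \<noteq> n}"
  have D: "finite D" "{k. k dvd n} = insert n D" "n \<notin> D"
    using less.prems unfolding D_def by auto
  have kD: "k < n" "k > 0" if "k \<in> D" for k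
    using that less.prems dvd_imp_le[of k n] unfolding D_def by (auto intro!: Nat.gr0I)
  have "degree (monom 1 n - 1 :: complex poly) = (\<Sum>k | k dvd n. card (prim_roots k))"
    unfolding unity_poly_factorization[OF less.prems]
  proof (subst degree_prod_sum_eq)
    fix k show "(\<Prod>\<zeta>\<in>prim_roots k. [:- \<zeta>, 1:]) \<noteq> 0"
      using lead_coeff_linear_prod[of "prim_roots k"] by (metis leading_coeff_0_iff zero_neq_one)
  qed (simp only: degree_linear_prod)
  moreover have "degree (monom 1 n - 1 :: complex poly) = n"
    unfolding diff_conv_add_uminus using less.prems
    by (subst degree_add_eq_left) (simp_all add: degree_monom_eq)
  ultimately have "(\<Sum>k | k dvd n. card (prim_roots k)) = (\<Sum>k | k dvd n. totient k)"
    by (simp add: totient_divisor_sum)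
  then have "card (prim_roots n) + (\<Sum>k\<in>D. card (prim_roots k)) = totient n + (\<Sum>k\<in>D. totient k)"
    using D by simp
  moreover have "(\<Sum>k\<in>D. card (prim_roots k)) = (\<Sum>k\<in>D. totient k)"
    using less.IH kD by (intro sum.cong) auto
  ultimately show ?case by simp
qed

lemma norm_prim_root: "\<zeta> \<in> prim_roots r \<Longrightarrow> r > 0 \<Longrightarrow> norm \<zeta> = 1"
  using power_eq_imp_eq_base[of "norm \<zeta>" r 1] by (auto simp: prim_roots_def norm_power[symmetric])

lemma prim_root_neq_1: "\<zeta> \<in> prim_roots r \<Longrightarrow> r > 1 \<Longrightarrow> \<zeta> \<noteq> 1"
  by (auto simp: prim_roots_def)

lemma prim_roots_nonempty: "r > 0 \<Longrightarrow> prim_roots r \<noteq> {}"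
  using card_prim_roots[of r] by auto

lemma prim_root_power_eq_1_iff:
  assumes "\<zeta> \<in> prim_roots r" "r > 0"
  shows "\<zeta> ^ i = 1 \<longleftrightarrow> r dvd i"
proof
  assume "r dvd i" then show "\<zeta> ^ i = 1" using assms by (auto simp: prim_roots_def power_mult elim: dvdE)
next
  assume i: "\<zeta> ^ i = 1"
  have "\<zeta> ^ i = \<zeta> ^ (r * (i div r) + i mod r)" by simp
  also have "\<dots> = \<zeta> ^ (i mod r)" unfolding power_add power_mult using assms by (simp add: prim_roots_def)
  finally have "\<zeta> ^ (i mod r) = 1" using i by simp
  moreover have "i mod r < r" using assms by simp
  ultimately have "i mod r = 0" using assms by (auto simp: prim_roots_def)
  then show "r dvd i" by auto
qed

section \<open>Primitive prime divisors\<close>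

lemma power_decompose:
  fixes x z :: complex
  assumes "p > 0" "z \<noteq> 0"
  shows "(\<Prod>\<omega> | \<omega> ^ p = z. x - \<omega>) = x ^ p - z"
proof -
  let ?q = "monom 1 p + [:- z:] :: complex poly"
  have "degree ?q = p"
    using assms by (subst degree_add_eq_left) (simp_all add: degree_monom_eq)
  then have l: "lead_coeff ?q = 1" using assms(1) by (simp add: coeff_pCons split: nat.splits)
  have r: "{a. poly ?q a = 0} = {a. a ^ p = z}" by (simp add: poly_monom)
  have "poly (pderiv ?q) a \<noteq> 0" if "poly ?q a = 0" for a
  proof -
    have "a \<noteq> 0" using that assms by (auto simp: poly_monom power_0_left)
    then show ?thesis using assms by (simp add: pderiv_add pderiv_monom poly_monom pderiv_pCons)
  qed
  then have "?q = (\<Prod>a | poly ?q a = 0. [:- a, 1:])"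
    by (rule separable_factorization_monic[OF l])
  then have "poly ?q x = (\<Prod>a | a ^ p = z. x - a)"
    unfolding r by (simp add: poly_prod)
  then show ?thesis by (simp add: poly_monom)
qed

text \<open>Among the points of the unit circle, 1 is the only one at distance 1 from 2; all others are farther away.\<close>
lemma cyclotomic_2_gt_1:
  assumes "n > 1"
  shows "\<bar>poly (cyclotomic_poly n) 2\<bar> > 1"
proof -
  have n: "n > 0" using assms by simp
  have fin: "finite (prim_roots n)" using finite_prim_roots n by auto
  have "norm (2 - \<zeta>) > 1" if z: "\<zeta> \<in> prim_roots n" for \<zeta>
  proof -
    have nz: "norm \<zeta> = 1" "\<zeta> \<noteq> 1" using norm_prim_root prim_root_neq_1 z assms n by auto
    have "norm (2 - \<zeta>) \<ge> 2 - 1" using norm_triangle_ineq2[of 2 \<zeta>] nz by simp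
    moreover have "norm (2 - \<zeta>) \<noteq> 1"
    proof
      assume a: "norm (2 - \<zeta>) = 1"
      have "(2 - Re \<zeta>)\<^sup>2 + (Im \<zeta>)\<^sup>2 = 1" "(Re \<zeta>)\<^sup>2 + (Im \<zeta>)\<^sup>2 = 1"
        using a nz cmod_power2[of "2 - \<zeta>"] cmod_power2[of \<zeta>] by simp_all
      then have "Re \<zeta> = 1" by (simp add: power2_eq_square algebra_simps)
      moreover from this have "Im \<zeta> = 0" using \<open>(Re \<zeta>)\<^sup>2 + (Im \<zeta>)\<^sup>2 = 1\<close> by simp
      ultimately show False using nz(2) by (simp add: complex_eq_iff)
    qed
    ultimately show ?thesis by simp
  qed
  then have "1 < (\<Prod>\<zeta>\<in>prim_roots n. norm (2 - \<zeta>))"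
    using fin prim_roots_nonempty[OF n]
    by (intro less_1_prod) auto
  also have "\<dots> = norm (of_int (poly (cyclotomic_poly n) 2) :: complex)"
    unfolding poly_cyclotomic[OF n] by (simp add: prod_norm[symmetric])
  also have "\<dots> = real_of_int \<bar>poly (cyclotomic_poly n) 2\<bar>" by simp
  finally show ?thesis by simp
qed

lemma norm_2_minus_prim_root:
  assumes "\<zeta> \<in> prim_roots n" "n > 0"
  shows "1 \<le> norm (2 - \<zeta>)" "norm (2 - \<zeta>) \<le> 3"
  using norm_triangle_ineq2[of 2 \<zeta>] norm_triangle_ineq4[of 2 \<zeta>] norm_prim_root[OF assms] by simp_all

lemma norm_cyclotomic_value:
  assumes "n > 0"
  shows "real_of_int \<bar>poly (cyclotomic_poly n) x\<bar> = (\<Prod>\<zeta>\<in>prim_roots n. norm (of_int x - \<zeta>))"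
proof -
  have "real_of_int \<bar>poly (cyclotomic_poly n) x\<bar> = norm (of_int (poly (cyclotomic_poly n) x) :: complex)"
    by simp
  then show ?thesis unfolding poly_cyclotomic[OF assms] by (simp add: prod_norm)
qed

text \<open>The \<open>p\<close>-th roots of the primitive \<open>m\<close>-th roots of unity are primitive of order \<open>p * m\<close> or \<open>m\<close>.  The product of
\<open>2 - \<omega>\<close> over all of them is the product of \<open>2 ^ p - \<zeta>\<close> over the primitive \<open>m\<close>-th roots \<open>\<zeta>\<close>, and those of
order \<open>m\<close> contribute at most a factor 3 each.\<close>
lemma cyclotomic_value_lower_bound:
  assumes "prime p" "m > 0"
  shows "((2 ^ p - 1) / 3) ^ totient m \<le> real_of_int \<bar>poly (cyclotomic_poly (p * m)) 2\<bar>"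
proof -
  have p0: "p > 0" using assms(1) by (simp add: prime_gt_0_nat)
  define W where "W = (\<Union>\<zeta>\<in>prim_roots m. {\<omega>. \<omega> ^ p = \<zeta>})"
  have z0: "\<zeta> \<noteq> 0" if "\<zeta> \<in> prim_roots m" for \<zeta>
    using norm_prim_root[OF that assms(2)] by auto
  have pm: "p * m > 0" using p0 assms(2) by simp
  have sub: "W \<subseteq> prim_roots (p * m) \<union> prim_roots m"
  proof
    fix \<omega> assume "\<omega> \<in> W"
    then have w: "\<omega> ^ p \<in> prim_roots m" by (auto simp: W_def)
    then have "\<omega> ^ (p * m) = 1" by (simp add: prim_roots_def power_mult)
    then obtain e where e: "e dvd p * m" "e > 0" "\<omega> \<in> prim_roots e"
      using unity_root_decompose pm by blast
    have "(\<omega> ^ p) ^ e = (\<omega> ^ e) ^ p" by (simp add: power_mult[symmetric] mult.commute)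
    then have "(\<omega> ^ p) ^ e = 1" using e(3) by (simp add: prim_roots_def)
    then have "m dvd e" using prim_root_power_eq_1_iff[OF w assms(2)] by blast
    then obtain t where t: "e = t * m" by (metis dvd_def mult.commute)
    then have "t dvd p" using e(1) assms(2) by simp
    then have "t = 1 \<or> t = p" using assms(1) by (auto simp: prime_nat_iff)
    then show "\<omega> \<in> prim_roots (p * m) \<union> prim_roots m" using e(3) t by auto
  qed
  have fin: "finite (prim_roots (p * m))" "finite (prim_roots m)"
    using finite_prim_roots pm assms(2) by auto
  have finW: "finite W" using sub fin by (auto intro: finite_subset)
  have "(\<Prod>\<omega>\<in>W. norm (2 - \<omega>)) = (\<Prod>\<zeta>\<in>prim_roots m. \<Prod>\<omega> | \<omega> ^ p = \<zeta>. norm (2 - \<omega>))"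
    unfolding W_def
  proof (rule prod.UNION_disjoint)
    show "\<forall>i\<in>prim_roots m. finite {\<omega>. \<omega> ^ p = i}"
    proof
      fix i assume "i \<in> prim_roots m"
      then have "{\<omega>. \<omega> ^ p = i} \<subseteq> W" by (auto simp: W_def)
      then show "finite {\<omega>. \<omega> ^ p = i}" using finW finite_subset by blast
    qed
  qed (use fin in auto)
  also have "\<dots> = (\<Prod>\<zeta>\<in>prim_roots m. norm (2 ^ p - \<zeta>))"
    by (rule prod.cong[OF refl]) (simp only: prod_norm power_decompose[OF p0 z0])
  finally have eq: "(\<Prod>\<omega>\<in>W. norm (2 - \<omega>)) = (\<Prod>\<zeta>\<in>prim_roots m. norm (2 ^ p - \<zeta>))" .
  have "(2 ^ p - 1) ^ totient m = (\<Prod>\<zeta>\<in>prim_roots m. 2 ^ p - 1 :: real)"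
    using card_prim_roots[OF assms(2)] by simp
  also have "\<dots> \<le> (\<Prod>\<zeta>\<in>prim_roots m. norm (2 ^ p - \<zeta>))"
  proof (rule prod_mono)
    fix \<zeta> assume "\<zeta> \<in> prim_roots m"
    then show "0 \<le> (2 ^ p - 1 :: real) \<and> 2 ^ p - 1 \<le> norm (2 ^ p - \<zeta>)"
      using norm_triangle_ineq2[of "2 ^ p" \<zeta>] norm_prim_root assms(2) by (simp add: norm_power)
  qed
  also have "\<dots> \<le> (\<Prod>\<omega>\<in>prim_roots (p * m) \<union> prim_roots m. norm (2 - \<omega>))"
    unfolding eq[symmetric]
    by (rule prod_mono2) (use sub fin norm_2_minus_prim_root pm assms(2) in auto)
  also have "\<dots> = (\<Prod>\<omega>\<in>prim_roots (p * m). norm (2 - \<omega>)) * (\<Prod>\<omega>\<in>prim_roots m - prim_roots (p * m). norm (2 - \<omega>))"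
    using prod.union_disjoint[of "prim_roots (p * m)" "prim_roots m - prim_roots (p * m)" "\<lambda>\<omega>. norm (2 - \<omega>)"] fin
    by auto
  also have "(\<Prod>\<omega>\<in>prim_roots m - prim_roots (p * m). norm (2 - \<omega>)) \<le> (\<Prod>\<omega>\<in>prim_roots m. norm (2 - \<omega>))"
    by (rule prod_mono2) (use fin norm_2_minus_prim_root assms(2) in auto)
  also have "\<dots> \<le> (\<Prod>\<omega>\<in>prim_roots m. 3)"
    by (rule prod_mono) (use norm_2_minus_prim_root assms(2) in auto)
  also have "\<dots> = 3 ^ totient m" using card_prim_roots[OF assms(2)] by simp
  finally have "(2 ^ p - 1) ^ totient m \<le> (\<Prod>\<omega>\<in>prim_roots (p * m). norm (2 - \<omega>)) * 3 ^ totient m"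
    by (simp add: mult_left_mono prod_nonneg)
  then show ?thesis
    using norm_cyclotomic_value[OF pm, of 2] by (simp add: power_divide divide_le_eq)
qed

text \<open>The \<open>n\<close>-th cyclotomic polynomial is coprime to \<open>x ^ (n / q) - 1\<close>, so its value divides the quotient
\<open>(2 ^ n - 1) / (2 ^ (n / q) - 1)\<close>.\<close>
lemma cyclotomic_dvd_geometric_sum:
  assumes "prime q" "q dvd n" "n > 0"
  shows "poly (cyclotomic_poly n) 2 dvd (\<Sum>i<q. (2 ^ (n div q)) ^ i :: int)"
proof -
  obtain m where m: "n = q * m" using assms(2) by auto
  then have m0: "m > 0" "n div q = m" using assms by (auto simp: prime_gt_0_nat)
  have q1: "q > 1" using assms(1) by (rule prime_gt_1_nat)
  have "\<not> n dvd m" using m m0 q1 assms(3) by (auto dest!: dvd_imp_le)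
  then have "poly (cyclotomic_poly n) 2 * (\<Prod>d | d dvd m. poly (cyclotomic_poly d) 2 :: int)
      = (\<Prod>d\<in>insert n {d. d dvd m}. poly (cyclotomic_poly d) 2)"
    using m0 by simp
  also have "\<dots> dvd (\<Prod>d | d dvd n. poly (cyclotomic_poly d) 2)"
    by (rule prod_dvd_prod_subset) (use assms(3) m in auto)
  finally have "poly (cyclotomic_poly n) 2 * (2 ^ m - 1) dvd (2 ^ n - 1 :: int)"
    using prod_cyclotomic_value[OF m0(1), of 2] prod_cyclotomic_value[OF assms(3), of 2] by simp
  also have "(2 ^ n - 1 :: int) = (\<Sum>i<q. (2 ^ m) ^ i) * (2 ^ m - 1)"
    unfolding m by (simp add: power_mult mult.commute[of q] power_diff_1_eq mult.commute)
  finally have "poly (cyclotomic_poly n) 2 * (2 ^ m - 1) dvd (\<Sum>i<q. (2 ^ m) ^ i) * (2 ^ m - 1 :: int)" .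
  moreover have "(2 ^ m - 1 :: int) \<noteq> 0" using one_less_power[of "2::int" m] m0(1) by simp
  ultimately show ?thesis unfolding m0(2) by simp
qed

lemma pow2_mod_closed:
  fixes p :: int
  assumes "p dvd 2 ^ a - 1" "p dvd 2 ^ b - 1"
  shows "p dvd 2 ^ (a mod b) - 1"
proof -
  have "[2 ^ a = 1] (mod p)" "[2 ^ b = 1] (mod p)"
    using assms by (simp_all add: cong_iff_dvd_diff)
  then have "[(2 ^ b) ^ (a div b) = 1 ^ (a div b)] (mod p)" by (intro cong_pow)
  then have "[(2 ^ b) ^ (a div b) * 2 ^ (a mod b) = 1 * 2 ^ (a mod b)] (mod p)"
    by (intro cong_mult) auto
  moreover have "(2 ^ b) ^ (a div b) * 2 ^ (a mod b) = (2 ^ a :: int)"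
    by (simp flip: power_mult power_add)
  ultimately have "[2 ^ (a mod b) = 1] (mod p)"
    using \<open>[2 ^ a = 1] (mod p)\<close> by (metis cong_sym cong_trans mult_1)
  then show ?thesis by (simp add: cong_iff_dvd_diff)
qed

text \<open>Let \<open>o'\<close> be the order of 2 modulo a prime \<open>p\<close> that divides the \<open>n\<close>-th cyclotomic value at 2, and let \<open>q\<close> be a
prime divisor of \<open>n / o'\<close>.  Then \<open>p\<close> divides a geometric sum of \<open>q\<close> terms that are all 1 modulo \<open>p\<close>, so
\<open>q = p\<close>.  Hence \<open>n / o'\<close> is a power of \<open>p\<close>.\<close>
lemma non_primitive_prime:
  fixes p n :: nat
  assumes p: "prime p" "int p dvd poly (cyclotomic_poly n) 2" "n > 0"
    and k: "0 < k" "k < n" "int p dvd 2 ^ k - 1"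
  obtains o' i where "n = o' * p ^ i" "i > 0" "o' dvd p - 1" "o' > 0" "odd p" "int p dvd 2 ^ o' - 1"
proof -
  have "poly (cyclotomic_poly n) 2 dvd (2 ^ n - 1 :: int)"
    unfolding prod_cyclotomic_value[OF assms(3), symmetric] using assms(3) by (intro dvd_prodI) auto
  then have pn: "int p dvd 2 ^ n - 1" using p(2) dvd_trans by blast
  have odd: "odd p"
  proof
    assume "even p"
    then have "(2::int) dvd 2 ^ n - 1" using pn by (meson dvd_trans even_of_nat)
    then show False using assms(3) by simp
  qed
  obtain o' where o': "o' dvd n" "o' > 0" "int p dvd 2 ^ o' - 1"
      "\<And>k. 0 < k \<Longrightarrow> k < o' \<Longrightarrow> \<not> int p dvd 2 ^ k - 1"
    using least_period_dvd[of "\<lambda>k. int p dvd 2 ^ k - 1" n] pn assms(3) pow2_mod_closed by metis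
  have o_min: "o' dvd a" if "int p dvd 2 ^ a - 1" for a
  proof -
    have "int p dvd 2 ^ (a mod o') - 1" using pow2_mod_closed[OF that o'(3)] .
    moreover have "a mod o' < o'" using o'(2) by simp
    ultimately have "a mod o' = 0" using o'(4) by blast
    then show ?thesis by auto
  qed
  have "o' \<le> k" using o'(4)[OF k(1)] k(3) by (meson not_le)
  then have "o' < n" using k(2) by simp
  have "\<not> p dvd 2"
    using primes_dvd_imp_eq[OF p(1) two_is_prime_nat] odd by auto
  then have "[2 ^ (p - 1) = 1] (mod p)" by (rule fermat_theorem[OF p(1)])
  then have "[2 ^ (p - 1) = 1] (mod int p)"
    by (metis cong_int_iff of_nat_1 of_nat_numeral of_nat_power)
  then have op: "o' dvd p - 1" using o_min by (simp add: cong_iff_dvd_diff)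
  define N where "N = n div o'"
  have N1: "n = o' * N" using o'(1) unfolding N_def by simp
  have "N \<noteq> 0" "N \<noteq> 1" using N1 \<open>o' < n\<close> assms(3) by auto
  then have N: "n = o' * N" "N > 1" using N1 by auto
  have qp: "q = p" if q: "prime q" "q dvd N" for q
  proof -
    obtain M where M: "N = q * M" using q(2) by auto
    have nq: "n div q = o' * M" using N(1) M q(1) by (simp add: prime_gt_0_nat)
    have "[2 ^ o' = 1] (mod int p)" using o'(3) by (simp add: cong_iff_dvd_diff)
    then have y1: "[2 ^ (n div q) = 1] (mod int p)" unfolding nq power_mult
      using cong_pow[of "2 ^ o'" 1 "int p" M] by simp
    have "[(\<Sum>i<q. (2 ^ (n div q)) ^ i) = (\<Sum>i<q. 1)] (mod int p)"
      by (rule cong_sum) (use cong_pow[OF y1] in simp)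
    moreover have "int p dvd (\<Sum>i<q. (2 ^ (n div q)) ^ i)"
      using cyclotomic_dvd_geometric_sum[OF q(1), of n] N M assms(3) p(2) by (auto intro: dvd_trans)
    ultimately have "int p dvd int q" by (simp add: cong_dvd_iff)
    then have "p dvd q" by simp
    then show "q = p" using primes_dvd_imp_eq[OF p(1) q(1)] by simp
  qed
  have "\<exists>i. N = p ^ i"
  proof -
    have "prime_factors N = {p}"
    proof -
      obtain q where "prime q" "q dvd N" using N(2) prime_factor_nat[of N] by auto
      then show ?thesis using qp N(2) by (auto simp: prime_factors_dvd)
    qed
    then have "N = p ^ multiplicity p N"
      using prime_factorization_nat[of N] N(2) by simp
    then show ?thesis ..
  qed
  then obtain i where i: "N = p ^ i" by blast
  have "i > 0" using i N(2) by (cases i) auto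
  then show ?thesis using that[of o' i] N(1) i op o'(2,3) odd by simp
qed

text \<open>Bang's theorem.  If it fails for \<open>n\<close>, every prime divisor \<open>p\<close> of the cyclotomic value \<open>c\<close> is of the form described in
\<open>non_primitive_prime\<close>.  Then \<open>p\<close> is the largest prime factor of \<open>n\<close>, so it is the only prime divisor
of \<open>c\<close>, and its square does not divide \<open>c\<close>.  Thus \<open>\<bar>c\<bar> = p\<close>, which contradicts the lower bound for \<open>\<bar>c\<bar>\<close> except
for \<open>n = 6\<close>.\<close>
theorem exists_primitive_prime_divisor:
  fixes n :: nat
  assumes n: "n > 1" "n \<noteq> 6"
  shows "\<exists>p. prime p \<and> int p dvd 2 ^ n - 1 \<and> (\<forall>k. 0 < k \<and> k < n \<longrightarrow> \<not> int p dvd 2 ^ k - 1)"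
proof (rule ccontr)
  assume no: "\<not> ?thesis"
  have n0: "n > 0" using n by simp
  define c where "c = poly (cyclotomic_poly n) (2::int)"
  have cn: "c dvd 2 ^ n - 1"
    unfolding c_def prod_cyclotomic_value[OF n0, symmetric] using n0 by (intro dvd_prodI) auto
  have c1: "\<bar>c\<bar> > 1" unfolding c_def using cyclotomic_2_gt_1 n(1) .
  have bad: "\<exists>o' i. n = o' * q ^ i \<and> i > 0 \<and> o' dvd q - 1 \<and> o' > 0 \<and> odd q \<and> int q dvd 2 ^ o' - 1"
    if q: "prime q" "int q dvd c" for q
  proof -
    have "int q dvd 2 ^ n - 1" using q(2) cn dvd_trans by blast
    then obtain k where k: "0 < k" "k < n" "int q dvd 2 ^ k - 1" using no q(1) by blast
    show ?thesis using non_primitive_prime[OF q(1) _ n0 k] q(2) unfolding c_def by metis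
  qed
  have "nat \<bar>c\<bar> \<noteq> 1" using c1 by simp
  then obtain p where "prime p" "p dvd nat \<bar>c\<bar>" using prime_factor_nat by blast
  then have p: "prime p" "int p dvd c" by (auto simp: int_dvd_int_iff[symmetric])
  obtain o' i where oi: "n = o' * p ^ i" "i > 0" "o' dvd p - 1" "o' > 0" "odd p" "int p dvd 2 ^ o' - 1"
    using bad[OF p] by blast
  have uniq: "q = p" if q: "prime q" "int q dvd c" for q
  proof (rule ccontr)
    assume ne: "q \<noteq> p"
    obtain o2 j where oj: "n = o2 * q ^ j" "j > 0" "o2 dvd q - 1" "o2 > 0"
      using bad[OF q] by blast
    have "p dvd n" unfolding oi(1) using oi(2) by (simp add: dvd_mult dvd_power)
    have "q dvd n" unfolding oj(1) using oj(2) by (simp add: dvd_mult dvd_power)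
    have "p dvd o2" using \<open>p dvd n\<close> unfolding oj(1)
      using p(1) q(1) ne by (metis prime_dvd_mult_nat prime_dvd_power_nat primes_dvd_imp_eq)
    moreover have "q dvd o'" using \<open>q dvd n\<close> unfolding oi(1)
      using p(1) q(1) ne by (metis prime_dvd_mult_nat prime_dvd_power_nat primes_dvd_imp_eq)
    moreover have "o2 \<le> q - 1" "o' \<le> p - 1"
      using oj(3) oi(3) prime_gt_1_nat[OF p(1)] prime_gt_1_nat[OF q(1)] by (auto intro!: dvd_imp_le)
    ultimately have "p \<le> q - 1" "q \<le> p - 1"
      using oi(4) oj(4) by (meson dvd_imp_le le_trans)+
    then show False using prime_gt_1_nat[OF p(1)] prime_gt_1_nat[OF q(1)] by simp
  qed
  have pn: "p dvd n" using oi(1,2) by (auto simp: dvd_power)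
  have np: "n div p = o' * p ^ (i - 1)"
    using oi(1,2) p(1) by (cases i) (auto simp: prime_gt_0_nat)
  have nsq: "\<not> (int p)\<^sup>2 dvd c"
  proof
    assume "(int p)\<^sup>2 dvd c"
    then have sq: "(int p)\<^sup>2 dvd (\<Sum>i<p. (2 ^ (n div p)) ^ i)"
      using cyclotomic_dvd_geometric_sum[OF p(1) pn n0] unfolding c_def by (rule dvd_trans)
    have "[2 ^ o' = 1] (mod int p)" using oi(6) by (simp add: cong_iff_dvd_diff)
    then have "[2 ^ (n div p) = 1] (mod int p)" unfolding np power_mult
      using cong_pow[of "2 ^ o'" 1 "int p"] by simp
    then obtain k where k: "2 ^ (n div p) = 1 + int p * k"
      by (metis cong_iff_dvd_diff dvdE add.commute diff_add_cancel)
    \<comment> \<open>Modulo the square of \<open>p\<close> the sum is \<open>p + p * k * (p * (p - 1) / 2)\<close>, which is \<open>p\<close> as \<open>p\<close> is odd.\<close>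
    have pw: "\<exists>u. (1 + int p * k) ^ j = 1 + int j * int p * k + (int p)\<^sup>2 * u" for j
    proof (induction j)
      case (Suc j)
      then obtain u where u: "(1 + int p * k) ^ j = 1 + int j * int p * k + (int p)\<^sup>2 * u" by blast
      have "(1 + int p * k) ^ Suc j = 1 + int (Suc j) * int p * k
          + (int p)\<^sup>2 * (int j * k\<^sup>2 + u + int p * k * u)"
        unfolding power_Suc u by (simp add: algebra_simps power2_eq_square)
      then show ?case by blast
    qed (auto intro: exI[of _ 0])
    then obtain u where u: "\<And>j. (1 + int p * k) ^ j = 1 + int j * int p * k + (int p)\<^sup>2 * u j" by metis
    have "(\<Sum>i<p. (2 ^ (n div p)) ^ i) = (\<Sum>i<p. 1 + int p * k * int i + (int p)\<^sup>2 * u i)"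
      unfolding k u by (simp add: mult_ac)
    also have "\<dots> = int p + int p * k * (\<Sum>i<p. int i) + (int p)\<^sup>2 * (\<Sum>i<p. u i)"
      by (simp add: sum.distrib sum_distrib_left)
    also have "(\<Sum>i<p. int i) = int p * ((int p - 1) div 2)"
    proof -
      have "2 * (\<Sum>i<q. int i) = int q * (int q - 1)" for q
        by (induction q) (auto simp: algebra_simps)
      moreover have "2 * (int p * ((int p - 1) div 2)) = int p * (int p - 1)"
        using oi(5) by simp
      ultimately show ?thesis by (metis mult_cancel_left zero_neq_numeral)
    qed
    finally have "(\<Sum>i<p. (2 ^ (n div p)) ^ i) = int p + (int p)\<^sup>2 * (k * ((int p - 1) div 2) + (\<Sum>i<p. u i))"
      by (simp add: algebra_simps power2_eq_square)
    with sq have "(int p)\<^sup>2 dvd int p" by (metis dvd_add_times_triv_right_iff mult.commute)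
    then have "int p dvd 1" using p(1) by (simp add: power2_eq_square prime_gt_0_nat)
    then show False using p(1) by simp
  qed
  obtain d where d: "c = int p * d" using p(2) by auto
  have "is_unit d"
  proof (rule ccontr)
    assume "\<not> is_unit d"
    then have "nat \<bar>d\<bar> \<noteq> 1" by auto
    then obtain q where "prime q" "q dvd nat \<bar>d\<bar>" using prime_factor_nat by blast
    then have q: "prime q" "int q dvd d" by (auto simp: int_dvd_int_iff[symmetric])
    then have "q = p" using uniq d by simp
    then show False using nsq q(2) d by (simp add: power2_eq_square)
  qed
  then have "\<bar>d\<bar> = 1" by auto
  then have cp: "\<bar>c\<bar> = int p" using d by (simp add: abs_mult)
  define m where "m = o' * p ^ (i - 1)"
  have m: "n = p * m" "m > 0"
    using np pn oi(4) p(1) unfolding m_def by (auto simp: prime_gt_0_nat)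
  have bound: "((2 ^ p - 1) / 3) ^ totient m \<le> real p"
    using cyclotomic_value_lower_bound[OF p(1) m(2)] cp m(1) unfolding c_def by simp
  have p2: "p \<ge> 3" using p(1) oi(5) prime_ge_2_nat[of p] by (cases "p = 2") auto
  have tm: "totient m > 0" using m(2) by simp
  show False
  proof (cases "p = 3")
    case False
    then have p5: "p \<ge> 5" using p2 oi(5) by (cases "p = 4") auto
    have big: "(2::real) ^ p - 1 > 3 * real p"
      using p5 by (induction p rule: dec_induct) auto
    then have "(2 ^ p - 1) / 3 > real p" by simp
    moreover from this have "((2 ^ p - 1) / 3 :: real) ^ 1 \<le> ((2 ^ p - 1) / 3) ^ totient m"
      using tm p5 by (intro power_increasing) linarith+
    ultimately show False using bound by simp
  next
    case True
    have "o' dvd 2" using oi(3) True by simp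
    moreover have "o' \<noteq> 1" using oi(6) True by auto
    ultimately have o2: "o' = 2" using two_is_prime_nat by (auto simp: prime_nat_iff)
    have "i \<noteq> 1" using oi(1) o2 True n(2) by auto
    then have i: "i = Suc (Suc (i - 2))" using oi(2) by simp
    have "m = 6 * 3 ^ (i - 2)" unfolding m_def o2 True by (subst i) simp
    moreover have "(1::nat) \<le> 3 ^ (i - 2)" by simp
    ultimately have "m > 2" by linarith
    then have t2: "totient m \<ge> 2" using totient_gt_1[of m] by simp
    have "((2 ^ p - 1) / 3 :: real) ^ 2 \<le> ((2 ^ p - 1) / 3) ^ totient m"
      using t2 True by (intro power_increasing) auto
    then show False using bound True by (simp add: power2_eq_square)
  qed
qed

lemma cyclotomic_value_dvd:
  assumes "e > 0"
  shows "poly (cyclotomic_poly e) x dvd x ^ e - (1::int)"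
  unfolding prod_cyclotomic_value[OF assms, symmetric] using assms by (intro dvd_prodI) auto

text \<open>In \<open>2 ^ n - 1 = \<Prod>k dvd r. \<Phi> k (2 ^ d)\<close> a factor with \<open>k < r\<close> divides \<open>2 ^ (d * k) - 1\<close>, so a primitive prime
divisor of \<open>2 ^ n - 1\<close> occurs only in the factor \<open>k = r\<close>.\<close>
lemma multiplicity_cyclotomic_primitive:
  fixes p :: nat
  assumes p: "prime p" "int p dvd 2 ^ n - 1" "\<And>k. 0 < k \<Longrightarrow> k < n \<Longrightarrow> \<not> int p dvd 2 ^ k - 1"
    and n: "n = r * d" "n > 0"
  shows "multiplicity (int p) (poly (cyclotomic_poly r) (2 ^ d)) = multiplicity (int p) (2 ^ n - 1)"
proof -
  have r: "r > 0" "d > 0" using n by (auto intro: Nat.gr0I)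
  define D where "D = {k. k dvd r \<and> k \<noteq> r}"
  have D: "finite D" "{k. k dvd r} = insert r D" "r \<notin> D"
    using r unfolding D_def by auto
  let ?u = "\<Prod>k\<in>D. poly (cyclotomic_poly k) (2 ^ d :: int)"
  have eq: "(2 ^ n - 1 :: int) = poly (cyclotomic_poly r) (2 ^ d) * ?u"
    using prod_cyclotomic_value[OF r(1), of "2 ^ d"] D n(1)
    by (simp add: power_mult[symmetric] mult.commute)
  have pp: "prime (int p)" using p(1) by simp
  have "\<not> int p dvd ?u"
  proof
    assume "int p dvd ?u"
    then obtain k where k: "k \<in> D" "int p dvd poly (cyclotomic_poly k) (2 ^ d)"
      using prime_dvd_prod_iff[OF D(1) pp, of "\<lambda>k. poly (cyclotomic_poly k) (2 ^ d)"] by blast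
    have k0: "k > 0" "k < r" using k(1) r dvd_imp_le[of k r] unfolding D_def by (auto intro!: Nat.gr0I)
    have "int p dvd (2 ^ d) ^ k - 1"
      using k(2) cyclotomic_value_dvd[OF k0(1)] dvd_trans by blast
    then have "int p dvd 2 ^ (d * k) - 1" by (simp add: power_mult)
    moreover have "d * k < n" "0 < d * k" using k0 r n by (auto simp: mult.commute)
    ultimately show False using p(3) by blast
  qed
  then have "multiplicity (int p) ?u = 0" by (rule not_dvd_imp_multiplicity_0)
  moreover have "(2 ^ n - 1 :: int) \<noteq> 0" using one_less_power[of "2::int" n] n by simp
  ultimately show ?thesis
    unfolding eq using pp by (subst prime_elem_multiplicity_mult_distrib) auto
qed

section \<open>Specialisation at complex parameters\<close>

definition spec_dynatomic :: "complex \<Rightarrow> nat \<Rightarrow> complex poly" where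
  "spec_dynatomic \<gamma> n = map_poly (eval_at \<gamma>) (dynatomic n)"

definition spec_multiplier_poly :: "complex \<Rightarrow> nat \<Rightarrow> complex poly" where
  "spec_multiplier_poly \<gamma> n = map_poly (eval_at \<gamma>) (multiplier_poly n)"

text \<open>The number of points of exact period \<open>n\<close> of the generic quadratic polynomial.\<close>
definition num_points :: "nat \<Rightarrow> nat" where "num_points n = degree (dynatomic n)"

lemma spec_dynatomic_monic:
  assumes "n > 0"
  shows "degree (spec_dynatomic \<gamma> n) = num_points n" "lead_coeff (spec_dynatomic \<gamma> n) = 1"
    "spec_dynatomic \<gamma> n \<noteq> 0"
proof -
  show "degree (spec_dynatomic \<gamma> n) = num_points n" and *: "lead_coeff (spec_dynatomic \<gamma> n) = 1"
    unfolding spec_dynatomic_def num_points_def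
    using lead_coeff_map_poly_monic[OF comm_ring_hom_eval_at dynatomic_characterization(1)[OF assms]] by auto
  then show "spec_dynatomic \<gamma> n \<noteq> 0" by (metis leading_coeff_0_iff zero_neq_one)
qed

lemma spec_dynatomic_prod:
  assumes "n > 0"
  shows "(\<Prod>d | d dvd n. spec_dynatomic \<gamma> d) = fix_poly \<gamma> n"
proof -
  have "map_poly (eval_at \<gamma>) (\<Prod>d | d dvd n. dynatomic d) = fix_poly \<gamma> n"
    unfolding dynatomic_prod[OF assms] map_poly_fix_poly[OF comm_ring_hom_eval_at] eval_at_X ..
  then show ?thesis by (simp add: evp.hom_prod spec_dynatomic_def)
qed

lemma sum_num_points:
  assumes "n > 0"
  shows "(\<Sum>d | d dvd n. num_points d) = 2 ^ n"
proof -
  have "degree (\<Prod>d | d dvd n. spec_dynatomic 0 d) = (\<Sum>d | d dvd n. degree (spec_dynatomic 0 d))"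
    by (rule degree_prod_sum_eq) (use assms in \<open>auto intro!: spec_dynatomic_monic Nat.gr0I\<close>)
  also have "\<dots> = (\<Sum>d | d dvd n. num_points d)"
    by (rule sum.cong[OF refl]) (use assms in \<open>auto intro!: spec_dynatomic_monic Nat.gr0I\<close>)
  finally show ?thesis unfolding spec_dynatomic_prod[OF assms] fix_poly_monic(1)[OF assms] by simp
qed

lemma spec_dynatomic_root_fixed:
  assumes "poly (spec_dynatomic \<gamma> d) \<alpha> = 0" "d dvd n" "n > 0"
  shows "poly (quad_iter \<gamma> n) \<alpha> = \<alpha>"
proof -
  have "poly (fix_poly \<gamma> n) \<alpha> = 0"
    unfolding spec_dynatomic_prod[OF assms(3), symmetric] poly_prod
    by (rule prod_zero) (use assms in auto)
  then show ?thesis by (simp add: fix_poly_root_iff)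
qed

lemma periodic_point_spec_dynatomic:
  assumes "\<alpha> \<in> periodic_points \<gamma> n" "n > 0"
  shows "poly (spec_dynatomic \<gamma> n) \<alpha> = 0"
proof -
  have "poly (fix_poly \<gamma> n) \<alpha> = 0" using assms by (simp add: fix_poly_root_iff periodic_points_def)
  then have "\<exists>d\<in>{d. d dvd n}. poly (spec_dynatomic \<gamma> d) \<alpha> = 0"
    unfolding spec_dynatomic_prod[OF assms(2), symmetric] poly_prod using assms(2) by (simp add: prod_zero_iff)
  then obtain d where d: "d dvd n" "poly (spec_dynatomic \<gamma> d) \<alpha> = 0" by blast
  have "d > 0" "d \<le> n" using d assms(2) by (auto intro: Nat.gr0I dvd_imp_le)
  moreover have "poly (quad_iter \<gamma> d) \<alpha> = \<alpha>" using spec_dynatomic_root_fixed[OF d(2) dvd_refl] \<open>d > 0\<close> .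
  ultimately have "d = n" using assms(1) by (auto simp: periodic_points_def order_le_less)
  then show ?thesis using d by simp
qed

lemma spec_multiplier_poly_monic:
  assumes "n > 0"
  shows "lead_coeff (spec_multiplier_poly \<gamma> n) = 1" "spec_multiplier_poly \<gamma> n \<noteq> 0"
    "degree (spec_multiplier_poly \<gamma> n) = degree (multiplier_poly n)"
proof -
  show *: "lead_coeff (spec_multiplier_poly \<gamma> n) = 1"
    "degree (spec_multiplier_poly \<gamma> n) = degree (multiplier_poly n)"
    unfolding spec_multiplier_poly_def
    using lead_coeff_map_poly_monic[OF comm_ring_hom_eval_at multiplier_poly_characterization(1)[OF assms]] by auto
  then show "spec_multiplier_poly \<gamma> n \<noteq> 0" by (metis leading_coeff_0_iff zero_neq_one)
qed

lemma poly_spec_multiplier_poly_power: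
  assumes "n > 0"
  shows "poly (spec_multiplier_poly \<gamma> n) x ^ n = (\<Prod>\<alpha>\<in>#proots (spec_dynatomic \<gamma> n). x - multiplier \<gamma> n \<alpha>)"
proof -
  have "spec_multiplier_poly \<gamma> n ^ n = map_poly (eval_at \<gamma>) (multiplier_resultant n)"
    unfolding spec_multiplier_poly_def multiplier_poly_characterization(2)[OF assms, symmetric]
    by (simp add: evp.hom_power)
  also have "\<dots> = (\<Prod>\<alpha>\<in>#proots (spec_dynatomic \<gamma> n). [:- multiplier \<gamma> n \<alpha>, 1:])"
    unfolding map_multiplier_resultant[OF comm_ring_hom_eval_at assms] eval_at_X spec_dynatomic_def ..
  finally show ?thesis by (simp add: poly_prod_mset flip: poly_power)
qed

lemma size_proots_spec_dynatomic:
  "n > 0 \<Longrightarrow> size (proots (spec_dynatomic \<gamma> n)) = num_points n"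
  using alg_closed_factorization(2)[OF spec_dynatomic_monic(3)] spec_dynatomic_monic(1) by simp

lemma spec_multiplier_poly_zero_iff:
  assumes "n > 0"
  shows "poly (spec_multiplier_poly \<gamma> n) x = 0
     \<longleftrightarrow> (\<exists>\<alpha>. poly (spec_dynatomic \<gamma> n) \<alpha> = 0 \<and> multiplier \<gamma> n \<alpha> = x)"
proof -
  have "poly (spec_multiplier_poly \<gamma> n) x = 0 \<longleftrightarrow> poly (spec_multiplier_poly \<gamma> n) x ^ n = 0"
    using assms by simp
  also have "\<dots> \<longleftrightarrow> (\<exists>\<alpha>. poly (spec_dynatomic \<gamma> n) \<alpha> = 0 \<and> multiplier \<gamma> n \<alpha> = x)"
    unfolding poly_spec_multiplier_poly_power[OF assms]
    using spec_dynatomic_monic(3)[OF assms, of \<gamma>] by (auto simp: prod_mset_zero_iff)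
  finally show ?thesis .
qed

text \<open>A common root of two dynatomic factors of \<open>f\<^sup>n z - z\<close> is a multiple root.\<close>
lemma double_root_multiplier:
  assumes "n > 0" "k dvd n" "l dvd n" "k \<noteq> l"
    "poly (spec_dynatomic \<gamma> k) \<alpha> = 0" "poly (spec_dynatomic \<gamma> l) \<alpha> = 0"
  shows "multiplier \<gamma> n \<alpha> = 1"
proof -
  let ?R = "\<Prod>d\<in>{d. d dvd n} - {k} - {l}. spec_dynatomic \<gamma> d"
  have "fix_poly \<gamma> n = spec_dynatomic \<gamma> k * (spec_dynatomic \<gamma> l * ?R)"
    unfolding spec_dynatomic_prod[OF assms(1), symmetric] using assms
    by (subst prod.remove[of _ k], simp, simp, subst prod.remove[of _ l]) auto
  then have "poly (pderiv (fix_poly \<gamma> n)) \<alpha> = 0"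
    using assms(5,6) by (simp add: pderiv_mult)
  then show ?thesis by (simp add: poly_pderiv_fix_poly)
qed

lemma simple_multiplier_exact_period:
  assumes "d > 0" "poly (spec_dynatomic \<gamma> d) \<alpha> = 0" "multiplier \<gamma> d \<alpha> \<noteq> 1"
  shows "\<alpha> \<in> periodic_points \<gamma> d"
proof -
  have "poly (quad_iter \<gamma> d) \<alpha> = \<alpha>" using spec_dynatomic_root_fixed[OF assms(2) dvd_refl assms(1)] .
  then obtain e where e: "e dvd d" "e > 0" "\<alpha> \<in> periodic_points \<gamma> e"
    using periodic_point_decompose assms(1) by blast
  have "poly (spec_dynatomic \<gamma> e) \<alpha> = 0" using periodic_point_spec_dynatomic e by blast
  then have "e = d" using double_root_multiplier[OF assms(1) e(1) dvd_refl] assms(2,3) by blast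
  then show ?thesis using e by simp
qed

text \<open>Let \<open>\<alpha>\<close> have period \<open>d\<close> and multiplier \<open>\<zeta>\<close>, a primitive \<open>j\<close>-th root of unity, and let \<open>n = j * d\<close>.  Then \<open>\<alpha>\<close> is a
multiple root of \<open>f\<^sup>n z - z\<close>, because its multiplier for the \<open>n\<close>-th iterate is \<open>\<zeta> ^ j = 1\<close>.  It is a simple root
of the dynatomic factor of index \<open>d\<close>, and it is no root of a factor of index \<open>i * d\<close> with \<open>1 < i < j\<close>, since
\<open>\<zeta> ^ i \<noteq> 1\<close>.  So it must be a root of the factor of index \<open>n\<close>.\<close>
theorem satellite_collision:
  assumes "j > 1" "d > 0" "\<zeta> \<in> prim_roots j" "poly (spec_multiplier_poly \<gamma> d) \<zeta> = 0"
  shows "poly (spec_multiplier_poly \<gamma> (j * d)) 1 = 0"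
proof -
  define n where "n = j * d"
  have n: "n > 0" "d dvd n" "d \<noteq> n" using assms unfolding n_def by auto
  have z1: "\<zeta> \<noteq> 1" using prim_root_neq_1[OF assms(3,1)] .
  obtain \<alpha> where a: "poly (spec_dynatomic \<gamma> d) \<alpha> = 0" "multiplier \<gamma> d \<alpha> = \<zeta>"
    using assms(4) spec_multiplier_poly_zero_iff[OF assms(2)] by blast
  have per: "\<alpha> \<in> periodic_points \<gamma> d"
    using simple_multiplier_exact_period[OF assms(2) a(1)] a(2) z1 by simp
  then have fd: "poly (quad_iter \<gamma> d) \<alpha> = \<alpha>" by (simp add: periodic_points_def)
  have mult: "multiplier \<gamma> (i * d) \<alpha> = \<zeta> ^ i" for i using multiplier_mult[OF fd] a(2) by simp
  have mn: "multiplier \<gamma> n \<alpha> = 1" using mult[of j] assms(3) by (simp add: n_def prim_roots_def)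
  have "poly (spec_dynatomic \<gamma> n) \<alpha> = 0"
  proof (rule ccontr)
    assume ne: "poly (spec_dynatomic \<gamma> n) \<alpha> \<noteq> 0"
    \<comment> \<open>The derivative of \<open>f\<^sup>k z - z\<close> at \<open>\<alpha>\<close> is the derivative of one factor times the value of the cofactor.\<close>
    have spl: "fix_poly \<gamma> k = spec_dynatomic \<gamma> d * (\<Prod>e\<in>{e. e dvd k} - {d}. spec_dynatomic \<gamma> e)"
      if "k > 0" "d dvd k" for k
      unfolding spec_dynatomic_prod[OF that(1), symmetric] using that by (subst prod.remove[of _ d]) auto
    have der: "poly (pderiv (spec_dynatomic \<gamma> d)) \<alpha> * poly (\<Prod>e\<in>{e. e dvd k} - {d}. spec_dynatomic \<gamma> e) \<alpha>
        = multiplier \<gamma> k \<alpha> - 1" if "k > 0" "d dvd k" for k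
      unfolding poly_pderiv_fix_poly[symmetric] spl[OF that] using a(1) by (simp add: pderiv_mult)
    have "poly (pderiv (spec_dynatomic \<gamma> d)) \<alpha> \<noteq> 0"
      using der[OF assms(2) dvd_refl] a(2) z1 by auto
    then have "poly (\<Prod>e\<in>{e. e dvd n} - {d}. spec_dynatomic \<gamma> e) \<alpha> = 0"
      using der[OF n(1,2)] mn by simp
    then obtain k where k: "k dvd n" "k \<noteq> d" "poly (spec_dynatomic \<gamma> k) \<alpha> = 0"
      using n(1) by (auto simp: poly_prod)
    have k0: "k > 0" using k(1) n(1) by (auto intro: Nat.gr0I)
    have "k \<noteq> n" using k(3) ne by auto
    then have kn: "k < n" using k(1) n(1) by (simp add: dvd_imp_le order_le_neq_trans)
    have "d dvd k"
      using periodic_points_dvd[OF per assms(2) spec_dynatomic_root_fixed[OF k(3) dvd_refl k0]] .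
    then obtain i where i: "k = i * d" by (metis dvd_def mult.commute)
    have "multiplier \<gamma> k \<alpha> = 1"
      using double_root_multiplier[OF k0 \<open>d dvd k\<close> dvd_refl k(2)[symmetric] a(1) k(3)] .
    then have "j dvd i" using prim_root_power_eq_1_iff[OF assms(3), of i] mult[of i] i assms(1) by simp
    then have "j \<le> i" using k0 i by (intro dvd_imp_le) auto
    then show False using kn i unfolding n_def by simp
  qed
  then show ?thesis using spec_multiplier_poly_zero_iff[OF n(1)] mn unfolding n_def by blast
qed

lemma eval_at_poly_multiplier:
  "eval_at \<gamma> (poly (multiplier_poly n) 1) = poly (spec_multiplier_poly \<gamma> n) 1"
  unfolding spec_multiplier_poly_def using ev.poly_map_poly[of \<gamma> "multiplier_poly n" 1] by simp

lemma eval_at_const: "eval_at \<gamma> [:a:] = of_int a"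
  unfolding eval_at_def by (subst of_int_hom.map_poly_pCons_hom) simp

theorem eval_at_Delta_proper:
  assumes "n = r * m" "n > 0"
  shows "eval_at \<gamma> (Delta_proper n m) = (\<Prod>\<zeta>\<in>prim_roots r. poly (spec_multiplier_poly \<gamma> m) \<zeta>)"
proof -
  have r: "r > 0" "m > 0" "n div m = r" using assms by (auto intro: Nat.gr0I)
  let ?C = "map_poly coeff_lift (cyclotomic_poly r)"
  have l: "lead_coeff ?C = 1"
    using lead_coeff_map_poly_monic(2)[OF coeff_lift_hom.comm_ring_hom_axioms cyclotomic_poly_characterization(1)[OF r(1)]] .
  have e: "map_poly (eval_at \<gamma>) ?C = map_poly of_int (cyclotomic_poly r)"
    by (rule poly_eqI) (simp add: coeff_map_poly eval_at_const)
  have p: "proots (map_poly of_int (cyclotomic_poly r)) = mset_set (prim_roots r)"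
    unfolding cyclotomic_poly_characterization(2)[OF r(1)] prod_unfold_prod_mset by (rule proots_linear_product)
  have "eval_at \<gamma> (Delta_proper n m) = (\<Prod>\<zeta>\<in>#proots (map_poly (eval_at \<gamma>) ?C). poly (map_poly (eval_at \<gamma>) (multiplier_poly m)) \<zeta>)"
    unfolding Delta_proper_def r(3)
    by (rule hom_resultant_monic[OF comm_ring_hom_eval_at l])
       (use spec_multiplier_poly_monic[OF r(2), of \<gamma>] in \<open>auto simp: spec_multiplier_poly_def\<close>)
  then show ?thesis unfolding e p spec_multiplier_poly_def by (simp only: prod_unfold_prod_mset)
qed

section \<open>Constant coefficients\<close>

lemma eval_at_0: "eval_at 0 p = of_int (coeff p 0)"
  by (simp add: eval_at_def poly_0_coeff_0)

lemma dynatomic_root_at_0: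
  assumes "m > 1" "poly (spec_dynatomic 0 m) \<alpha> = 0"
  shows "multiplier 0 m \<alpha> = 2 ^ m"
proof -
  have m0: "m > 0" using assms(1) by simp
  have fm: "poly (quad_iter 0 m) \<alpha> = \<alpha>" using spec_dynatomic_root_fixed[OF assms(2) dvd_refl m0] .
  have "\<alpha> \<noteq> 0"
  proof
    assume a: "\<alpha> = 0"
    then have "\<alpha> \<in> periodic_points 0 1" by (auto simp: periodic_points_def)
    then have "poly (spec_dynatomic 0 1) \<alpha> = 0" using periodic_point_spec_dynatomic by simp
    then have "multiplier 0 m \<alpha> = 1"
      using double_root_multiplier[OF m0, of 1 m] assms by simp
    then show False using fixed_point_at_0[OF fm m0] a by simp
  qed
  then show ?thesis using fixed_point_at_0[OF fm m0] by simp
qed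

text \<open>All points of period \<open>m > 1\<close> have multiplier \<open>2 ^ m\<close> at \<open>c = 0\<close>.  The \<open>m\<close>-th power on the left comes from
the definition of the multiplier polynomial as an \<open>m\<close>-th root.\<close>
lemma Delta_proper_at_0:
  assumes "n = r * m" "n > 0" "m > 1"
  shows "\<bar>coeff (Delta_proper n m) 0\<bar> ^ m = \<bar>poly (cyclotomic_poly r) (2 ^ m)\<bar> ^ num_points m"
proof -
  have r: "r > 0" "m > 0" using assms by (auto intro: Nat.gr0I)
  have z: "norm (poly (spec_multiplier_poly 0 m) \<zeta>) ^ m = norm (2 ^ m - \<zeta>) ^ num_points m" for \<zeta>
  proof -
    have "poly (spec_multiplier_poly 0 m) \<zeta> ^ m = (\<Prod>\<alpha>\<in>#proots (spec_dynatomic 0 m). \<zeta> - 2 ^ m)"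
      unfolding poly_spec_multiplier_poly_power[OF r(2)]
      by (rule arg_cong[where f = prod_mset], rule image_mset_cong)
         (use dynatomic_root_at_0[OF assms(3)] spec_dynatomic_monic(3)[OF r(2), of 0] in auto)
    then show ?thesis
      by (simp add: size_proots_spec_dynatomic[OF r(2)] norm_minus_commute flip: norm_power)
  qed
  have "real_of_int (\<bar>coeff (Delta_proper n m) 0\<bar> ^ m) = norm (eval_at 0 (Delta_proper n m)) ^ m"
    by (simp add: eval_at_0)
  also have "\<dots> = (\<Prod>\<zeta>\<in>prim_roots r. norm (poly (spec_multiplier_poly 0 m) \<zeta>) ^ m)"
    unfolding eval_at_Delta_proper[OF assms(1,2)] by (simp add: prod_power_distrib prod_norm[symmetric])
  also have "\<dots> = real_of_int \<bar>poly (cyclotomic_poly r) (2 ^ m)\<bar> ^ num_points m"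
    unfolding z norm_cyclotomic_value[OF r(1)] by (simp add: prod_power_distrib)
  finally show ?thesis by (simp only: of_int_power[symmetric] of_int_eq_iff)
qed

lemma spec_dynatomic_1: "spec_dynatomic \<gamma> 1 = [:\<gamma>, - 1, 1:]"
proof -
  have "spec_dynatomic \<gamma> 1 = fix_poly \<gamma> 1" using spec_dynatomic_prod[of 1 \<gamma>] by simp
  then show ?thesis by (simp add: fix_poly_def quad_iter_Suc quad_iter_0 power2_eq_square del: pCons_one)
qed

lemma poly_spec_multiplier_poly_1_at_0: "poly (spec_multiplier_poly 0 1) x = x * (x - 2)"
proof -
  have "spec_dynatomic 0 1 = [:- 0, 1:] * [:- 1, 1:]" unfolding spec_dynatomic_1 by (simp del: pCons_one)
  then have "proots (spec_dynatomic 0 1) = proots ([:- 0, 1:] * [:- 1, 1:])" by (simp only:)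
  also have "\<dots> = {#0#} + {#1#}"
    by (subst proots_mult) (auto simp only: proots_linear_factor minus_minus pCons_eq_0_iff zero_neq_one[symmetric])
  finally have "proots (spec_dynatomic 0 1) = {#0#} + {#1#}" .
  then show ?thesis using poly_spec_multiplier_poly_power[of 1 0 x] by (simp add: multiplier_eq)
qed

text \<open>At \<open>c = 0\<close> the two fixed points have multipliers 0 and 2, and the first contributes only a sign.\<close>
lemma Delta_proper_1_at_0:
  assumes "n > 0"
  shows "\<bar>coeff (Delta_proper n 1) 0\<bar> = \<bar>poly (cyclotomic_poly n) 2\<bar>"
proof -
  have "norm (poly (spec_multiplier_poly 0 1) \<zeta>) = norm (2 - \<zeta>)" if "\<zeta> \<in> prim_roots n" for \<zeta>
    unfolding poly_spec_multiplier_poly_1_at_0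
    using norm_prim_root[OF that assms] by (simp add: norm_mult norm_minus_commute)
  then have "norm (eval_at 0 (Delta_proper n 1)) = (\<Prod>\<zeta>\<in>prim_roots n. norm (2 - \<zeta>))"
    using eval_at_Delta_proper[of n n 1 0] assms by (simp add: prod_norm[symmetric])
  then have "real_of_int \<bar>coeff (Delta_proper n 1) 0\<bar> = real_of_int \<bar>poly (cyclotomic_poly n) 2\<bar>"
    unfolding norm_cyclotomic_value[OF assms] by (simp add: eval_at_0)
  then show ?thesis by linarith
qed

section \<open>Degrees and leading coefficients\<close>

text \<open>The parameter \<open>t\<close> is the square root of \<open>c\<close>, so that sizes of periodic points and multipliers are powers of \<open>t\<close>.\<close>
definition growth :: "(real \<Rightarrow> real) \<Rightarrow> nat \<Rightarrow> bool" where
  "growth f e \<longleftrightarrow> ((\<lambda>t. f t / (2 * t) ^ e) \<longlongrightarrow> 1) at_top"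

lemma growth_prod:
  assumes "\<And>i. i \<in> I \<Longrightarrow> growth (f i) (e i)"
  shows "growth (\<lambda>t. \<Prod>i\<in>I. f i t) (\<Sum>i\<in>I. e i)"
proof -
  have "((\<lambda>t. \<Prod>i\<in>I. f i t / (2 * t) ^ e i) \<longlongrightarrow> (\<Prod>i\<in>I. 1)) at_top"
    by (rule tendsto_prod) (use assms in \<open>auto simp: growth_def\<close>)
  then show ?thesis by (simp add: growth_def prod_dividef power_sum)
qed

text \<open>Comparison with the growth \<open>\<bar>lead_coeff p\<bar> * t ^ (2 * degree p)\<close> of a polynomial.\<close>
lemma growth_poly_degree:
  fixes p :: "int poly"
  assumes "growth (\<lambda>t. norm (eval_at (of_real (t\<^sup>2)) p)) e"
  shows "e = 2 * degree p" "\<bar>lead_coeff p\<bar> = 2 ^ e"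
proof -
  define q :: "complex poly" where "q = map_poly of_int p"
  define d where "d = degree p"
  have dq: "degree q = d" by (simp add: q_def d_def)
  define L where "L = norm (lead_coeff q)"
  have L: "L = real_of_int \<bar>lead_coeff p\<bar>" by (simp add: L_def q_def)
  have flt: "filterlim (\<lambda>t::real. of_real (t\<^sup>2) :: complex) at_infinity at_top"
    unfolding filterlim_at_infinity_conv_norm_at_top
    by (simp add: norm_power) (intro filterlim_pow_at_top filterlim_ident, simp)
  have "((\<lambda>t::real. poly q (of_real (t\<^sup>2)) / of_real (t\<^sup>2) ^ degree q) \<longlongrightarrow> lead_coeff q) at_top"
    by (rule filterlim_compose[OF poly_divide_tendsto_aux flt])
  then have "((\<lambda>t::real. norm (poly q (of_real (t\<^sup>2)) / of_real (t\<^sup>2) ^ degree q)) \<longlongrightarrow> L) at_top"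
    unfolding L_def by (rule tendsto_norm)
  then have 1: "((\<lambda>t::real. norm (poly q (of_real (t\<^sup>2))) / t ^ (2 * d)) \<longlongrightarrow> L) at_top"
    by (simp add: norm_divide norm_power dq power_mult)
  have 2: "((\<lambda>t::real. norm (poly q (of_real (t\<^sup>2))) / (2 * t) ^ e) \<longlongrightarrow> 1) at_top"
    using assms by (simp add: growth_def eval_at_def q_def)
  have "((\<lambda>t::real. (norm (poly q (of_real (t\<^sup>2))) / t ^ (2 * d)) / (norm (poly q (of_real (t\<^sup>2))) / (2 * t) ^ e)) \<longlongrightarrow> L / 1) at_top"
    by (rule tendsto_divide[OF 1 2]) simp
  moreover have "eventually (\<lambda>t::real. (norm (poly q (of_real (t\<^sup>2))) / t ^ (2 * d)) / (norm (poly q (of_real (t\<^sup>2))) / (2 * t) ^ e)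
      = (2 * t) ^ e / t ^ (2 * d)) at_top"
  proof -
    have "eventually (\<lambda>t::real. norm (poly q (of_real (t\<^sup>2))) / (2 * t) ^ e > 0) at_top"
      by (rule order_tendstoD(1)[OF 2]) simp
    then show ?thesis by (rule eventually_mono) auto
  qed
  ultimately have lim: "((\<lambda>t::real. (2 * t) ^ e / t ^ (2 * d)) \<longlongrightarrow> L) at_top"
    using tendsto_cong by force
  have inv: "((\<lambda>t::real. inverse t) \<longlongrightarrow> 0) at_top" by (rule tendsto_inverse_0_at_top[OF filterlim_ident])
  have L0: "L > 0"
  proof -
    have "q \<noteq> 0"
    proof
      assume "q = 0"
      then have "((\<lambda>t::real. 0) \<longlongrightarrow> (1::real)) at_top" using 2 by simp
      then show False by (simp add: tendsto_const_iff)
    qed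
    then show ?thesis by (simp add: L_def)
  qed
  have unbalanced: False
    if "f \<noteq> g" "((\<lambda>t::real. a * (t ^ f / t ^ g)) \<longlongrightarrow> l) at_top" "a > 0" "l > 0" "f \<le> g" for f g and a l :: real
  proof -
    have "eventually (\<lambda>t::real. a * (t ^ f / t ^ g) = a * inverse t ^ (g - f)) at_top"
      using eventually_gt_at_top[of 0]
    proof (rule eventually_mono)
      fix t :: real assume "t > 0"
      have "t ^ g = t ^ f * t ^ (g - f)" using that(5) by (simp flip: power_add)
      then show "a * (t ^ f / t ^ g) = a * inverse t ^ (g - f)"
        using \<open>t > 0\<close> by (simp add: field_simps)
    qed
    moreover have "((\<lambda>t::real. a * inverse t ^ (g - f)) \<longlongrightarrow> a * 0 ^ (g - f)) at_top"
      by (intro tendsto_intros inv)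
    ultimately have "((\<lambda>t::real. a * (t ^ f / t ^ g)) \<longlongrightarrow> 0) at_top"
      using that(1,5) tendsto_cong by (force simp: power_0_left)
    then show False using tendsto_unique[OF _ that(2)] that(4) by simp
  qed
  show e: "e = 2 * degree p"
  proof (rule ccontr)
    assume "e \<noteq> 2 * degree p"
    then have ne: "e \<noteq> 2 * d" by (simp add: d_def)
    have l: "((\<lambda>t::real. 2 ^ e * (t ^ e / t ^ (2 * d))) \<longlongrightarrow> L) at_top"
      using lim by (simp add: power_mult_distrib)
    have "((\<lambda>t::real. inverse (2 ^ e * (t ^ e / t ^ (2 * d)))) \<longlongrightarrow> inverse L) at_top"
      by (rule tendsto_inverse[OF l]) (use L0 in simp)
    then have l': "((\<lambda>t::real. inverse (2 ^ e) * (t ^ (2 * d) / t ^ e)) \<longlongrightarrow> inverse L) at_top"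
      by (simp add: field_simps)
    show False
    proof (cases "e \<le> 2 * d")
      case True
      then show False using unbalanced[OF ne l] L0 by simp
    next
      case False
      then show False using unbalanced[OF _ l'] ne L0 by simp
    qed
  qed
  have "eventually (\<lambda>t::real. (2 * t) ^ e / t ^ (2 * d) = 2 ^ e) at_top"
    using eventually_gt_at_top[of 0] by (rule eventually_mono) (simp add: e d_def power_mult_distrib)
  then have "((\<lambda>t::real. (2 * t) ^ e / t ^ (2 * d)) \<longlongrightarrow> 2 ^ e) at_top"
    by (rule tendsto_eventually)
  then have "L = 2 ^ e" using tendsto_unique[OF _ lim] by simp
  then have "real_of_int \<bar>lead_coeff p\<bar> = real_of_int (2 ^ e)" using L by simp
  then show "\<bar>lead_coeff p\<bar> = 2 ^ e" by (simp only: of_int_eq_iff)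
qed

text \<open>Let \<open>M\<close> be the largest absolute value on the orbit.  Every point \<open>z\<close> satisfies
\<open>\<bar>z\<^sup>2 + t\<^sup>2\<bar> \<le> M\<close>, hence \<open>t\<^sup>2 - M \<le> \<bar>z\<bar>\<^sup>2 \<le> t\<^sup>2 + M\<close>; the upper bound at a maximal \<open>z\<close> bounds \<open>M\<close> itself.\<close>
lemma periodic_orbit_bounds:
  fixes t :: real and \<alpha> :: complex
  assumes "t \<ge> 5" "poly (quad_iter (of_real (t\<^sup>2)) n) \<alpha> = \<alpha>" "n > 0"
  shows "norm (poly (quad_iter (of_real (t\<^sup>2)) i) \<alpha>) \<le> t + 1"
    "t - 2 \<le> norm (poly (quad_iter (of_real (t\<^sup>2)) i) \<alpha>)"
proof -
  define z where "z i = poly (quad_iter (of_real (t\<^sup>2)) i) \<alpha>" for i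
  have step: "z (Suc i) = z i ^ 2 + of_real (t\<^sup>2)" for i by (simp add: z_def)
  define M where "M = Max ((\<lambda>i. norm (z i)) ` {..<n})"
  have per: "z (i mod n) = z i" for i unfolding z_def using poly_quad_iter_mod[OF assms(2)] .
  have le: "norm (z i) \<le> M" for i
  proof -
    have "norm (z (i mod n)) \<le> M" unfolding M_def using assms(3) by (intro Max_ge) auto
    then show ?thesis by (simp add: per)
  qed
  have "M \<in> (\<lambda>i. norm (z i)) ` {..<n}" unfolding M_def using assms(3) by (intro Max_in) auto
  then obtain k where k: "M = norm (z k)" by auto
  have "norm (z k ^ 2) = norm (z (Suc k) - of_real (t\<^sup>2))" by (simp add: step)
  also have "\<dots> \<le> norm (z (Suc k)) + norm (of_real (t\<^sup>2) :: complex)" by (rule norm_triangle_ineq4)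
  finally have "M\<^sup>2 \<le> norm (z (Suc k)) + t\<^sup>2" unfolding k by (simp add: norm_power)
  then have M2: "M\<^sup>2 \<le> M + t\<^sup>2" using le[of "Suc k"] by simp
  have Mt: "M \<le> t + 1"
  proof (rule ccontr)
    assume "\<not> M \<le> t + 1"
    then have "M > t + 1" by simp
    then have "M * (M - 1) > (t + 1) * t" using assms(1) by (intro mult_strict_mono) auto
    then show False using M2 assms(1) by (simp add: power2_eq_square algebra_simps)
  qed
  then show "norm (poly (quad_iter (of_real (t\<^sup>2)) i) \<alpha>) \<le> t + 1" using le[of i] by (simp add: z_def)
  have "norm (of_real (t\<^sup>2) :: complex) = norm (z (Suc i) - z i ^ 2)" by (simp add: step)
  also have "\<dots> \<le> norm (z (Suc i)) + norm (z i ^ 2)" by (rule norm_triangle_ineq4)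
  finally have "t\<^sup>2 \<le> t + 1 + (norm (z i))\<^sup>2" using le[of "Suc i"] Mt by (simp add: norm_power)
  then have "(t - 2)\<^sup>2 \<le> (norm (z i))\<^sup>2" using assms(1) by (simp add: power2_eq_square algebra_simps)
  then have "t - 2 \<le> norm (z i)" by (rule power2_le_imp_le) simp
  then show "t - 2 \<le> norm (poly (quad_iter (of_real (t\<^sup>2)) i) \<alpha>)" by (simp add: z_def)
qed

lemma prod_mset_bounds:
  fixes f :: "'a \<Rightarrow> real"
  assumes "\<And>a. a \<in># A \<Longrightarrow> l \<le> f a \<and> f a \<le> u" "0 \<le> l"
  shows "l ^ size A \<le> (\<Prod>a\<in>#A. f a) \<and> (\<Prod>a\<in>#A. f a) \<le> u ^ size A"
  using assms(1)
proof (induction A)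
  case (add a A)
  have "l ^ size A \<le> (\<Prod>a\<in>#A. f a)" "(\<Prod>a\<in>#A. f a) \<le> u ^ size A" "l \<le> f a" "f a \<le> u"
    using add by auto
  moreover have "0 \<le> (\<Prod>a\<in>#A. f a)"
    using order_trans[OF zero_le_power[OF assms(2)] \<open>l ^ size A \<le> _\<close>] .
  ultimately show ?case using assms(2) by (auto intro!: mult_mono)
qed simp

lemma prod_mset_divide:
  fixes h :: "'a \<Rightarrow> 'b::field"
  shows "(\<Prod>a\<in>#A. h a) / r ^ size A = (\<Prod>a\<in>#A. h a / r)"
proof (induction A)
  case (add x A)
  have "(\<Prod>a\<in>#add_mset x A. h a) / r ^ size (add_mset x A) = (h x / r) * ((\<Prod>a\<in>#A. h a) / r ^ size A)"
    by simp
  then show ?case unfolding add.IH by simp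
qed simp

text \<open>Each factor \<open>\<bar>x - \<lambda>\<bar>\<close> of the \<open>n\<close>-th power of the left hand side, divided by \<open>(2 * t) ^ n\<close>, lies between two
functions \<open>l\<close> and \<open>u\<close> that tend to 1.\<close>
theorem growth_multiplier_poly:
  assumes "n > 0"
  shows "growth (\<lambda>t. norm (poly (spec_multiplier_poly (of_real (t\<^sup>2)) n) x)) (num_points n)"
proof -
  define N where "N = num_points n"
  define l where "l t = (1 - 2 * inverse t) ^ n - norm x * (inverse t / 2) ^ n" for t :: real
  define u where "u t = (1 + inverse t) ^ n + norm x * (inverse t / 2) ^ n" for t :: real
  have inv: "((\<lambda>t::real. inverse t) \<longlongrightarrow> 0) at_top" by (rule tendsto_inverse_0_at_top[OF filterlim_ident])
  have "(l \<longlongrightarrow> (1 - 2 * 0) ^ n - norm x * (0 / 2) ^ n) at_top" unfolding l_def by (intro tendsto_intros inv) simp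
  then have l1: "(l \<longlongrightarrow> 1) at_top" using assms by (simp add: power_0_left)
  have "(u \<longlongrightarrow> (1 + 0) ^ n + norm x * (0 / 2) ^ n) at_top" unfolding u_def by (intro tendsto_intros inv) simp
  then have u1: "(u \<longlongrightarrow> 1) at_top" using assms by (simp add: power_0_left)
  define g where "g t = norm (poly (spec_multiplier_poly (of_real (t\<^sup>2)) n) x)" for t :: real
  have main: "l t ^ N \<le> (g t / (2 * t) ^ N) ^ n \<and> (g t / (2 * t) ^ N) ^ n \<le> u t ^ N"
    if t: "t \<ge> 5" "l t \<ge> 0" for t
  proof -
    let ?c = "of_real (t\<^sup>2) :: complex"
    let ?f = "\<lambda>\<alpha>. norm (x - multiplier ?c n \<alpha>) / (2 * t) ^ n"
    have bnd: "l t \<le> ?f \<alpha> \<and> ?f \<alpha> \<le> u t" if "\<alpha> \<in># proots (spec_dynatomic ?c n)" for \<alpha>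
    proof -
      have "poly (spec_dynatomic ?c n) \<alpha> = 0" using that spec_dynatomic_monic(3)[OF assms] by simp
      then have fx: "poly (quad_iter ?c n) \<alpha> = \<alpha>" by (rule spec_dynatomic_root_fixed[OF _ dvd_refl assms])
      have "norm (multiplier ?c n \<alpha>) = (\<Prod>i<n. 2 * norm (poly (quad_iter ?c i) \<alpha>))"
        by (simp add: multiplier_eq norm_mult flip: prod_norm)
      moreover have "(\<Prod>i<n. 2 * (t - 2)) \<le> (\<Prod>i<n. 2 * norm (poly (quad_iter ?c i) \<alpha>))"
      proof (rule prod_mono)
        fix i
        show "0 \<le> 2 * (t - 2) \<and> 2 * (t - 2) \<le> 2 * norm (poly (quad_iter ?c i) \<alpha>)"
          using mult_left_mono[OF periodic_orbit_bounds(2)[OF t(1) fx assms, of i], of 2] t(1) by simp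
      qed
      moreover have "(\<Prod>i<n. 2 * norm (poly (quad_iter ?c i) \<alpha>)) \<le> (\<Prod>i<n. 2 * (t + 1))"
      proof (rule prod_mono)
        fix i
        show "0 \<le> 2 * norm (poly (quad_iter ?c i) \<alpha>) \<and> 2 * norm (poly (quad_iter ?c i) \<alpha>) \<le> 2 * (t + 1)"
          using periodic_orbit_bounds(1)[OF t(1) fx assms, of i] by simp
      qed
      ultimately have m: "(2 * (t - 2)) ^ n \<le> norm (multiplier ?c n \<alpha>)" "norm (multiplier ?c n \<alpha>) \<le> (2 * (t + 1)) ^ n"
        by simp_all
      have "norm (x - multiplier ?c n \<alpha>) \<le> norm x + norm (multiplier ?c n \<alpha>)" by (rule norm_triangle_ineq4)
      moreover have "norm (multiplier ?c n \<alpha>) - norm x \<le> norm (x - multiplier ?c n \<alpha>)"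
        using norm_triangle_ineq2[of "multiplier ?c n \<alpha>" x] by (simp add: norm_minus_commute)
      ultimately have b: "(2 * (t - 2)) ^ n - norm x \<le> norm (x - multiplier ?c n \<alpha>)"
        "norm (x - multiplier ?c n \<alpha>) \<le> (2 * (t + 1)) ^ n + norm x" using m by linarith+
      have r1: "2 * (t - 2) = 2 * t * (1 - 2 * inverse t)" "2 * (t + 1) = 2 * t * (1 + inverse t)"
        using t(1) by (simp_all add: field_simps)
      have r2: "norm x = (2 * t) ^ n * (norm x * (inverse t / 2) ^ n)"
      proof -
        have "(2 * t) ^ n * (inverse t / 2) ^ n = 1"
          using t(1) by (subst power_mult_distrib[symmetric]) simp
        then show ?thesis by (metis mult.left_commute mult.right_neutral)
      qed
      have e1: "(2 * (t - 2)) ^ n - norm x = (2 * t) ^ n * l t"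
      proof -
        have "(2 * (t - 2)) ^ n = (2 * t) ^ n * (1 - 2 * inverse t) ^ n"
          unfolding r1 by (rule power_mult_distrib)
        then show ?thesis
          by (simp only: l_def right_diff_distrib[of "(2 * t) ^ n"] r2[symmetric])
      qed
      have e2: "(2 * (t + 1)) ^ n + norm x = (2 * t) ^ n * u t"
      proof -
        have "(2 * (t + 1)) ^ n = (2 * t) ^ n * (1 + inverse t) ^ n"
          unfolding r1 by (rule power_mult_distrib)
        then show ?thesis
          by (simp only: u_def distrib_left[of "(2 * t) ^ n"] r2[symmetric])
      qed
      have "(2 * t) ^ n > 0" using t(1) by simp
      then show ?thesis using b unfolding e1 e2 by (simp add: field_simps)
    qed
    have "(g t / (2 * t) ^ N) ^ n = (\<Prod>\<alpha>\<in>#proots (spec_dynatomic ?c n). ?f \<alpha>)"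
    proof -
      have "g t ^ n = norm (\<Prod>\<alpha>\<in>#proots (spec_dynatomic ?c n). x - multiplier ?c n \<alpha>)"
        unfolding g_def poly_spec_multiplier_poly_power[OF assms, symmetric] by (simp add: norm_power)
      also have "\<dots> = (\<Prod>\<alpha>\<in>#proots (spec_dynatomic ?c n). norm (x - multiplier ?c n \<alpha>))"
      proof -
        have "norm (\<Prod>a\<in>#A. h a) = (\<Prod>a\<in>#A. norm (h a :: complex))" for A and h :: "complex \<Rightarrow> complex"
          by (induction A) (auto simp: norm_mult)
        then show ?thesis .
      qed
      finally have "g t ^ n / ((2 * t) ^ n) ^ N = (\<Prod>\<alpha>\<in>#proots (spec_dynatomic ?c n). norm (x - multiplier ?c n \<alpha>)) / ((2 * t) ^ n) ^ N"
        by simp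
      also have "\<dots> = (\<Prod>\<alpha>\<in>#proots (spec_dynatomic ?c n). ?f \<alpha>)"
      proof -
        show ?thesis
          using prod_mset_divide[of "\<lambda>\<alpha>. norm (x - multiplier ?c n \<alpha>)" "proots (spec_dynatomic ?c n)" "(2 * t) ^ n"]
          by (simp only: size_proots_spec_dynatomic[OF assms] N_def)
      qed
      finally show ?thesis by (simp only: power_divide power_mult[symmetric] mult.commute[of n N])
    qed
    then show ?thesis
      using prod_mset_bounds[of "proots (spec_dynatomic ?c n)" "l t" ?f "u t", OF bnd t(2)]
      by (simp add: size_proots_spec_dynatomic[OF assms] N_def)
  qed
  have ev: "eventually (\<lambda>t. t \<ge> 5 \<and> l t \<ge> 0) at_top"
  proof -
    have "eventually (\<lambda>t. 0 < l t) at_top" by (rule order_tendstoD(1)[OF l1]) simp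
    with eventually_ge_at_top[of 5] show ?thesis by eventually_elim simp
  qed
  have "((\<lambda>t. (g t / (2 * t) ^ N) ^ n) \<longlongrightarrow> 1) at_top"
  proof (rule tendsto_sandwich)
    show "((\<lambda>t. l t ^ N) \<longlongrightarrow> 1) at_top" using tendsto_power[OF l1, of N] by simp
    show "((\<lambda>t. u t ^ N) \<longlongrightarrow> 1) at_top" using tendsto_power[OF u1, of N] by simp
    show "eventually (\<lambda>t. l t ^ N \<le> (g t / (2 * t) ^ N) ^ n) at_top"
      "eventually (\<lambda>t. (g t / (2 * t) ^ N) ^ n \<le> u t ^ N) at_top"
      by (rule eventually_mono[OF ev], use main in blast)+
  qed
  then have "((\<lambda>t. root n ((g t / (2 * t) ^ N) ^ n)) \<longlongrightarrow> root n 1) at_top"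
    by (rule tendsto_real_root)
  moreover have "eventually (\<lambda>t. root n ((g t / (2 * t) ^ N) ^ n) = g t / (2 * t) ^ N) at_top"
    using eventually_ge_at_top[of 0]
    by (rule eventually_mono) (use assms in \<open>auto simp: g_def real_root_power_cancel\<close>)
  ultimately have "((\<lambda>t. g t / (2 * t) ^ N) \<longlongrightarrow> root n 1) at_top"
    by (rule Lim_transform_eventually)
  then show ?thesis using assms unfolding growth_def g_def N_def by simp
qed

lemma growth_Delta_proper:
  assumes "n = r * m" "n > 0"
  shows "growth (\<lambda>t. norm (eval_at (of_real (t\<^sup>2)) (Delta_proper n m))) (totient r * num_points m)"
proof -
  have r: "r > 0" "m > 0" using assms by (auto intro: Nat.gr0I)
  have "growth (\<lambda>t. \<Prod>\<zeta>\<in>prim_roots r. norm (poly (spec_multiplier_poly (of_real (t\<^sup>2)) m) \<zeta>)) (\<Sum>\<zeta>\<in>prim_roots r. num_points m)"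
    by (intro growth_prod growth_multiplier_poly r(2))
  then show ?thesis
    unfolding eval_at_Delta_proper[OF assms] using card_prim_roots[OF r(1)] by (simp add: prod_norm)
qed

lemma growth_multiplier_poly_1:
  assumes "n > 0"
  shows "growth (\<lambda>t. norm (eval_at (of_real (t\<^sup>2)) (poly (multiplier_poly n) 1))) (num_points n)"
  unfolding eval_at_poly_multiplier by (rule growth_multiplier_poly[OF assms])

section \<open>Counting periodic points\<close>

definition proper_divisors :: "nat \<Rightarrow> nat set" where
  "proper_divisors n = {k. k dvd n \<and> k \<noteq> n}"

lemma proper_divisors:
  assumes "n > 0"
  shows "finite (proper_divisors n)" "{k. k dvd n} = insert n (proper_divisors n)" "n \<notin> proper_divisors n"
  using assms unfolding proper_divisors_def by auto

lemma proper_divisor_bounds: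
  assumes "d \<in> proper_divisors n" "n > 0"
  shows "1 \<le> d" "d \<le> n div 2" "n div d > 1" "n = (n div d) * d" "n div d > 0"
proof -
  obtain r where r: "n = r * d" "d \<noteq> n" using assms(1) by (auto simp: proper_divisors_def mult.commute elim: dvdE)
  have "r > 0" "d > 0" using r assms(2) by (auto intro: Nat.gr0I)
  moreover have "r \<noteq> 1" using r by auto
  ultimately have r2: "r \<ge> 2" by simp
  then have "2 * d \<le> n" unfolding r(1) by (rule mult_right_mono) simp
  then show "1 \<le> d" "d \<le> n div 2" using \<open>d > 0\<close> by auto
  show "n div d > 1" "n = (n div d) * d" "n div d > 0" using r(1) \<open>d > 0\<close> r2 by auto
qed

lemma num_points_rec: "n > 0 \<Longrightarrow> num_points n + (\<Sum>d\<in>proper_divisors n. num_points d) = 2 ^ n"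
  using sum_num_points[of n] proper_divisors[of n] by simp

lemma proper_divisors_filter:
  assumes "n > 0"
  shows "proper_divisors n = set (filter (\<lambda>d. d dvd n) [1..<n])"
proof -
  have "d dvd n \<and> d \<noteq> n \<longleftrightarrow> d dvd n \<and> 1 \<le> d \<and> d < n" for d
  proof (cases "d dvd n")
    case True
    then have "d \<le> n" "d \<noteq> 0" using assms by (auto dest: dvd_imp_le)
    then show ?thesis by linarith
  qed simp
  then show ?thesis unfolding proper_divisors_def by auto
qed

lemma proper_divisors_small:
  "proper_divisors 1 = {}" "proper_divisors 2 = {1}" "proper_divisors 3 = {1}" "proper_divisors 4 = {1, 2}"
  "proper_divisors 5 = {1}" "proper_divisors 6 = {1, 2, 3}" "proper_divisors 7 = {1}" "proper_divisors 8 = {1, 2, 4}"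
  by (simp_all only: proper_divisors_filter zero_less_one zero_less_numeral) code_simp+

lemma num_points_small:
  "num_points 1 = 2" "num_points 2 = 2" "num_points 3 = 6" "num_points 4 = 12"
  "num_points 5 = 30" "num_points 6 = 54" "num_points 7 = 126" "num_points 8 = 240"
proof -
  show 1: "num_points 1 = 2" using num_points_rec[of 1] by (simp add: proper_divisors_small del: One_nat_def)
  show 2: "num_points 2 = 2" using num_points_rec[of 2] 1 by (simp add: proper_divisors_small del: One_nat_def)
  show 3: "num_points 3 = 6" using num_points_rec[of 3] 1 by (simp add: proper_divisors_small del: One_nat_def)
  show 4: "num_points 4 = 12" using num_points_rec[of 4] 1 2 by (simp add: proper_divisors_small del: One_nat_def)
  show "num_points 5 = 30" using num_points_rec[of 5] 1 by (simp add: proper_divisors_small del: One_nat_def)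
  show "num_points 6 = 54" using num_points_rec[of 6] 1 2 3 by (simp add: proper_divisors_small del: One_nat_def)
  show "num_points 7 = 126" using num_points_rec[of 7] 1 by (simp add: proper_divisors_small del: One_nat_def)
  show "num_points 8 = 240" using num_points_rec[of 8] 1 2 4 by (simp add: proper_divisors_small del: One_nat_def)
qed

lemma totient_rec: "n > 0 \<Longrightarrow> totient n + (\<Sum>d\<in>proper_divisors n. totient d) = n"
  using totient_divisor_sum[of n] proper_divisors[of n] by simp

lemma totient_small:
  "totient 2 = 1" "totient 3 = 2" "totient 4 = 2" "totient 5 = 4" "totient 6 = 2" "totient 7 = 6" "totient 8 = 4"
proof -
  show 2: "totient 2 = 1" using totient_rec[of 2] by (simp add: proper_divisors_small del: One_nat_def)
  show 3: "totient 3 = 2" using totient_rec[of 3] by (simp add: proper_divisors_small del: One_nat_def)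
  show 4: "totient 4 = 2" using totient_rec[of 4] 2 by (simp add: proper_divisors_small del: One_nat_def)
  show "totient 5 = 4" using totient_rec[of 5] by (simp add: proper_divisors_small del: One_nat_def)
  show "totient 6 = 2" using totient_rec[of 6] 2 3 by (simp add: proper_divisors_small del: One_nat_def)
  show "totient 7 = 6" using totient_rec[of 7] by (simp add: proper_divisors_small del: One_nat_def)
  show "totient 8 = 4" using totient_rec[of 8] 2 4 by (simp add: proper_divisors_small del: One_nat_def)
qed

lemma num_points_le: "n > 0 \<Longrightarrow> num_points n \<le> 2 ^ n"
  using num_points_rec[of n] by simp

lemma sum_powers_2: "(\<Sum>d = 1..h. 2 ^ d :: nat) + 2 = 2 ^ (h + 1)"
  by (induction h) auto

text \<open>Proper divisors of \<open>n\<close> are at most \<open>n / 2\<close>.\<close>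
lemma num_points_ge:
  assumes "n > 0"
  shows "2 ^ n + 2 \<le> num_points n + 2 ^ (n div 2 + 1)"
proof -
  have "(\<Sum>d\<in>proper_divisors n. num_points d) \<le> (\<Sum>d\<in>proper_divisors n. 2 ^ d)"
    by (rule sum_mono) (use proper_divisor_bounds(1)[OF _ assms] in \<open>auto intro!: num_points_le simp: Suc_le_eq\<close>)
  also have "\<dots> \<le> (\<Sum>d = 1..n div 2. 2 ^ d)"
    by (rule sum_mono2) (use proper_divisor_bounds(1,2)[OF _ assms] in auto)
  finally show ?thesis using num_points_rec[OF assms] sum_powers_2[of "n div 2"] by simp
qed

lemma num_points_pos:
  assumes "n > 0"
  shows "num_points n > 0"
proof -
  have "n div 2 + 1 \<le> n" using assms by simp
  then have "(2::nat) ^ (n div 2 + 1) \<le> 2 ^ n" by (intro power_increasing) auto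
  then show ?thesis using num_points_ge[OF assms] by simp
qed

lemma num_points_ge_16:
  assumes "n \<ge> 5"
  shows "num_points n \<ge> 16"
proof -
  have "(2::nat) ^ (n div 2 + 1) \<le> 2 ^ (n - 1)" using assms by (intro power_increasing) auto
  moreover have "(2::nat) ^ n = 2 * 2 ^ (n - 1)" using assms by (simp flip: power_Suc)
  moreover have "(2::nat) ^ 4 \<le> 2 ^ (n - 1)" using assms by (intro power_increasing) auto
  ultimately show ?thesis using num_points_ge[of n] assms by simp
qed

text \<open>\<open>num_points d / d\<close> is the number of cycles of length \<open>d\<close>.  As \<open>num_points d\<close> is close to \<open>2 ^ d\<close>, it nearly doubles
from \<open>d\<close> to \<open>d + 1\<close>; the error term is at most \<open>2 ^ (d - 2)\<close> for \<open>d \<ge> 6\<close>.\<close>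
lemma num_points_ratio_step:
  assumes "d \<ge> 2"
  shows "num_points d * (d + 1) < num_points (d + 1) * d"
proof (cases "d \<ge> 6")
  case True
  define k where "k = d - 2"
  have k: "d = k + 2" using True by (simp add: k_def)
  have "(d + 1) div 2 + 1 \<le> k" using True by (simp add: k_def)
  then have "(2::nat) ^ ((d + 1) div 2 + 1) \<le> 2 ^ k" by (intro power_increasing) auto
  moreover have p: "(2::nat) ^ d = 4 * 2 ^ k" "(2::nat) ^ (d + 1) = 8 * 2 ^ k"
    by (simp_all add: k power_add)
  ultimately have "7 * 2 ^ k \<le> num_points (d + 1)"
    using num_points_ge[of "d + 1"] by linarith
  then have "7 * 2 ^ k * d \<le> num_points (d + 1) * d" by (rule mult_right_mono) simp
  moreover have "num_points d * (d + 1) \<le> 4 * 2 ^ k * (d + 1)"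
    using num_points_le[of d] True p(1) by (intro mult_right_mono) auto
  moreover have "4 * (2::nat) ^ k * (d + 1) < 7 * 2 ^ k * d"
  proof -
    have "4 * (d + 1) < 7 * d" using True by simp
    then have "2 ^ k * (4 * (d + 1)) < (2::nat) ^ k * (7 * d)"
      by (rule mult_strict_left_mono) simp
    then show ?thesis by (simp only: mult_ac)
  qed
  ultimately show ?thesis by linarith
next
  case False
  then have "d = 2 \<or> d = 3 \<or> d = 4 \<or> d = 5" using assms by auto
  then show ?thesis using num_points_small by auto
qed

lemma num_points_ratio_strict_mono:
  assumes "2 \<le> d" "d < e"
  shows "num_points d * e < num_points e * d"
proof -
  have "num_points d * (d + Suc i) < num_points (d + Suc i) * d" for i
  proof (induction i)
    case 0
    then show ?case using num_points_ratio_step[OF assms(1)] by simp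
  next
    case (Suc i)
    define e where "e = d + Suc i"
    have e: "e \<ge> 2" "e > 0" "d > 0" using assms(1) by (auto simp: e_def)
    have "(num_points d * e) * (e + 1) < (num_points e * d) * (e + 1)"
      using Suc unfolding e_def[symmetric] by (intro mult_strict_right_mono) auto
    also have "\<dots> = (num_points e * (e + 1)) * d" by (simp only: mult_ac)
    also have "\<dots> < (num_points (e + 1) * e) * d"
      using num_points_ratio_step[OF e(1)] e(3) by (intro mult_strict_right_mono) auto
    finally have "(num_points d * (e + 1)) * e < (num_points (e + 1) * d) * e" by (simp only: mult_ac)
    then have "num_points d * (e + 1) < num_points (e + 1) * d" using mult_less_cancel2 by blast
    then show ?case by (simp add: e_def)
  qed
  moreover obtain i where "e = d + Suc i" using assms(2) by (metis less_iff_Suc_add add_Suc_right)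
  ultimately show ?thesis by blast
qed

section \<open>Integral polynomials over the rationals\<close>

abbreviation rat_poly :: "int poly \<Rightarrow> rat poly" where "rat_poly \<equiv> map_poly rat_of_int"

lemma rat_poly_smult: "rat_poly (smult m q) = smult (of_int m) (rat_poly q)"
  by (rule poly_eqI) (simp add: coeff_map_poly)

lemma map_of_rat_rat_poly: "map_poly of_rat (rat_poly p) = (map_poly of_int p :: complex poly)"
  by (rule poly_eqI) (simp add: coeff_map_poly)

lemma irreducible_dvd_of_common_root:
  fixes p q :: "rat poly" and x :: complex
  assumes "irreducible p" "poly (map_poly of_rat p) x = 0" "poly (map_poly of_rat q) x = 0"
  shows "p dvd q"
proof (rule ccontr)
  assume "\<not> p dvd q"
  then have "coprime p q" using prime_elem_imp_coprime[OF field_poly_irreducible_imp_prime[OF assms(1)]] by blast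
  then have "fst (bezout_coefficients p q) * p + snd (bezout_coefficients p q) * q = 1"
    using bezout_coefficients_fst_snd[of p q] by simp
  then obtain a b where "a * p + b * q = 1" by blast
  then have e: "poly (map_poly of_rat (a * p + b * q)) x = 1" by simp
  interpret r: map_poly_comm_ring_hom "of_rat :: rat \<Rightarrow> complex" ..
  show False using e assms(2,3) by (simp add: r.hom_add r.hom_mult)
qed

lemma clear_denominators: "\<exists>m s'. m \<noteq> 0 \<and> smult (of_int m) s = rat_poly s'"
proof (induction s)
  case 0
  show ?case by (rule exI[of _ 1], rule exI[of _ 0]) simp
next
  case (pCons a s)
  then obtain m s' where ms: "m \<noteq> 0" "smult (of_int m) s = rat_poly s'" by blast
  obtain x y where xy: "a = of_int x / of_int y" "y \<noteq> 0"
  proof -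
    obtain x y where "quotient_of a = (x, y)" by force
    then show ?thesis using that[of x y] quotient_of_div quotient_of_denom_pos by force
  qed
  have "smult (of_int (m * y)) (pCons a s) = pCons (of_int (m * x)) (smult (of_int y) (smult (of_int m) s))"
    using xy by (simp add: mult_ac)
  also have "\<dots> = rat_poly (pCons (m * x) (smult y s'))"
    unfolding ms(2) by (simp add: of_int_hom.map_poly_pCons_hom rat_poly_smult)
  finally show ?case using ms(1) xy(2) by (intro exI[of _ "m * y"] exI[of _ "pCons (m * x) (smult y s')"]) simp
qed

text \<open>Gauss's lemma, for the rational numbers instead of an abstract field of fractions.\<close>
lemma primitive_dvd_descends:
  fixes p q :: "int poly"
  assumes "content p = 1" "rat_poly p dvd rat_poly q"
  shows "p dvd q"
proof -
  obtain s where s: "rat_poly q = rat_poly p * s" using assms(2) by (elim dvdE)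
  obtain m s' where m: "m \<noteq> 0" "smult (of_int m) s = rat_poly s'" using clear_denominators by blast
  have "rat_poly (smult m q) = rat_poly (p * s')"
    by (simp add: rat_poly_smult s of_int_poly_hom.hom_mult flip: m(2))
  then have e: "smult m q = p * s'" by (simp only: of_int_poly_hom.eq_iff)
  have "content (smult m q) = content s'" unfolding e by (simp add: content_mult assms(1))
  moreover have "m dvd content (smult m q)" by simp
  ultimately have "[:m:] dvd s'" by (simp add: const_poly_dvd_iff_dvd_content)
  then obtain u where "s' = [:m:] * u" by (elim dvdE)
  then have u: "s' = smult m u" by simp
  have "smult m q = smult m (p * u)" using e u by simp
  then have "q = p * u" using m(1) by (simp add: smult_cancel)
  then show ?thesis by simp
qed

lemma eval_at_rat_poly: "eval_at \<gamma> p = poly (map_poly of_rat (rat_poly p)) \<gamma>"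
  by (simp add: eval_at_def map_of_rat_rat_poly)

lemma degree_of_root:
  fixes p :: "int poly"
  assumes "irreducible (rat_poly p)" "eval_at \<gamma> p = 0" "has_degree_over_rat \<gamma> d"
  shows "degree p = d"
proof -
  obtain q :: "rat poly" where q: "irreducible q" "poly (map_poly of_rat q) \<gamma> = 0" "degree q = d"
    using assms(3) by (auto simp: has_degree_over_rat_def)
  have r: "poly (map_poly of_rat (rat_poly p)) \<gamma> = 0" using assms(2) by (simp add: eval_at_rat_poly)
  have d1: "q dvd rat_poly p" "rat_poly p dvd q"
    using irreducible_dvd_of_common_root assms(1) q r by blast+
  have ne: "q \<noteq> 0" "rat_poly p \<noteq> 0" using q(1) assms(1) by auto
  have "degree q = degree (rat_poly p)"
    using dvd_imp_degree_le[OF d1(1) ne(2)] dvd_imp_degree_le[OF d1(2) ne(1)] by simp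
  then show ?thesis using q(3) by simp
qed

lemma exists_complex_root:
  assumes "degree p > 0"
  shows "\<exists>\<gamma>. eval_at \<gamma> p = 0"
  using alg_closed_imp_poly_has_root[of "map_poly of_int p :: complex poly"] assms
  by (simp add: eval_at_def)

section \<open>The factorisation of the multiplier polynomial at 1\<close>

lemma degree_Delta_proper:
  assumes "d \<in> proper_divisors n" "n > 0"
  shows "2 * degree (Delta_proper n d) = totient (n div d) * num_points d"
    "\<bar>lead_coeff (Delta_proper n d)\<bar> = 2 ^ (totient (n div d) * num_points d)"
    "degree (Delta_proper n d) > 0"
proof -
  note b = proper_divisor_bounds[OF assms]
  show *: "2 * degree (Delta_proper n d) = totient (n div d) * num_points d"
    "\<bar>lead_coeff (Delta_proper n d)\<bar> = 2 ^ (totient (n div d) * num_points d)"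
    using growth_poly_degree[OF growth_Delta_proper[OF b(4) assms(2)]] by simp_all
  have "totient (n div d) * num_points d > 0"
    using b num_points_pos[of d] by simp
  then show "degree (Delta_proper n d) > 0" using *(1) by linarith
qed

lemma odd_cyclotomic_value:
  assumes "r > 1" "even x"
  shows "odd (poly (cyclotomic_poly r) x)"
proof
  assume "even (poly (cyclotomic_poly r) x)"
  then have "2 dvd x ^ r - 1"
    by (rule dvd_trans[OF _ cyclotomic_value_dvd]) (use assms(1) in simp)
  then show False using assms by simp
qed

lemma odd_Delta_proper_at_0:
  assumes "d \<in> proper_divisors n" "n > 0"
  shows "odd (coeff (Delta_proper n d) 0)"
proof (cases "d = 1")
  case True
  then have "n > 1" using assms by (auto simp: proper_divisors_def)
  then have "odd \<bar>coeff (Delta_proper n d) 0\<bar>"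
    using Delta_proper_1_at_0[OF assms(2)] odd_cyclotomic_value[of n 2] True by simp
  then show ?thesis by simp
next
  case False
  note b = proper_divisor_bounds[OF assms]
  have d: "d > 1" using b(1) False by simp
  have "odd (\<bar>poly (cyclotomic_poly (n div d)) (2 ^ d)\<bar> ^ num_points d)"
    using odd_cyclotomic_value[OF b(3), of "2 ^ d"] d by simp
  then have "odd (\<bar>coeff (Delta_proper n d) 0\<bar> ^ d)"
    using Delta_proper_at_0[OF b(4) assms(2) d] by simp
  then show ?thesis using d by simp
qed

text \<open>The leading coefficient is a power of 2 up to sign and the constant coefficient is odd.\<close>
lemma content_Delta_proper:
  assumes "d \<in> proper_divisors n" "n > 0"
  shows "content (Delta_proper n d) = 1"
proof -
  let ?c = "content (Delta_proper n d)"
  have "?c dvd coeff (Delta_proper n d) 0" by (rule content_dvd_coeff)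
  then have "odd ?c" using odd_Delta_proper_at_0[OF assms] dvd_trans by blast
  then have "coprime ?c (2 ^ (totient (n div d) * num_points d))" by simp
  moreover have "?c dvd 2 ^ (totient (n div d) * num_points d)"
    using content_dvd_coeff[of "Delta_proper n d" "degree (Delta_proper n d)"] degree_Delta_proper(2)[OF assms]
    by (metis dvd_abs_iff)
  ultimately have "is_unit ?c" by (meson coprime_common_divisor dvd_refl)
  then show ?thesis by (metis is_unit_normalize normalize_content)
qed

lemma Delta_proper_dvd_at_1:
  assumes "d \<in> proper_divisors n" "n > 0" "irreducible (rat_poly (Delta_proper n d))"
  shows "rat_poly (Delta_proper n d) dvd rat_poly (poly (multiplier_poly n) 1)"
proof -
  note b = proper_divisor_bounds[OF assms(1,2)]
  obtain \<gamma> where g: "eval_at \<gamma> (Delta_proper n d) = 0"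
    using exists_complex_root[OF degree_Delta_proper(3)[OF assms(1,2)]] by blast
  then have "\<exists>\<zeta>\<in>prim_roots (n div d). poly (spec_multiplier_poly \<gamma> d) \<zeta> = 0"
    unfolding eval_at_Delta_proper[OF b(4) assms(2)] using finite_prim_roots[OF b(5)] by (simp add: prod_zero_iff)
  then obtain \<zeta> where z: "\<zeta> \<in> prim_roots (n div d)" "poly (spec_multiplier_poly \<gamma> d) \<zeta> = 0" by blast
  have "poly (spec_multiplier_poly \<gamma> n) 1 = 0"
    using satellite_collision[OF b(3) _ z] b(1) b(4)[symmetric] by simp
  then have "eval_at \<gamma> (poly (multiplier_poly n) 1) = 0" by (simp add: eval_at_poly_multiplier)
  then show ?thesis
    using irreducible_dvd_of_common_root[OF assms(3)] g
    by (simp only: eval_at_rat_poly)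
qed

text \<open>The constant coefficient contains a primitive prime divisor of \<open>2 ^ n - 1\<close> once for every cycle of length \<open>d\<close>, up
to the common factor \<open>multiplicity (int p) (2 ^ n - 1)\<close>.  For \<open>d = 1\<close> the fixed point 0 does not count.\<close>
lemma prime_valuation_Delta_proper:
  fixes p :: nat
  assumes p: "prime p" "int p dvd 2 ^ n - 1" "\<And>k. 0 < k \<Longrightarrow> k < n \<Longrightarrow> \<not> int p dvd 2 ^ k - 1"
    and d: "d \<in> proper_divisors n" "n > 0"
  shows "d * multiplicity (int p) (coeff (Delta_proper n d) 0)
       = (if d = 1 then 1 else num_points d) * multiplicity (int p) (2 ^ n - 1)"
proof -
  note b = proper_divisor_bounds[OF d]
  have pe: "prime_elem (int p)" using p(1) by simp
  have abs: "multiplicity (int p) \<bar>x\<bar> = multiplicity (int p) x" for x :: int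
    by (simp add: abs_if)
  have ne: "(2 ^ n - 1 :: int) \<noteq> 0" using one_less_power[of "2::int" n] d(2) by simp
  show ?thesis
  proof (cases "d = 1")
    case True
    have "multiplicity (int p) (coeff (Delta_proper n 1) 0) = multiplicity (int p) (poly (cyclotomic_poly n) 2)"
      using abs Delta_proper_1_at_0[OF d(2)] by metis
    also have "\<dots> = multiplicity (int p) (2 ^ n - 1)"
      using multiplicity_cyclotomic_primitive[OF p, of n 1] d(2) by simp
    finally show ?thesis using True by simp
  next
    case False
    then have d1: "d > 1" using b(1) by simp
    have m: "multiplicity (int p) (poly (cyclotomic_poly (n div d)) (2 ^ d)) = multiplicity (int p) (2 ^ n - 1)"
      using multiplicity_cyclotomic_primitive[OF p b(4) d(2)] .
    have nz: "poly (cyclotomic_poly (n div d)) (2 ^ d) \<noteq> (0::int)"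
      using odd_cyclotomic_value[OF b(3), of "2 ^ d"] d1 by auto
    have c0: "coeff (Delta_proper n d) 0 \<noteq> 0" using odd_Delta_proper_at_0[OF d] by auto
    have "multiplicity (int p) (\<bar>coeff (Delta_proper n d) 0\<bar> ^ d)
        = multiplicity (int p) (\<bar>poly (cyclotomic_poly (n div d)) (2 ^ d)\<bar> ^ num_points d)"
      using Delta_proper_at_0[OF b(4) d(2) d1] by simp
    then have "d * multiplicity (int p) (coeff (Delta_proper n d) 0) = num_points d * multiplicity (int p) (2 ^ n - 1)"
      using pe nz c0 by (simp add: prime_elem_multiplicity_power_distrib abs m)
    then show ?thesis using False by simp
  qed
qed

text \<open>A fixed point with multiplier \<open>l\<close> exists for \<open>\<gamma> = l / 2 - (l / 2)\<^sup>2\<close>, and the cycle of length 2 has multiplier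
\<open>4 * (\<gamma> + 1)\<close>.  Both have absolute value 1 only for \<open>l = -1\<close>: this is the point where the main cardioid of the
Mandelbrot set touches the disc to its left, and it belongs to \<open>n = 2\<close>.\<close>
lemma common_satellite_1_2:
  assumes "even n" "n > 2" "eval_at \<gamma> (Delta_proper n 1) = 0" "eval_at \<gamma> (Delta_proper n 2) = 0"
  shows False
proof -
  have n0: "n > 0" using assms(2) by simp
  define r where "r = n div 2"
  have r: "n = r * 2" "r > 1" using assms(1,2) by (auto simp: r_def)
  have "\<exists>\<zeta>\<in>prim_roots n. poly (spec_multiplier_poly \<gamma> 1) \<zeta> = 0"
    using assms(3) eval_at_Delta_proper[of n n 1 \<gamma>] n0 finite_prim_roots[OF n0] by (simp add: prod_zero_iff)
  then obtain l where l: "l \<in> prim_roots n" "poly (spec_multiplier_poly \<gamma> 1) l = 0" by blast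
  have "\<exists>\<zeta>\<in>prim_roots r. poly (spec_multiplier_poly \<gamma> 2) \<zeta> = 0"
    using assms(4) eval_at_Delta_proper[OF r(1) n0, of \<gamma>] finite_prim_roots[of r] r by (simp add: prod_zero_iff)
  then obtain m where m: "m \<in> prim_roots r" "poly (spec_multiplier_poly \<gamma> 2) m = 0" by blast
  obtain a where a: "poly (spec_dynatomic \<gamma> 1) a = 0" "multiplier \<gamma> 1 a = l"
    using l(2) spec_multiplier_poly_zero_iff[of 1] by auto
  have la: "l = 2 * a" using a(2) by (simp add: multiplier_eq)
  have ga: "\<gamma> = a - a\<^sup>2" using a(1) unfolding spec_dynatomic_1 by (simp add: algebra_simps power2_eq_square)
  obtain b where b: "poly (spec_dynatomic \<gamma> 2) b = 0" "multiplier \<gamma> 2 b = m"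
    using m(2) spec_multiplier_poly_zero_iff[of 2] by auto
  have m1: "m \<noteq> 1" using prim_root_neq_1[OF m(1) r(2)] .
  have "b \<in> periodic_points \<gamma> 2" using simple_multiplier_exact_period[of 2 \<gamma> b] b m1 by simp
  then have "poly (quad_iter \<gamma> 2) b = b" "poly (quad_iter \<gamma> 1) b \<noteq> b" by (auto simp: periodic_points_def)
  then have b2: "(b\<^sup>2 + \<gamma>)\<^sup>2 + \<gamma> = b" "b\<^sup>2 + \<gamma> \<noteq> b" by (simp_all add: numeral_2_eq_2)
  define b' where "b' = b\<^sup>2 + \<gamma>"
  have "b'\<^sup>2 + \<gamma> = b" "b\<^sup>2 + \<gamma> = b'" using b2(1) by (simp_all add: b'_def)
  then have e: "b'\<^sup>2 = b - \<gamma>" "b\<^sup>2 = b' - \<gamma>" by (simp_all only: eq_diff_eq)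
  \<comment> \<open>\<open>b\<close> and \<open>b'\<close> are the two points of the cycle of length 2; their sum is \<open>- 1\<close>.\<close>
  have "(b' - b) * (b' + b + 1) = b'\<^sup>2 - b\<^sup>2 + (b' - b)"
    by (simp add: algebra_simps power2_eq_square)
  also have "\<dots> = 0" unfolding e by simp
  finally have "b' + b + 1 = 0" using b2(2) by (simp add: b'_def[symmetric])
  moreover have "b' = (b' + b + 1) - 1 - b" by simp
  ultimately have b': "b' = - 1 - b" by simp
  have "b * b' = - b - b\<^sup>2" unfolding b' by (simp add: algebra_simps power2_eq_square)
  also have "\<dots> = \<gamma> + 1" unfolding e(2) b' by simp
  finally have bb: "b * b' = \<gamma> + 1" .
  have "multiplier \<gamma> 2 b = (2 * b) * (2 * b')"
    by (simp add: multiplier_eq numeral_2_eq_2 b'_def algebra_simps)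
  then have "m = 4 * (b * b')" using b(2) by simp
  then have ml: "m = 4 + 2 * l - l\<^sup>2" unfolding bb ga la by (simp add: power2_eq_square algebra_simps)
  have nm: "norm m = 1" "norm l = 1" using norm_prim_root[OF m(1)] norm_prim_root[OF l(1) n0] r(2) by auto
  \<comment> \<open>In real coordinates \<open>\<bar>4 + 2 * l - l\<^sup>2\<bar> = 1 = \<bar>l\<bar>\<close> becomes a quadratic equation for the real part of \<open>l\<close>.\<close>
  define x y where "x = Re l" and "y = Im l"
  have xy: "x\<^sup>2 + y\<^sup>2 = 1" using nm(2) cmod_power2[of l] by (simp add: x_def y_def)
  have "(Re m)\<^sup>2 + (Im m)\<^sup>2 = 1" using nm(1) cmod_power2[of m] by simp
  moreover have "Re m = 4 + 2 * x - (x\<^sup>2 - y\<^sup>2)" "Im m = 2 * y - 2 * x * y"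
    unfolding ml x_def y_def by (simp_all add: power2_eq_square)
  ultimately have "(4 + 2 * x - (x\<^sup>2 - y\<^sup>2))\<^sup>2 + (2 * y - 2 * x * y)\<^sup>2 = 1" by simp
  moreover have y2: "y\<^sup>2 = 1 - x\<^sup>2" using xy by simp
  moreover have "(2 * y - 2 * x * y)\<^sup>2 = y\<^sup>2 * (2 - 2 * x)\<^sup>2" by (simp add: power2_eq_square algebra_simps)
  ultimately have "(4 + 2 * x - (x\<^sup>2 - (1 - x\<^sup>2)))\<^sup>2 + (1 - x\<^sup>2) * (2 - 2 * x)\<^sup>2 = 1" by simp
  moreover have "(4 + 2 * x - (x\<^sup>2 - (1 - x\<^sup>2)))\<^sup>2 + (1 - x\<^sup>2) * (2 - 2 * x)\<^sup>2 = 1 - 4 * ((x + 1) * (4 * x - 7))"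
    by (simp add: power2_eq_square algebra_simps)
  ultimately have "(x + 1) * (4 * x - 7) = 0" by simp
  moreover have "x \<le> 1" using complex_Re_le_cmod[of l] nm(2) by (simp add: x_def)
  ultimately have "x = - 1" by auto
  then have "y = 0" using xy by simp
  then have "l = - 1" using \<open>x = - 1\<close> by (simp add: x_def y_def complex_eq_iff)
  then have "l ^ 2 = 1" by simp
  then have "n dvd 2" using prim_root_power_eq_1_iff[OF l(1) n0] by blast
  then have "n \<le> 2" by (rule dvd_imp_le) simp
  then show False using assms(2) by simp
qed

text \<open>Associated primitive polynomials have the same constant coefficient up to sign, so by
\<open>prime_valuation_Delta_proper\<close> the cycles of lengths \<open>d\<close> and \<open>e\<close> are equally many.  That leaves \<open>d = 1\<close>, \<open>e = 2\<close>,
and \<open>n = 6\<close>, where no primitive prime divisor exists but the degrees 2 and 3 differ.\<close>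
lemma Delta_proper_not_associated:
  assumes "d \<in> proper_divisors n" "e \<in> proper_divisors n" "d < e" "n > 0"
    and dv: "rat_poly (Delta_proper n d) dvd rat_poly (Delta_proper n e)"
      "rat_poly (Delta_proper n e) dvd rat_poly (Delta_proper n d)"
  shows False
proof -
  let ?p = "Delta_proper n d" and ?q = "Delta_proper n e"
  note bd = proper_divisor_bounds[OF assms(1,4)] and be = proper_divisor_bounds[OF assms(2,4)]
  have "?p dvd ?q" "?q dvd ?p"
    using primitive_dvd_descends content_Delta_proper assms by blast+
  then have c: "\<bar>coeff ?p 0\<bar> = \<bar>coeff ?q 0\<bar>" and dg: "degree ?p = degree ?q"
  proof -
    obtain u where u: "?q = ?p * u" using \<open>?p dvd ?q\<close> by (elim dvdE)
    obtain v where v: "?p = ?q * v" using \<open>?q dvd ?p\<close> by (elim dvdE)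
    have "coeff ?q 0 = coeff ?p 0 * coeff u 0" "coeff ?p 0 = coeff ?q 0 * coeff v 0"
      using u v by (metis coeff_mult_0)+
    then show "\<bar>coeff ?p 0\<bar> = \<bar>coeff ?q 0\<bar>" by (metis dvd_triv_left zdvd_antisym_abs)
    have "?p \<noteq> 0" "?q \<noteq> 0" using degree_Delta_proper(3) assms by fastforce+
    then show "degree ?p = degree ?q" using \<open>?p dvd ?q\<close> \<open>?q dvd ?p\<close> by (simp add: dvd_imp_degree_le le_antisym)
  qed
  have "n \<noteq> 1" using assms(1) by (auto simp: proper_divisors_def)
  then have n1: "n > 1" using assms(4) by simp
  show False
  proof (cases "d = 1 \<and> e = 2")
    case True
    obtain \<gamma> where g: "eval_at \<gamma> ?p = 0"
      using exists_complex_root[OF degree_Delta_proper(3)[OF assms(1,4)]] by blast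
    have "eval_at \<gamma> ?q = 0" using \<open>?p dvd ?q\<close> g by (auto simp: ev.hom_mult elim: dvdE)
    moreover have "even n" "n > 2" using assms(2) True n1 by (auto simp: proper_divisors_def)
    ultimately show False using common_satellite_1_2[of n \<gamma>] g True by simp
  next
    case ne: False
    show False
    proof (cases "n = 6")
      case False
      obtain p where p: "prime p" "int p dvd 2 ^ n - 1" "\<And>k. 0 < k \<Longrightarrow> k < n \<Longrightarrow> \<not> int p dvd 2 ^ k - 1"
        using exists_primitive_prime_divisor[OF n1 False] by blast
      define v where "v = multiplicity (int p) (2 ^ n - 1)"
      have "(2 ^ n - 1 :: int) \<noteq> 0" using one_less_power[of "2::int" n] assms(4) by simp
      then have v: "v > 0" unfolding v_def using p(1,2) by (subst multiplicity_gt_zero_iff) auto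
      define w where "w = multiplicity (int p) (coeff ?p 0)"
      have "multiplicity (int p) \<bar>x\<bar> = multiplicity (int p) x" for x :: int by (simp add: abs_if)
      then have w': "w = multiplicity (int p) (coeff ?q 0)" unfolding w_def using c by metis
      have eqs: "d * w = (if d = 1 then 1 else num_points d) * v" "e * w = (if e = 1 then 1 else num_points e) * v"
        using prime_valuation_Delta_proper[OF p assms(1,4)] prime_valuation_Delta_proper[OF p assms(2,4)]
        unfolding w_def[symmetric] w'[symmetric] v_def[symmetric] by blast+
      show False
      proof (cases "d = 1")
        case True
        then have "w = v" "e > 2" using eqs(1) assms(3) ne by auto
        then have "e = num_points e" using eqs(2) v by simp
        moreover have "num_points 2 * e < num_points e * 2"
          using num_points_ratio_strict_mono[of 2 e] \<open>e > 2\<close> by simp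
        ultimately show False using num_points_small(2) by simp
      next
        case False
        then have d2: "2 \<le> d" using bd(1) by simp
        have "(num_points d * e) * v = (d * w) * e" using eqs(1) False by simp
        also have "\<dots> = (num_points e * d) * v" using eqs(2) d2 assms(3) by (simp add: mult_ac)
        finally have "num_points d * e = num_points e * d" using v by simp
        then show False using num_points_ratio_strict_mono[OF d2 assms(3)] by simp
      qed
    next
      case True
      have "d \<in> {1, 2, 3}" "e \<in> {1, 2, 3}" using assms(1,2) unfolding True proper_divisors_small by auto
      then have e3: "e = 3" "d = 1 \<or> d = 2" using assms(3) ne by auto
      have "totient (n div d) * num_points d = 4" "totient (n div e) * num_points e = 6"
        using e3 num_points_small(1-3) totient_small by (auto simp: True)
      then have "2 * degree ?p = 4" "2 * degree ?q = 6"
        using degree_Delta_proper(1)[OF assms(1,4)] degree_Delta_proper(1)[OF assms(2,4)] by simp_all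
      then show False using dg by simp
    qed
  qed
qed

text \<open>Pairwise coprime divisors over the rationals; the product is primitive, so the quotient is integral.\<close>
theorem prod_Delta_proper_dvd:
  assumes n: "n > 0" and irr: "\<And>d. d \<in> proper_divisors n \<Longrightarrow> irreducible (rat_poly (Delta_proper n d))"
  shows "(\<Prod>d\<in>proper_divisors n. Delta_proper n d) dvd poly (multiplier_poly n) 1"
proof -
  let ?q = "poly (multiplier_poly n) 1"
  have cop: "coprime (rat_poly (Delta_proper n d)) (rat_poly (Delta_proper n e))"
    if de: "d \<in> proper_divisors n" "e \<in> proper_divisors n" "d \<noteq> e" for d e
  proof (rule ccontr)
    assume nc: "\<not> coprime (rat_poly (Delta_proper n d)) (rat_poly (Delta_proper n e))"
    have "rat_poly (Delta_proper n d) dvd rat_poly (Delta_proper n e)"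
      using nc prime_elem_imp_coprime[OF field_poly_irreducible_imp_prime[OF irr[OF de(1)]]] by blast
    moreover have "rat_poly (Delta_proper n e) dvd rat_poly (Delta_proper n d)"
      using nc prime_elem_imp_coprime[OF field_poly_irreducible_imp_prime[OF irr[OF de(2)]]] by (metis coprime_commute)
    ultimately show False
      using Delta_proper_not_associated[of d n e] Delta_proper_not_associated[of e n d] de n
      by (metis linorder_neqE_nat)
  qed
  have "(\<Prod>d\<in>A. rat_poly (Delta_proper n d)) dvd rat_poly ?q" if "A \<subseteq> proper_divisors n" for A
  proof -
    have "finite A" using that proper_divisors(1)[OF n] finite_subset by blast
    then show ?thesis using that
    proof (induction A rule: finite_induct)
      case (insert a A)
      have "coprime (rat_poly (Delta_proper n a)) (\<Prod>d\<in>A. rat_poly (Delta_proper n d))"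
        using insert.hyps insert.prems by (intro prod_coprime_right cop) auto
      then show ?case
        using insert Delta_proper_dvd_at_1[OF _ n irr, of a] by (simp add: divides_mult)
    qed simp
  qed
  from this[of "proper_divisors n"] have "rat_poly (\<Prod>d\<in>proper_divisors n. Delta_proper n d) dvd rat_poly ?q"
    by (simp add: of_int_poly_hom.hom_prod)
  moreover have "content (\<Prod>d\<in>A. Delta_proper n d) = 1" if "A \<subseteq> proper_divisors n" for A
  proof -
    have "finite A" using that proper_divisors(1)[OF n] finite_subset by blast
    then show ?thesis using that
      by (induction A rule: finite_induct) (auto simp: content_mult content_Delta_proper[OF _ n])
  qed
  ultimately show ?thesis using primitive_dvd_descends by blast
qed

lemma Delta_self:
  assumes n: "n > 0" and irr: "\<And>d. d \<in> proper_divisors n \<Longrightarrow> irreducible (rat_poly (Delta_proper n d))"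
  shows "poly (multiplier_poly n) 1 = Delta n n * (\<Prod>d\<in>proper_divisors n. Delta_proper n d)"
proof -
  let ?P = "\<Prod>d\<in>proper_divisors n. Delta_proper n d"
  have P0: "?P \<noteq> 0" using degree_Delta_proper(3)[OF _ n] proper_divisors(1)[OF n] by (fastforce simp: prod_zero_iff)
  obtain D where D: "poly (multiplier_poly n) 1 = D * ?P"
    using prod_Delta_proper_dvd[OF n irr] by (metis dvdE mult.commute)
  have "Delta n n = (THE D. poly (multiplier_poly n) 1 = D * ?P)"
    by (simp add: Delta_def proper_divisors_def)
  also have "\<dots> = D" using D P0 by (intro the_equality) auto
  finally show ?thesis using D by simp
qed

lemma degree_Delta_self:
  assumes n: "n > 0" and irr: "\<And>d. d \<in> proper_divisors n \<Longrightarrow> irreducible (rat_poly (Delta_proper n d))"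
  shows "2 * degree (Delta n n) + (\<Sum>d\<in>proper_divisors n. totient (n div d) * num_points d) = num_points n"
proof -
  let ?q = "poly (multiplier_poly n) 1"
  have q: "num_points n = 2 * degree ?q" "\<bar>lead_coeff ?q\<bar> = 2 ^ num_points n"
    using growth_poly_degree[OF growth_multiplier_poly_1[OF n]] by auto
  have "?q \<noteq> 0" using q(2) by auto
  have self: "?q = Delta n n * (\<Prod>d\<in>proper_divisors n. Delta_proper n d)"
    by (rule Delta_self[OF n irr])
  have ne: "Delta n n \<noteq> 0" "(\<Prod>d\<in>proper_divisors n. Delta_proper n d) \<noteq> 0"
    using \<open>?q \<noteq> 0\<close> unfolding self by auto
  have "degree ?q = degree (Delta n n) + (\<Sum>d\<in>proper_divisors n. degree (Delta_proper n d))"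
    unfolding self degree_mult_eq[OF ne]
    using ne(2) proper_divisors(1)[OF n] by (subst degree_prod_sum_eq) (auto simp: prod_zero_iff)
  moreover have "2 * (\<Sum>d\<in>proper_divisors n. degree (Delta_proper n d)) = (\<Sum>d\<in>proper_divisors n. totient (n div d) * num_points d)"
    unfolding sum_distrib_left using degree_Delta_proper(1)[OF _ n] by (intro sum.cong) auto
  ultimately show ?thesis using q(1) by simp
qed

section \<open>Degrees of parabolic parameters\<close>

text \<open>For \<open>m \<le> 2\<close> the totient would have to be 5 or 7, but totients greater than 1 are even.\<close>
lemma satellite_degree_excluded:
  assumes "e > 0" "m > 0"
  shows "totient e * num_points m \<noteq> 10 \<and> totient e * num_points m \<noteq> 14"
proof -
  have t: "totient e > 0" using assms(1) by simp
  consider "m \<ge> 5" | "num_points m = 2" | "num_points m = 6" | "num_points m = 12"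
  proof -
    have "m = 1 \<or> m = 2 \<or> m = 3 \<or> m = 4 \<or> m \<ge> 5" using assms(2) by linarith
    then show ?thesis using num_points_small(1-4) that by metis
  qed
  then show ?thesis
  proof cases
    case 1
    then have "1 * 16 \<le> totient e * num_points m"
      using t num_points_ge_16 by (intro mult_le_mono) (simp_all add: Suc_le_eq)
    then show ?thesis by linarith
  next
    case 2
    have "totient e \<noteq> 5 \<and> totient e \<noteq> 7"
    proof (cases "e > 2")
      case True
      then have "even (totient e)" by (rule totient_even)
      then show ?thesis by auto
    next
      case False
      then have "e = 1 \<or> e = 2" using assms(1) by auto
      then show ?thesis using totient_small(1) by auto
    qed
    then show ?thesis unfolding 2 by presburger
  next
    case 3
    show ?thesis unfolding 3 by presburger
  next
    case 4
    show ?thesis unfolding 4 by presburger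
  qed
qed

lemma exponential_bound:
  fixes n :: nat
  assumes "n \<ge> 9"
  shows "(n + 1) * 2 ^ (n div 2 + 1) + 15 \<le> (2::nat) ^ n"
proof -
  define h where "h = n div 2"
  have big: "4 * k + 7 \<le> (2::nat) ^ k" if "k \<ge> 5" for k
    using that by (induction k rule: dec_induct) auto
  show ?thesis
  proof (cases "even n")
    case True
    then have n: "n = 2 * h" by (simp add: h_def)
    then have "h \<ge> 5" using assms by simp
    then have b: "4 * h + 3 \<le> 2 ^ h" "15 \<le> (2::nat) ^ h" using big[of h] by simp_all
    have "(n + 1) * 2 ^ (h + 1) + 15 \<le> (4 * h + 2) * 2 ^ h + 2 ^ h"
      using b(2) by (simp add: n algebra_simps)
    also have "\<dots> = (4 * h + 3) * 2 ^ h" by (simp add: algebra_simps)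
    also have "\<dots> \<le> 2 ^ h * 2 ^ h" using b(1) by (rule mult_right_mono) simp
    also have "\<dots> = 2 ^ n" by (simp add: n mult_2 power_add)
    finally show ?thesis by (simp add: h_def)
  next
    case False
    then have n: "n = 2 * h + 1" by (simp add: h_def)
    then have "h + 1 \<ge> 5" using assms by simp
    then have b: "4 * h + 5 \<le> 2 ^ (h + 1)" using big[of "h + 1"] by simp
    have "2 ^ 4 \<le> (2::nat) ^ h" using n assms by (intro power_increasing) auto
    then have b2: "15 \<le> (2::nat) ^ h" by simp
    have "(n + 1) * 2 ^ (h + 1) + 15 \<le> (4 * h + 4) * 2 ^ h + 2 ^ h"
      using b2 by (simp add: n algebra_simps)
    also have "\<dots> = (4 * h + 5) * 2 ^ h" by (simp add: algebra_simps)
    also have "\<dots> \<le> 2 ^ (h + 1) * 2 ^ h" using b by (rule mult_right_mono) simp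
    also have "\<dots> = 2 ^ n" by (simp only: n power_add[symmetric]) (simp add: mult_2)
    finally show ?thesis by (simp add: h_def)
  qed
qed

lemma degree_Delta_self_excluded:
  assumes n: "n > 0" and irr: "\<And>d. d \<in> proper_divisors n \<Longrightarrow> irreducible (rat_poly (Delta_proper n d))"
  shows "degree (Delta n n) \<noteq> 5 \<and> degree (Delta n n) \<noteq> 7"
proof -
  let ?S = "\<Sum>d\<in>proper_divisors n. totient (n div d) * num_points d"
  have D: "2 * degree (Delta n n) + ?S = num_points n" by (rule degree_Delta_self[OF n irr])
  show ?thesis
  proof (cases "n \<ge> 9")
    case True
    have "?S \<le> (\<Sum>d\<in>proper_divisors n. n * 2 ^ d)"
    proof (rule sum_mono)
      fix d assume d: "d \<in> proper_divisors n"
      have "totient (n div d) \<le> n div d" by (rule totient_le)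
      then have "totient (n div d) \<le> n" using div_le_dividend le_trans by blast
      moreover have "num_points d \<le> 2 ^ d" using num_points_le proper_divisor_bounds(1)[OF d n] by simp
      ultimately show "totient (n div d) * num_points d \<le> n * 2 ^ d" by (rule mult_le_mono)
    qed
    also have "\<dots> \<le> (\<Sum>d = 1..n div 2. n * 2 ^ d)"
      by (rule sum_mono2) (use proper_divisor_bounds(1,2)[OF _ n] in auto)
    also have "\<dots> = n * (\<Sum>d = 1..n div 2. 2 ^ d)" by (rule sum_distrib_left[symmetric])
    also have "\<dots> \<le> n * 2 ^ (n div 2 + 1)" using sum_powers_2[of "n div 2"] by (intro mult_left_mono) auto
    finally have "?S \<le> n * 2 ^ (n div 2 + 1)" .
    moreover have "2 ^ n + 2 \<le> num_points n + 2 ^ (n div 2 + 1)" by (rule num_points_ge[OF n])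
    moreover have "n * 2 ^ (n div 2 + 1) + 2 ^ (n div 2 + 1) + 15 \<le> 2 ^ n"
      using exponential_bound[OF True] by (simp add: algebra_simps)
    ultimately have "2 * degree (Delta n n) \<ge> 15" using D by linarith
    then show ?thesis by linarith
  next
    case False
    then have "n = 1 \<or> n = 2 \<or> n = 3 \<or> n = 4 \<or> n = 5 \<or> n = 6 \<or> n = 7 \<or> n = 8" using n by linarith
    \<comment> \<open>The degrees for \<open>n = 1, \<dots>, 8\<close> are 1, 0, 1, 3, 11, 20, 57, 108.\<close>
    then have "num_points n = ?S \<or> num_points n = ?S + 2 \<or> num_points n = ?S + 6 \<or> num_points n \<ge> ?S + 15"
      by (elim disjE) (simp_all add: proper_divisors_small num_points_small totient_small del: One_nat_def)
    then show ?thesis using D by linarith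
  qed
qed

theorem proposition6p11:
  assumes "\<And>n m :: nat. 0 < n \<Longrightarrow> 0 < m \<Longrightarrow> m dvd n \<Longrightarrow> degree (Delta n m) > 0 \<Longrightarrow>
             irreducible (map_poly rat_of_int (Delta n m))"
  shows "\<not> (\<exists>\<gamma>. parabolic_parameter \<gamma> \<and> has_degree_over_rat \<gamma> 5) \<and>
         \<not> (\<exists>\<gamma>. parabolic_parameter \<gamma> \<and> has_degree_over_rat \<gamma> 7)"
proof -
  have irr: "irreducible (rat_poly (Delta_proper n d))" if "n > 0" "d \<in> proper_divisors n" for n d
  proof -
    have d: "d dvd n" "d \<noteq> n" "d > 0"
      using that proper_divisor_bounds(1)[OF that(2,1)] by (auto simp: proper_divisors_def)
    then have e: "Delta n d = Delta_proper n d" by (simp add: Delta_def)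
    show ?thesis
      using assms[of n d] that(1) d degree_Delta_proper(3)[OF that(2,1)] unfolding e by blast
  qed
  have satellite: False
    if "n > 0" "d \<in> proper_divisors n" "eval_at \<gamma> (Delta_proper n d) = 0"
      "has_degree_over_rat \<gamma> k" "k = 5 \<or> k = 7" for n d \<gamma> k
  proof -
    have "degree (Delta_proper n d) = k" using degree_of_root[OF irr[OF that(1,2)] that(3,4)] .
    then have "totient (n div d) * num_points d = 2 * k" using degree_Delta_proper(1)[OF that(2,1)] by simp
    then show False
      using satellite_degree_excluded[of "n div d" d] proper_divisor_bounds(1,5)[OF that(2,1)] that(5) by auto
  qed
  have main: False
    if par: "parabolic_parameter \<gamma>" and deg: "has_degree_over_rat \<gamma> k" "k = 5 \<or> k = 7" for \<gamma> k
  proof -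
    obtain m \<alpha> r where m: "m > 0" "\<alpha> \<in> periodic_points \<gamma> m" "r > 0" "multiplier \<gamma> m \<alpha> ^ r = 1"
      using par unfolding parabolic_parameter_def periodic_points_def multiplier_def by blast
    obtain e where e: "e > 0" "multiplier \<gamma> m \<alpha> \<in> prim_roots e"
      using unity_root_decompose[OF m(4,3)] by blast
    have z: "poly (spec_multiplier_poly \<gamma> m) (multiplier \<gamma> m \<alpha>) = 0"
      using spec_multiplier_poly_zero_iff[OF m(1)] periodic_point_spec_dynatomic[OF m(2,1)] by blast
    show False
    proof (cases "e = 1")
      case False
      define n where "n = e * m"
      have n: "n > 0" "m \<in> proper_divisors n" using e(1) m(1) False by (auto simp: n_def proper_divisors_def)
      have "eval_at \<gamma> (Delta_proper n m) = 0"
        unfolding eval_at_Delta_proper[OF n_def n(1)] using finite_prim_roots[OF e(1)] e(2) z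
        by (intro prod_zero) auto
      then show False using satellite n deg by blast
    next
      case True
      then have "multiplier \<gamma> m \<alpha> = 1" using e(2) by (simp add: prim_roots_def)
      then have "eval_at \<gamma> (poly (multiplier_poly m) 1) = 0" using z by (simp add: eval_at_poly_multiplier)
      have self: "poly (multiplier_poly m) 1 = Delta m m * (\<Prod>d\<in>proper_divisors m. Delta_proper m d)"
        by (rule Delta_self[OF m(1) irr[OF m(1)]])
      then have "eval_at \<gamma> (Delta m m) * (\<Prod>d\<in>proper_divisors m. eval_at \<gamma> (Delta_proper m d)) = 0"
        using \<open>eval_at \<gamma> (poly (multiplier_poly m) 1) = 0\<close> by (simp only: ev.hom_mult ev.hom_prod)
      moreover have "eval_at \<gamma> (Delta_proper m d) \<noteq> 0" if "d \<in> proper_divisors m" for d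
        using satellite[OF m(1) that _ deg] by blast
      ultimately have D0: "eval_at \<gamma> (Delta m m) = 0"
        using proper_divisors(1)[OF m(1)] by (auto simp: prod_zero_iff)
      have "poly (multiplier_poly m) 1 \<noteq> 0"
        using growth_poly_degree(2)[OF growth_multiplier_poly_1[OF m(1)]] by auto
      then have "Delta m m \<noteq> 0" unfolding self by auto
      then have "degree (Delta m m) > 0"
        using D0 by (cases "degree (Delta m m) = 0") (auto simp: eval_at_const elim!: degree_eq_zeroE)
      then have "irreducible (rat_poly (Delta m m))" using assms[of m m] m(1) by simp
      then have "degree (Delta m m) = k" using degree_of_root D0 deg(1) by blast
      moreover have "degree (Delta m m) \<noteq> 5 \<and> degree (Delta m m) \<noteq> 7"
        by (rule degree_Delta_self_excluded[OF m(1) irr[OF m(1)]])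
      ultimately show False using deg(2) by blast
    qed
  qed
  show ?thesis using main by blast
qed

end
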